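(* Let $p_j,q_j\in(0,\infty]$, $j=0,1,2$, let $\vartheta_j\in\mathscr P(\mathbf R^{2d})$, $j=0,1,2$, and suppose $\omega_j\in\mathscr P(\mathbf R^{4d})$, $j=0,1,2$, are given by $$\omega_0(X,Y)=\frac{\vartheta_2(X-Y)}{\vartheta_0(X+Y)},\quad \omega_1(X,Y)=\frac{\vartheta_2(X-Y)}{\vartheta_1(X+Y)},\quad \omega_2(X,Y)=\frac{\vartheta_1(X-Y)}{\vartheta_0(X+Y)},\qquad X,Y\in\mathbf R^{2d}.$$ If $$\|a\# b\|_{\mathcal M^{p_0,q_0}_{(\omega_0)}}\lesssim\|a\|_{\mathcal M^{p_1,q_1}_{(\omega_1)}}\|b\|_{\mathcal M^{p_2,q_2}_{(\omega_2)}},\qquad a,b\in\mathscr S(\mathbf R^{2d}),$$ then $$\frac1{p_0}\le\frac1{p_1}+\frac1{p_2},\quad \frac1{p_0}\le\frac1{q_1}+\frac1{q_2}\quad\text{and}\quad q_1,q_2\le q_0.$$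
   Context: Notation: $f(\theta)\lesssim g(\theta)$ means $f(\theta)\le c\,g(\theta)$ for some constant $c>0$ uniformly in all $\theta$ (here: uniformly in $a,b$). $1/\infty=0$. $\mathscr S$ is the Schwartz space. Weights: a weight on $\mathbf R^n$ is a positive $\omega\in L^\infty_{loc}(\mathbf R^n)$ with $1/\omega\in L^\infty_{loc}(\mathbf R^n)$. $\mathscr P(\mathbf R^n)$ is the set of weights that are polynomially moderate, i.e. $\omega(x+y)\lesssim\omega(x)v(y)$ for $x,y\in\mathbf R^n$ for some positive polynomial $v$. Weyl product: the Weyl quantization of $a$ is $\operatorname{Op}^w(a)f(x)=(2\pi)^{-d}\iint_{\mathbf R^{2d}}a\big(\tfrac{x+y}2,\xi\big)f(y)e^{i\langle x-y,\xi\rangle}\,dy\,d\xi$, and the Weyl product $a\#b$ is defined by $\operatorname{Op}^w(a\#b)=\operatorname{Op}^w(a)\circ\operatorname{Op}^w(b)$. Gelfand--Shilov space: $\mathcal S_{1/2}(\mathbf R^n)$ is the space of $f\in C^\infty(\mathbf R^n)$ for which there is $h>0$ with $\sup_{\alpha,\beta,x}\frac{|x^\beta\partial^\alpha f(x)|}{h^{|\alpha|+|\beta|}(\alpha!\beta!)^{1/2}}<\infty$, with inductive limit topology (with respect to $h$); $\mathcal S_{1/2}'(\mathbf R^n)$ is its topological dual. Symplectic modulation spaces: the symplectic form is $\sigma(X,Y)=\langle y,\xi\rangle-\langle x,\eta\rangle$ for $X=(x,\xi)$, $Y=(y,\eta)\in\mathbf R^{2d}$; the symplectic Fourier transform is $\mathscr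 F_\sigma a(X)=\pi^{-d}\int_{\mathbf R^{2d}}a(Y)e^{2i\sigma(X,Y)}dY$, extended to distributions; the symplectic short-time Fourier transform of $a\in\mathcal S_{1/2}'(\mathbf R^{2d})$ with window $\Phi\in\mathcal S_{1/2}(\mathbf R^{2d})\setminus0$ is $\mathcal V_\Phi a(X,Y)=\mathscr F_\sigma(a\,\overline{\Phi(\cdot-X)})(Y)$, $X,Y\in\mathbf R^{2d}$. For $p,q\in(0,\infty]$, a weight $\omega\in\mathscr P(\mathbf R^{4d})$ and a fixed such $\Phi$, $\mathcal M^{p,q}_{(\omega)}(\mathbf R^{2d})$ is the space of all $a\in\mathcal S_{1/2}'(\mathbf R^{2d})$ with $\|a\|_{\mathcal M^{p,q}_{(\omega)}}=\Big(\int\big(\int|\mathcal V_\Phi a(X,Y)\,\omega(X,Y)|^p\,dX\big)^{q/p}dY\Big)^{1/q}<\infty$ (obvious modification for infinite exponents); different windows give equivalent quasi-norms. *)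

theory Defs
  imports "HOL-Analysis.Analysis" "HOL-Probability.Essential_Supremum"
begin

text \<open>
  The space \<open>R\<^sup>d\<close> is rendered by a Euclidean space \<open>'a\<close> with \<open>d = DIM('a)\<close>; accordingly
  \<open>R\<^sup>2\<^sup>d\<close> is \<open>'a \<times> 'a\<close> and \<open>R\<^sup>4\<^sup>d\<close> is \<open>('a \<times> 'a) \<times> ('a \<times> 'a)\<close>.
\<close>

section \<open>Weights\<close>

definition locally_ess_bounded :: "('a::euclidean_space \<Rightarrow> real) \<Rightarrow> bool" where
  "locally_ess_bounded f \<longleftrightarrow> f \<in> borel_measurable lebesgue \<and>
     (\<forall>K. compact K \<longrightarrow> (\<exists>C. AE x in lebesgue. x \<in> K \<longrightarrow> \<bar>f x\<bar> \<le> C))"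

definition weight :: "('a::euclidean_space \<Rightarrow> real) \<Rightarrow> bool" where
  "weight \<omega> \<longleftrightarrow> (\<forall>x. \<omega> x > 0) \<and> locally_ess_bounded \<omega> \<and> locally_ess_bounded (\<lambda>x. 1 / \<omega> x)"

definition poly_moderate_weights :: "('a::euclidean_space \<Rightarrow> real) set" where
  "poly_moderate_weights = {\<omega>. weight \<omega> \<and>
     (\<exists>v. real_polynomial_function v \<and> (\<forall>y. v y > 0) \<and>
       (\<exists>C>0. \<forall>x y. \<omega> (x + y) \<le> C * (\<omega> x * v y)))}"


section \<open>Smooth, Schwartz and Gelfand--Shilov functions\<close>

text \<open>
  A partial derivative \<open>\<partial>\<^sup>\<alpha>\<close> is described by the list of basis vectors along which one
  differentiates. The multi-index \<open>\<alpha>\<close> belonging to the list \<open>bs\<close> is \<open>count_list bs\<close>, and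
  \<open>\<bar>\<alpha>\<bar> = length bs\<close>. For smooth functions the order of the list is irrelevant, so
  quantifying over all lists amounts to quantifying over all multi-indices.
\<close>

definition partial_deriv ::
    "'a::euclidean_space \<Rightarrow> ('a \<Rightarrow> complex) \<Rightarrow> 'a \<Rightarrow> complex" where
  "partial_deriv b f x = frechet_derivative f (at x) b"

definition iter_partial_deriv ::
    "'a::euclidean_space list \<Rightarrow> ('a \<Rightarrow> complex) \<Rightarrow> 'a \<Rightarrow> complex" where
  "iter_partial_deriv bs f = foldr partial_deriv bs f"

definition smooth :: "('a::euclidean_space \<Rightarrow> complex) \<Rightarrow> bool" where
  "smooth f \<longleftrightarrow> (\<forall>bs\<in>lists Basis. iter_partial_deriv bs f differentiable_on UNIV)"

definition multi_monom :: "('a::euclidean_space \<Rightarrow> nat) \<Rightarrow> 'a \<Rightarrow> real" where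
  "multi_monom \<beta> x = (\<Prod>b\<in>Basis. (x \<bullet> b) ^ \<beta> b)"

definition multi_fact :: "('a::euclidean_space \<Rightarrow> nat) \<Rightarrow> real" where
  "multi_fact \<beta> = (\<Prod>b\<in>Basis. fact (\<beta> b))"

definition multi_size :: "('a::euclidean_space \<Rightarrow> nat) \<Rightarrow> nat" where
  "multi_size \<beta> = (\<Sum>b\<in>Basis. \<beta> b)"

definition schwartz_space :: "('a::euclidean_space \<Rightarrow> complex) set" where
  "schwartz_space = {f. smooth f \<and>
     (\<forall>bs\<in>lists Basis. \<forall>\<beta>. \<exists>C. \<forall>x. norm (multi_monom \<beta> x * iter_partial_deriv bs f x) \<le> C)}"

definition gelfand_shilov_half :: "('a::euclidean_space \<Rightarrow> complex) set" where
  "gelfand_shilov_half = {f. smooth f \<and>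
     (\<exists>h>0. \<exists>C. \<forall>bs\<in>lists Basis. \<forall>\<beta> x.
        norm (multi_monom \<beta> x * iter_partial_deriv bs f x) /
          (h ^ (length bs + multi_size \<beta>) * sqrt (multi_fact (count_list bs) * multi_fact \<beta>)) \<le> C)}"


section \<open>The Weyl product\<close>

definition weyl_op ::
    "('a::euclidean_space \<times> 'a \<Rightarrow> complex) \<Rightarrow> ('a \<Rightarrow> complex) \<Rightarrow> 'a \<Rightarrow> complex" where
  "weyl_op a f x = complex_of_real (1 / (2 * pi) ^ DIM('a)) *
     (LINT (y, \<xi>)|lborel. a ((1/2) *\<^sub>R (x + y), \<xi>) * f y * exp (\<i> * complex_of_real ((x - y) \<bullet> \<xi>)))"

text \<open>
  For Schwartz symbols \<open>a\<close> and \<open>b\<close>, the symbol of the composition is again a Schwartz function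
  and is determined by the action of the operator on Schwartz functions.
\<close>

definition weyl_product ::
    "('a::euclidean_space \<times> 'a \<Rightarrow> complex) \<Rightarrow> ('a \<times> 'a \<Rightarrow> complex) \<Rightarrow> 'a \<times> 'a \<Rightarrow> complex"
    (infixl \<open>#\<^sub>w\<close> 70) where
  "a #\<^sub>w b = (THE c. c \<in> schwartz_space \<and>
     (\<forall>f\<in>schwartz_space. weyl_op c f = weyl_op a (weyl_op b f)))"


section \<open>Symplectic modulation space quasi-norms\<close>

definition symp :: "'a::euclidean_space \<times> 'a \<Rightarrow> 'a \<times> 'a \<Rightarrow> real" where
  "symp X Y = fst Y \<bullet> snd X - fst X \<bullet> snd Y"

definition symp_fourier ::
    "('a::euclidean_space \<times> 'a \<Rightarrow> complex) \<Rightarrow> 'a \<times> 'a \<Rightarrow> complex" where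
  "symp_fourier a X = complex_of_real (1 / pi ^ DIM('a)) *
     (LINT Y|lborel. a Y * exp (2 * \<i> * complex_of_real (symp X Y)))"

definition symp_stft ::
    "('a::euclidean_space \<times> 'a \<Rightarrow> complex) \<Rightarrow> ('a \<times> 'a \<Rightarrow> complex) \<Rightarrow>
     'a \<times> 'a \<Rightarrow> 'a \<times> 'a \<Rightarrow> complex" where
  "symp_stft \<Phi> a X Y = symp_fourier (\<lambda>Z. a Z * cnj (\<Phi> (Z - X))) Y"

text \<open>Positive real powers on \<open>[0, \<infinity>]\<close>; only used for \<open>r > 0\<close>.\<close>

definition ennpowr :: "ennreal \<Rightarrow> real \<Rightarrow> ennreal" where
  "ennpowr x r = (if x = \<infinity> then \<infinity> else ennreal (enn2real x powr r))"

definition Lp_qnorm :: "ennreal \<Rightarrow> ('b::euclidean_space \<Rightarrow> ennreal) \<Rightarrow> ennreal" where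
  "Lp_qnorm p F =
     (if p = \<infinity> then esssup lebesgue F
      else ennpowr (\<integral>\<^sup>+ x. ennpowr (F x) (enn2real p) \<partial>lebesgue) (1 / enn2real p))"

text \<open>
  The \<open>M\<^sup>p\<^sup>,\<^sup>q\<close> quasi-norm with weight \<open>\<omega>\<close> and window \<open>\<Phi>\<close>, for symbols \<open>a\<close> that are
  functions. On these, the distributional short-time Fourier transform is the integral above.
\<close>

definition modulation_qnorm ::
    "('a::euclidean_space \<times> 'a \<Rightarrow> complex) \<Rightarrow> ennreal \<Rightarrow> ennreal \<Rightarrow>
     (('a \<times> 'a) \<times> ('a \<times> 'a) \<Rightarrow> real) \<Rightarrow> ('a \<times> 'a \<Rightarrow> complex) \<Rightarrow> ennreal" where
  "modulation_qnorm \<Phi> p q \<omega> a =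
     Lp_qnorm q (\<lambda>Y. Lp_qnorm p (\<lambda>X. ennreal (norm (symp_stft \<Phi> a X Y * \<omega> (X, Y)))))"

end

theory Submission
  imports Defs "HOL-Probability.Probability"
begin

text \<open>
  The Gaussian symbol \<open>A\<^sub>x\<^sub>y(q, \<xi>) = exp (- \<bar>q - (x + y)/2\<bar>\<^sup>2 - \<bar>\<xi>\<bar>\<^sup>2 - i \<langle>x - y, \<xi>\<rangle>)\<close> quantizes to a multiple of
  the rank-one operator \<open>f \<mapsto> \<langle>f, g\<^sub>y\<rangle> g\<^sub>x\<close>, where \<open>g\<^sub>x\<close> is the Gaussian centred at \<open>x\<close>. Hence, up to a
  factor, \<open>A\<^sub>x\<^sub>y # A\<^sub>y\<^sub>'\<^sub>z = exp (- \<bar>y - y'\<bar>\<^sup>2/4) A\<^sub>x\<^sub>z\<close>, and widely spaced Gaussians multiply like matrix units.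
  The short-time Fourier transform of \<open>A\<^sub>x\<^sub>y\<close> decays rapidly away from the point \<open>(X, Y)\<close> with
  \<open>X - Y = (x, 0)\<close> and \<open>X + Y = (y, 0)\<close>, so the three weights, being quotients, are absorbed into the
  coefficients \<open>\<vartheta>'(y, 0)/\<vartheta>(x, 0)\<close> of the matrix units. A sum of \<open>N\<close> normalised, widely
  spaced matrix units has norm of order \<open>N\<^bsup>1/p\<^esup>\<close> if they lie on the diagonal and \<open>N\<^bsup>1/q\<^esup>\<close> if they lie on \<open>N\<close>
  different diagonals. With \<open>x\<^sub>i = i R u\<close> the four inequalities come from the matrix products
  \<open>(\<Sum> E\<^sub>x\<^sub>x)(\<Sum> E\<^sub>x\<^sub>x)\<close>, \<open>(\<Sum> E\<^sub>x\<^sub>,\<^sub>-\<^sub>x)(\<Sum> E\<^sub>-\<^sub>x\<^sub>,\<^sub>x)\<close>, \<open>(\<Sum> E\<^sub>x\<^sub>0) E\<^sub>0\<^sub>0\<close> and \<open>E\<^sub>0\<^sub>0 (\<Sum> E\<^sub>0\<^sub>x)\<close>, as \<open>N \<rightarrow> \<infinity>\<close> with \<open>R\<close> growing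
  fast enough to make the cross terms negligible.
\<close>


section \<open>Integration on Euclidean spaces and Fourier inversion\<close>

text \<open>The exponents may lie below 1, so norms of sums cannot be handled by the triangle
  inequality. Instead, \<open>sum_decay_le\<close> dominates a sum of widely separated bumps
  pointwise by twice one of them, for every exponent, at the price of one extra order of decay. The
  lower bound is pointwise as well: on a ball near the centre of each main term, all other terms
  together amount to at most half of it. There are fewer than |I||J| others, each of size O(1/R),
  which is why R is taken proportional to |I||J|. The window is arbitrary, so the transform of the
  Gaussian has no closed formula. Upper estimates use its rapid decay, obtained by integrating by
  parts; the lower one uses a ball on which it stays away from 0, found through uniqueness of the
  Fourier transform. Since \<open>#\<^sub>w\<close> is a definite description, the multiplication
  rule for the matrix units also needs injectivity of the Weyl quantization. All constants are fixed
  before the number N of atoms and the spacing R, so growth in N compares exponents.\<close>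

definition decay :: "real \<Rightarrow> 'a::real_normed_vector \<Rightarrow> real" where
  "decay s x = (1 + norm x) powr (- s)"

lemma one_plus_norm_pos: "0 < 1 + norm x"
  by (smt (verit) norm_ge_zero)

lemma decay_pos [simp]: "decay s x > 0"
  unfolding decay_def by (smt (verit) norm_ge_zero powr_gt_zero)

lemma decay_nonneg [simp]: "decay s x \<ge> 0"
  using decay_pos[of s x] by linarith

lemma decay_le_1: "s \<ge> 0 \<Longrightarrow> decay s x \<le> 1"
  unfolding decay_def by (simp add: powr_le_one_le powr_minus_divide divide_le_eq ge_one_powr_ge_zero)

lemma decay_0 [simp]: "decay 0 x = 1"
  unfolding decay_def using one_plus_norm_pos[of x] by simp

text \<open>Orders are arbitrary reals so that raising a bound to the power p, as in the L^p
  estimates below, stays inside the family.\<close>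

lemma decay_powr: "decay s x powr p = decay (s * p) x"
  by (simp add: decay_def powr_powr)

lemma decay_add: "decay (s + t) x = decay s x * decay t x"
  by (simp add: decay_def powr_add[symmetric])

lemma decay_antimono: "s \<le> t \<Longrightarrow> decay t x \<le> decay s x"
  unfolding decay_def by (intro powr_mono) auto

lemma decay_mono_norm: "s \<ge> 0 \<Longrightarrow> norm x \<le> norm y \<Longrightarrow> decay s y \<le> decay s x"
  unfolding decay_def by (intro powr_mono2') (auto intro: add_pos_nonneg)

lemma decay_uminus [simp]: "decay s (- x) = decay s x"
  by (simp add: decay_def)

lemma decay_minus_commute: "decay s (x - y) = decay s (y - x)"
  by (simp add: decay_def norm_minus_commute)

lemma decay_nat: "decay (real M) x = 1 / (1 + norm x) ^ M"
proof -
  have "1 + norm x > 0" by (smt (verit) norm_ge_zero)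
  then show ?thesis
    unfolding decay_def by (simp add: powr_minus_divide powr_realpow)
qed

text \<open>By the triangle inequality (1 + |x - y|)(1 + |y|) dominates 1 + |x|, and negative powers
  reverse this. The estimate trades decay in y and in x - y for decay in x.\<close>

lemma decay_Peetre:
  assumes "s \<ge> 0"
  shows "decay s (x - y) * decay s y \<le> decay s x"
proof -
  have pos: "1 + norm (x - y) > 0" "1 + norm y > 0" "1 + norm x > 0"
    by (smt (verit) norm_ge_zero)+
  have "norm x \<le> norm (x - y) + norm y"
    using norm_triangle_ineq[of "x - y" y] by simp
  then have "1 + norm x \<le> (1 + norm (x - y)) * (1 + norm y)"
    using mult_nonneg_nonneg[OF norm_ge_zero[of "x-y"] norm_ge_zero[of y]] unfolding distrib_left distrib_right by linarith
  then have "((1 + norm (x - y)) * (1 + norm y)) powr (-s) \<le> (1 + norm x) powr (-s)"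
    using assms pos by (intro powr_mono2') auto
  then show ?thesis
    using pos by (simp add: decay_def powr_mult)
qed

lemma continuous_on_decay [continuous_intros]:
  "continuous_on A f \<Longrightarrow> continuous_on A (\<lambda>x. decay s (f x))"
  unfolding decay_def
  by (intro continuous_intros ballI less_imp_neq[OF one_plus_norm_pos, symmetric])

lemma borel_measurable_decay [measurable]: "decay s \<in> borel_measurable borel"
  by (intro borel_measurable_continuous_onI continuous_intros)


lemma nn_integral_real_decay_finite: "(\<integral>\<^sup>+x. ennreal (decay 2 (x::real)) \<partial>lborel) < \<infinity>"
proof -
  define g :: "real \<Rightarrow> ennreal" where "g x = ennreal (1 / (1 + x)^2) * indicator {0..} x" for x
  have [measurable]: "g \<in> borel_measurable borel" unfolding g_def by measurable
  have lim: "((\<lambda>x::real. - (1 / (1 + x))) \<longlongrightarrow> 0) at_top"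
    by real_asymp
  have "(\<integral>\<^sup>+x. g x \<partial>lborel) = ennreal (0 - (- (1 / (1 + 0))))"
    unfolding g_def
    by (rule nn_integral_FTC_atLeast[OF _ _ _ lim])
       (auto intro!: derivative_eq_intros simp: power2_eq_square)
  then have g1: "(\<integral>\<^sup>+x. g x \<partial>lborel) = 1" by simp
  then have g2: "(\<integral>\<^sup>+x. g (- x) \<partial>lborel) = 1"
    using nn_integral_real_affine[of g "-1" 0] by simp
  have "(\<integral>\<^sup>+x. ennreal (decay 2 (x::real)) \<partial>lborel) \<le> (\<integral>\<^sup>+x. g x + g (- x) \<partial>lborel)"
  proof (rule nn_integral_mono)
    fix x :: real
    have e: "decay 2 x = 1 / (1 + \<bar>x\<bar>)^2" using decay_nat[of 2 x] by simp
    show "ennreal (decay 2 x) \<le> g x + g (- x)"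
      unfolding e g_def by (cases "x \<ge> 0") (auto simp: indicator_def)
  qed
  also have "\<dots> = 2" by (simp add: nn_integral_add g1 g2)
  finally show ?thesis by (simp add: order_le_less_trans)
qed

text \<open>With order 2d, (1 + |x|)^(-2d) splits into d factors (1 + |x|)^(-2), each at most (1 +
  |x_b|)^(-2) for its own coordinate, and the integral factors. The order 2d recurs below as the
  decay reserved for integrability.\<close>

lemma nn_integral_decay_finite:
  fixes s :: real
  assumes "s \<ge> 2 * DIM('a)"
  shows "(\<integral>\<^sup>+x. ennreal (decay s (x::'a::euclidean_space)) \<partial>lborel) < \<infinity>"
proof -
  have "(\<integral>\<^sup>+x. ennreal (decay s (x::'a)) \<partial>lborel) \<le> (\<integral>\<^sup>+x. (\<Prod>b\<in>Basis. ennreal (decay 2 ((x::'a) \<bullet> b))) \<partial>lborel)"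
  proof (rule nn_integral_mono)
    fix x :: 'a
    have "decay s x \<le> decay (real (2 * DIM('a))) x"
      using assms by (intro decay_antimono) simp
    also have "\<dots> = (\<Prod>b\<in>(Basis::'a set). decay 2 x)"
      using decay_powr[of 2 x "real DIM('a)"] decay_pos[of 2 x] by (simp add: powr_realpow)
    also have "\<dots> \<le> (\<Prod>b\<in>Basis. decay 2 (x \<bullet> b))"
      by (intro prod_mono) (auto intro!: decay_mono_norm simp: Basis_le_norm)
    finally show "ennreal (decay s x) \<le> (\<Prod>b\<in>Basis. ennreal (decay 2 (x \<bullet> b)))"
      by (subst prod_ennreal) (auto intro: ennreal_leI)
  qed
  also have "\<dots> = (\<Prod>b\<in>(Basis::'a set). (\<integral>\<^sup>+x. ennreal (decay 2 (x::real)) \<partial>lborel))"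
    by (rule nn_integral_lborel_prod) auto
  also have "\<dots> < \<infinity>"
    using nn_integral_real_decay_finite by (simp add: power_less_top_ennreal)
  finally show ?thesis .
qed

lemma integrable_decay:
  fixes s :: real
  assumes "s \<ge> 2 * DIM('a)"
  shows "integrable lborel (\<lambda>x::'a::euclidean_space. decay s x)"
  using nn_integral_decay_finite[OF assms] by (intro integrableI_bounded) auto

section \<open>Changes of variables, product integrands and Gaussian integrals\<close>

lemma integrable_lborel_translate:
  fixes f :: "'a::euclidean_space \<Rightarrow> 'b::{banach, second_countable_topology}"
  assumes "integrable lborel f"
  shows "integrable lborel (\<lambda>x. f (c + x))"
  using assms integrable_distr_eq[of "(+) c" lborel borel f]
  by (simp add: lborel_distr_plus borel_measurable_integrable)

lemma integral_lborel_translate: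
  fixes f :: "'a::euclidean_space \<Rightarrow> 'b::{banach, second_countable_topology}"
  assumes [measurable]: "f \<in> borel_measurable borel"
  shows "(\<integral>x. f (c + x) \<partial>lborel) = (\<integral>x. f x \<partial>lborel)"
  using integral_distr[of "(+) c" lborel borel f] by (simp add: lborel_distr_plus)

lemma nn_integral_lborel_translate:
  fixes c :: "'a::euclidean_space"
  assumes [measurable]: "f \<in> borel_measurable borel"
  shows "(\<integral>\<^sup>+x. f (c + x) \<partial>lborel) = (\<integral>\<^sup>+x. f x \<partial>lborel)"
  using nn_integral_distr[of "(+) c" lborel borel f] by (simp add: lborel_distr_plus)

lemma integral_lborel_affine:
  fixes f :: "'a::euclidean_space \<Rightarrow> 'b::{banach, second_countable_topology}"
  assumes [measurable]: "f \<in> borel_measurable borel" and "c \<noteq> 0"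
  shows "(\<integral>x. f x \<partial>lborel) = \<bar>c\<bar> ^ DIM('a) *\<^sub>R (\<integral>x. f (t + c *\<^sub>R x) \<partial>lborel)"
  by (subst lborel_affine[OF assms(2), of t])
     (simp add: integral_density integral_distr)

lemma integrable_lborel_affine:
  fixes f :: "'a::euclidean_space \<Rightarrow> 'b::{banach, second_countable_topology}"
  assumes "integrable lborel f" "c \<noteq> 0"
  shows "integrable lborel (\<lambda>x. f (t + c *\<^sub>R x))"
proof -
  have [measurable]: "f \<in> borel_measurable borel"
    using assms(1) by (simp add: borel_measurable_integrable)
  have "integrable (density (distr lborel borel (\<lambda>x. t + c *\<^sub>R x)) (\<lambda>_. \<bar>c\<bar> ^ DIM('a))) f"
    using assms lborel_affine[OF assms(2), of t] by simp
  then show ?thesis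
    using assms(2) using integrable_scaleR_right[of "inverse (\<bar>c\<bar> ^ DIM('a))" lborel "\<lambda>x. \<bar>c\<bar> ^ DIM('a) *\<^sub>R f (t + c *\<^sub>R x)"]
    by (simp add: integrable_density integrable_distr_eq)
qed

lemma
  fixes f :: "'a::euclidean_space \<Rightarrow> real \<Rightarrow> 'b::{real_normed_field,banach,second_countable_topology}"
  assumes f: "\<And>b. b \<in> Basis \<Longrightarrow> integrable lborel (f b)"
  shows integrable_lborel_prod: "integrable lborel (\<lambda>x. \<Prod>b\<in>Basis. f b (x \<bullet> b))"
    and integral_lborel_prod: "(\<integral>x. (\<Prod>b\<in>Basis. f b (x \<bullet> b)) \<partial>lborel) = (\<Prod>b\<in>Basis. (\<integral>x. f b x \<partial>lborel))"
proof -
  interpret product_sigma_finite "\<lambda>_::'a. lborel :: real measure" by standard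
  have [measurable]: "\<And>b. b \<in> Basis \<Longrightarrow> f b \<in> borel_measurable borel"
    using f by (simp add: borel_measurable_integrable)
  have m: "(\<lambda>x::'a. \<Prod>b\<in>Basis. f b (x \<bullet> b)) \<in> borel_measurable borel"
    by measurable
  have *: "(\<Prod>b\<in>Basis. f b ((\<Sum>b\<in>Basis. x b *\<^sub>R b) \<bullet> b)) = (\<Prod>b\<in>Basis. f b (x b))" for x :: "'a \<Rightarrow> real"
    by (intro prod.cong) auto
  have 1: "integrable (Pi\<^sub>M Basis (\<lambda>_::'a. lborel)) (\<lambda>x. \<Prod>b\<in>Basis. f b (x b))"
    by (rule product_integrable_prod) (use f in auto)
  have m2: "(\<lambda>f. \<Sum>b\<in>Basis. f b *\<^sub>R (b::'a)) \<in> (\<Pi>\<^sub>M b\<in>Basis. lborel) \<rightarrow>\<^sub>M borel"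
    by measurable
  show "integrable lborel (\<lambda>x::'a. \<Prod>b\<in>Basis. f b (x \<bullet> b))"
    by (subst lborel_eq, subst integrable_distr_eq[OF m2 m]) (simp only: * 1)
  have "(\<integral>x. (\<Prod>b\<in>Basis. f b (x \<bullet> b)) \<partial>lborel) = (\<integral>x. (\<Prod>b\<in>Basis. f b (x b)) \<partial>(Pi\<^sub>M Basis (\<lambda>_::'a. lborel)))"
    by (subst lborel_eq, subst integral_distr[OF m2 m]) (simp only: *)
  also have "\<dots> = (\<Prod>b\<in>Basis. (\<integral>x. f b x \<partial>lborel))"
    by (rule product_integral_prod) (use f in auto)
  finally show "(\<integral>x. (\<Prod>b\<in>Basis. f b (x \<bullet> b)) \<partial>lborel) = (\<Prod>b\<in>Basis. (\<integral>x. f b x \<partial>lborel))" .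
qed

lemma borel_measurable_cis [measurable]: "cis \<in> borel_measurable borel"
  unfolding cis_conv_exp by measurable

text \<open>Up to normalisation this is the characteristic function of the standard normal
  distribution, whose value is known.\<close>

lemma
  fixes t :: real
  shows integrable_gaussian_cis_real: "integrable lborel (\<lambda>x. complex_of_real (exp (- x\<^sup>2 / 2)) * cis (t * x))"
    and integral_gaussian_cis_real: "(\<integral>x. complex_of_real (exp (- x\<^sup>2 / 2)) * cis (t * x) \<partial>lborel)
      = complex_of_real (sqrt (2 * pi) * exp (- t\<^sup>2 / 2))"
proof -
  have eq: "complex_of_real (exp (- x\<^sup>2 / 2)) * cis (t * x) = complex_of_real (sqrt (2 * pi)) * (std_normal_density x *\<^sub>R cis (t * x))" for x
    by (simp add: std_normal_density_def scaleR_conv_of_real)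
  have i: "integrable lborel (\<lambda>x. std_normal_density x *\<^sub>R cis (t * x))"
  proof (rule Bochner_Integration.integrable_bound[of _ "std_normal_density"])
    show "integrable lborel std_normal_density" by simp
  qed (auto simp: normal_density_nonneg)
  then show "integrable lborel (\<lambda>x. complex_of_real (exp (- x\<^sup>2 / 2)) * cis (t * x))"
    unfolding eq by (rule integrable_mult_right)
  have "(\<integral>x. std_normal_density x *\<^sub>R cis (t * x) \<partial>lborel) = char std_normal_distribution t"
    unfolding char_def by (subst integral_density) (auto simp: cis_conv_exp normal_density_nonneg)
  then have "(\<integral>x. std_normal_density x *\<^sub>R cis (t * x) \<partial>lborel) = complex_of_real (exp (- t\<^sup>2 / 2))"
    by (simp add: char_std_normal_distribution)
  then show "(\<integral>x. complex_of_real (exp (- x\<^sup>2 / 2)) * cis (t * x) \<partial>lborel)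
      = complex_of_real (sqrt (2 * pi) * exp (- t\<^sup>2 / 2))"
    unfolding eq integral_mult_right_zero by simp
qed

lemma cis_sum: "finite A \<Longrightarrow> cis (\<Sum>a\<in>A. f a) = (\<Prod>a\<in>A. cis (f a))"
  by (induction A rule: finite_induct) (auto simp flip: cis_mult)

lemma
  fixes \<eta> :: "'a::euclidean_space"
  shows integrable_gaussian_cis: "integrable lborel (\<lambda>x::'a. complex_of_real (exp (- (norm x)\<^sup>2 / 2)) * cis (\<eta> \<bullet> x))"
    and integral_gaussian_cis: "(\<integral>x. complex_of_real (exp (- (norm x)\<^sup>2 / 2)) * cis (\<eta> \<bullet> x) \<partial>lborel)
      = complex_of_real (sqrt (2 * pi) ^ DIM('a) * exp (- (norm \<eta>)\<^sup>2 / 2))"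
proof -
  have n: "(norm x)\<^sup>2 = (\<Sum>b\<in>Basis. (x \<bullet> b)\<^sup>2)" for x :: 'a
    unfolding power2_norm_eq_inner by (subst euclidean_inner) (simp add: power2_eq_square)
  have e: "exp (- (norm x)\<^sup>2 / 2) = (\<Prod>b\<in>Basis. exp (- (x \<bullet> b)\<^sup>2 / 2))" for x :: 'a
    by (simp add: n exp_sum[symmetric] sum_negf sum_divide_distrib del: norm_Basis)
  have eq: "complex_of_real (exp (- (norm x)\<^sup>2 / 2)) * cis (\<eta> \<bullet> x)
     = (\<Prod>b\<in>Basis. complex_of_real (exp (- (x \<bullet> b)\<^sup>2 / 2)) * cis ((\<eta> \<bullet> b) * (x \<bullet> b)))" for x :: 'a
    by (subst euclidean_inner[of \<eta> x]) (simp only: e cis_sum prod.distrib of_real_prod finite_Basis)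
  show "integrable lborel (\<lambda>x::'a. complex_of_real (exp (- (norm x)\<^sup>2 / 2)) * cis (\<eta> \<bullet> x))"
    unfolding eq by (rule integrable_lborel_prod) (rule integrable_gaussian_cis_real)
  show "(\<integral>x. complex_of_real (exp (- (norm x)\<^sup>2 / 2)) * cis (\<eta> \<bullet> x) \<partial>lborel)
      = complex_of_real (sqrt (2 * pi) ^ DIM('a) * exp (- (norm \<eta>)\<^sup>2 / 2))"
    unfolding eq
    by (subst integral_lborel_prod[OF integrable_gaussian_cis_real])
       (simp only: integral_gaussian_cis_real e of_real_prod of_real_mult of_real_power prod.distrib prod_constant)
qed

lemma integrable_gaussian: "integrable lborel (\<lambda>x::'a::euclidean_space. exp (- (norm x)\<^sup>2 / 2))"
  using integrable_norm[OF integrable_gaussian_cis[of 0]] by simp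

lemma integral_gaussian: "(\<integral>x. exp (- (norm x)\<^sup>2 / 2) \<partial>(lborel :: 'a::euclidean_space measure)) = sqrt (2 * pi) ^ DIM('a)"
proof -
  have "(\<integral>x. complex_of_real (exp (- (norm x)\<^sup>2 / 2)) \<partial>(lborel :: 'a measure)) = complex_of_real (sqrt (2 * pi) ^ DIM('a))"
    using integral_gaussian_cis[of "0::'a"] by simp
  then show ?thesis
    unfolding integral_complex_of_real of_real_eq_iff .
qed

text \<open>As s tends to 0, dominated convergence turns the vanishing averages into h(x0) times the
  mass of the Gaussian, which is positive. Used for Fourier uniqueness and again to recover an
  operator kernel from the operator.\<close>

lemma gaussian_approximate_identity:
  fixes h :: "'a::euclidean_space \<Rightarrow> complex"
  assumes cont: "continuous_on UNIV h" and bdd: "\<And>x. norm (h x) \<le> B"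
    and zero: "\<And>s. s > 0 \<Longrightarrow> (\<integral>x. h (x0 + s *\<^sub>R x) * exp (- (norm x)\<^sup>2 / 2) \<partial>lborel) = 0"
  shows "h x0 = 0"
proof -
  have [measurable]: "h \<in> borel_measurable borel"
    using cont by (rule borel_measurable_continuous_onI)
  have "(\<lambda>n. \<integral>x. h (x0 + inverse (Suc n) *\<^sub>R x) * exp (- (norm x)\<^sup>2 / 2) \<partial>lborel)
     \<longlonglongrightarrow> (\<integral>x. h x0 * complex_of_real (exp (- (norm (x::'a))\<^sup>2 / 2)) \<partial>lborel)"
  proof (rule integral_dominated_convergence)
    show "integrable lborel (\<lambda>x::'a. B * exp (- (norm x)\<^sup>2 / 2))"
      by (intro integrable_mult_right integrable_gaussian)
    show "AE x in lborel. (\<lambda>n. h (x0 + inverse (Suc n) *\<^sub>R x) * exp (- (norm x)\<^sup>2 / 2)) \<longlonglongrightarrow> h x0 * complex_of_real (exp (- (norm (x::'a))\<^sup>2 / 2))"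
    proof (rule AE_I2)
      fix x :: 'a
      have "(\<lambda>n. x0 + inverse (real (Suc n)) *\<^sub>R x) \<longlonglongrightarrow> x0 + 0 *\<^sub>R x"
        by (intro tendsto_intros LIMSEQ_inverse_real_of_nat)
      then have "(\<lambda>n. h (x0 + inverse (Suc n) *\<^sub>R x)) \<longlonglongrightarrow> h x0"
        using continuous_on_tendsto_compose[OF cont, of "\<lambda>n. x0 + inverse (real (Suc n)) *\<^sub>R x" x0] by simp
      then show "(\<lambda>n. h (x0 + inverse (Suc n) *\<^sub>R x) * exp (- (norm x)\<^sup>2 / 2)) \<longlonglongrightarrow> h x0 * complex_of_real (exp (- (norm x)\<^sup>2 / 2))"
        by (intro tendsto_intros)
    qed
    show "AE x in lborel. norm (h (x0 + inverse (Suc n) *\<^sub>R x) * exp (- (norm x)\<^sup>2 / 2)) \<le> B * exp (- (norm x)\<^sup>2 / 2)" for n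
      by (rule AE_I2) (auto simp: norm_mult intro!: mult_right_mono bdd)
  qed measurable
  moreover have "(\<integral>x. h (x0 + inverse (Suc n) *\<^sub>R x) * exp (- (norm x)\<^sup>2 / 2) \<partial>lborel) = 0" for n
    by (rule zero) simp
  ultimately have "(\<lambda>n. 0) \<longlonglongrightarrow> (\<integral>x. h x0 * complex_of_real (exp (- (norm (x::'a))\<^sup>2 / 2)) \<partial>lborel)"
    by simp
  then have "0 = (\<integral>x. h x0 * complex_of_real (exp (- (norm (x::'a))\<^sup>2 / 2)) \<partial>lborel)"
    using LIMSEQ_unique tendsto_const by blast
  also have "\<dots> = h x0 * complex_of_real (sqrt (2 * pi) ^ DIM('a))"
    unfolding integral_mult_right_zero integral_complex_of_real integral_gaussian ..
  finally show ?thesis by simp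
qed

text \<open>The Gaussian is a multiple of its own Fourier transform, so by Fubini every Gaussian
  average of h is a superposition of the Fourier integrals of h, which all vanish.\<close>

lemma fourier_injective:
  fixes h :: "'a::euclidean_space \<Rightarrow> complex"
  assumes cont: "continuous_on UNIV h" and bdd: "\<And>x. norm (h x) \<le> B" and int: "integrable lborel h"
    and zero: "\<And>y. (\<integral>x. h x * cis (y \<bullet> x) \<partial>lborel) = 0"
  shows "h x0 = 0"
proof (rule gaussian_approximate_identity[OF cont bdd])
  fix s :: real assume s: "s > 0"
  have [measurable]: "h \<in> borel_measurable borel"
    using cont by (rule borel_measurable_continuous_onI)
  let ?c = "complex_of_real (sqrt (2 * pi) ^ DIM('a))"
  let ?g = "\<lambda>x y::'a. h (x0 + s *\<^sub>R x) * (complex_of_real (exp (- (norm y)\<^sup>2 / 2)) * cis (x \<bullet> y))"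
  have inth: "integrable lborel (\<lambda>x. h (x0 + s *\<^sub>R x))"
    using integrable_lborel_affine[OF int, of s x0] s by simp
  have m: "case_prod ?g \<in> borel_measurable (lborel \<Otimes>\<^sub>M lborel)"
    unfolding split_beta by measurable
  have int: "integrable (lborel \<Otimes>\<^sub>M lborel) (case_prod ?g)"
  proof (rule lborel_pair.Fubini_integrable[OF m])
    have "(\<lambda>x. \<integral>y. norm (case_prod ?g (x, y)) \<partial>lborel) = (\<lambda>x. norm (h (x0 + s *\<^sub>R x)) * (\<integral>y. exp (- (norm (y::'a))\<^sup>2 / 2) \<partial>lborel))"
      by (simp add: norm_mult)
    then show "integrable lborel (\<lambda>x. \<integral>y. norm (case_prod ?g (x, y)) \<partial>lborel)"
      using inth by simp
    show "AE x in lborel. integrable lborel (\<lambda>y. case_prod ?g (x, y))"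
      by (intro AE_I2, unfold prod.case, intro integrable_mult_right integrable_gaussian_cis)
  qed
  have "(\<integral>x. (\<integral>y. ?g x y \<partial>lborel) \<partial>lborel) = (\<integral>y. (\<integral>x. ?g x y \<partial>lborel) \<partial>lborel)"
    by (rule lborel_pair.Fubini_integral[OF int, symmetric])
  also have "\<dots> = (\<integral>y. 0 \<partial>(lborel :: 'a measure))"
  proof (rule Bochner_Integration.integral_cong[OF refl])
    fix y :: 'a
    \<comment> \<open>Under the substitution of x0 + s x for x the frequency y / s becomes y, and
      the translation by x0 contributes only a phase.\<close>
    let ?k = "\<lambda>x. h x * cis ((y /\<^sub>R s) \<bullet> x)"
    have "0 = \<bar>s\<bar> ^ DIM('a) *\<^sub>R (\<integral>x. ?k (x0 + s *\<^sub>R x) \<partial>lborel)"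
      using integral_lborel_affine[of ?k s x0] zero[of "y /\<^sub>R s"] s by simp
    then have "0 = (\<integral>x. ?k (x0 + s *\<^sub>R x) \<partial>lborel)"
      using s by simp
    also have "\<dots> = (\<integral>x. cis ((y /\<^sub>R s) \<bullet> x0) * (h (x0 + s *\<^sub>R x) * cis (x \<bullet> y)) \<partial>lborel)"
      using s by (intro Bochner_Integration.integral_cong[OF refl])
        (simp add: inner_add_right cis_mult[symmetric] mult.assoc[symmetric] inner_commute)
    finally have "(\<integral>x. h (x0 + s *\<^sub>R x) * cis (x \<bullet> y) \<partial>lborel) = 0"
      by simp
    moreover have "(\<integral>x. ?g x y \<partial>lborel) = (\<integral>x. complex_of_real (exp (- (norm y)\<^sup>2 / 2)) * (h (x0 + s *\<^sub>R x) * cis (x \<bullet> y)) \<partial>lborel)"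
      by (simp only: mult_ac)
    ultimately show "(\<integral>x. ?g x y \<partial>lborel) = 0"
      by simp
  qed
  finally have "(\<integral>x. (\<integral>y. ?g x y \<partial>lborel) \<partial>lborel) = 0" by simp
  moreover have "(\<lambda>x. \<integral>y. ?g x y \<partial>lborel) = (\<lambda>x. ?c * (h (x0 + s *\<^sub>R x) * exp (- (norm x)\<^sup>2 / 2)))"
    unfolding integral_mult_right_zero integral_gaussian_cis by (simp add: mult_ac)
  ultimately have "?c * (\<integral>x. h (x0 + s *\<^sub>R x) * exp (- (norm x)\<^sup>2 / 2) \<partial>lborel) = 0"
    unfolding integral_mult_right_zero[symmetric] by (simp only:)
  then show "(\<integral>x. h (x0 + s *\<^sub>R x) * exp (- (norm x)\<^sup>2 / 2) \<partial>lborel) = 0"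
    by simp
qed


section \<open>Schwartz functions\<close>

lemma iter_partial_deriv_Nil [simp]: "iter_partial_deriv [] f = f"
  by (simp add: iter_partial_deriv_def)

lemma iter_partial_deriv_Cons [simp]: "iter_partial_deriv (b # bs) f = partial_deriv b (iter_partial_deriv bs f)"
  by (simp add: iter_partial_deriv_def)

lemma iter_partial_deriv_append: "iter_partial_deriv (bs @ cs) f = iter_partial_deriv bs (iter_partial_deriv cs f)"
  by (simp add: iter_partial_deriv_def)

lemma partial_deriv_eqI: "(f has_derivative f') (at x) \<Longrightarrow> partial_deriv b f x = f' b"
  unfolding partial_deriv_def using frechet_derivative_at by metis

lemma smooth_differentiable: "smooth f \<Longrightarrow> f differentiable (at x)"
  unfolding smooth_def differentiable_on_def by (force dest: bspec[of _ _ "[]"])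

lemma smooth_partial_deriv: "smooth f \<Longrightarrow> b \<in> Basis \<Longrightarrow> smooth (partial_deriv b f)"
  unfolding smooth_def using iter_partial_deriv_append[of _ "[b]" f] by (metis append_in_lists_conv iter_partial_deriv_Cons iter_partial_deriv_Nil lists.simps)

lemma smooth_continuous_on: "smooth f \<Longrightarrow> continuous_on A f"
  by (meson continuous_at_imp_continuous_on differentiable_imp_continuous_within smooth_differentiable)

lemma smooth_has_derivative: "smooth f \<Longrightarrow> (f has_derivative frechet_derivative f (at x)) (at x)"
  using smooth_differentiable frechet_derivative_works by blast

text \<open>Smoothness concerns all iterated derivatives. Exhibiting a class of differentiable
  functions closed under partial derivatives avoids computing any of them.\<close>

lemma smooth_coinduct:
  assumes "f \<in> S"
    and "\<And>g x. g \<in> S \<Longrightarrow> g differentiable (at x)"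
    and closed: "\<And>g b. g \<in> S \<Longrightarrow> b \<in> Basis \<Longrightarrow> partial_deriv b g \<in> S"
  shows "smooth f" and "bs \<in> lists Basis \<Longrightarrow> iter_partial_deriv bs f \<in> S"
proof -
  have *: "iter_partial_deriv bs f \<in> S" if "bs \<in> lists Basis" for bs
    using that by (induction bs) (auto simp: assms)
  then show "bs \<in> lists Basis \<Longrightarrow> iter_partial_deriv bs f \<in> S" .
  show "smooth f"
    unfolding smooth_def differentiable_on_def using * assms(2)
    by (auto intro: differentiable_at_withinI)
qed

lemma abs_multi_monom_le: "\<bar>multi_monom \<beta> x\<bar> \<le> (1 + norm x) ^ multi_size \<beta>"
proof -
  have "\<bar>multi_monom \<beta> x\<bar> = (\<Prod>b\<in>Basis. \<bar>x \<bullet> b\<bar> ^ \<beta> b)"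
    by (simp add: multi_monom_def abs_prod power_abs)
  also have "\<dots> \<le> (\<Prod>b\<in>Basis. (1 + norm x) ^ \<beta> b)"
    by (intro prod_mono conjI power_mono) (auto intro: order_trans[OF Basis_le_norm])
  also have "\<dots> = (1 + norm x) ^ multi_size \<beta>"
    by (simp add: multi_size_def power_sum)
  finally show ?thesis .
qed

text \<open>With T the maximum of 1 and the coordinates, 1 + |x| is at most (1 + d) T, and T^M t
  equals t or one of the coordinate quantities. Bounds for powers of single coordinates thus combine
  into one for powers of 1 + |x|, both for Schwartz seminorms and after integrating by parts in one
  coordinate.\<close>

lemma power_norm_bound:
  fixes x :: "'a::euclidean_space"
  assumes t: "t \<ge> 0" "t \<le> K0" and Kb: "\<And>b. b \<in> Basis \<Longrightarrow> \<bar>x \<bullet> b\<bar> ^ M * t \<le> K b"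
  shows "(1 + norm x) ^ M * t \<le> (1 + real DIM('a)) ^ M * (K0 + (\<Sum>b\<in>Basis. K b))"
proof -
  define T where "T = Max (insert 1 ((\<lambda>b. \<bar>x \<bullet> b\<bar>) ` Basis))"
  have T1: "T \<ge> 1" unfolding T_def by (intro Max_ge) auto
  have Tb: "\<bar>x \<bullet> b\<bar> \<le> T" if "b \<in> Basis" for b unfolding T_def using that by (intro Max_ge) auto
  have Tin: "T \<in> insert 1 ((\<lambda>b. \<bar>x \<bullet> b\<bar>) ` Basis)"
    unfolding T_def by (rule Max_in) auto
  have "norm x \<le> (\<Sum>b\<in>Basis. \<bar>x \<bullet> b\<bar>)" by (rule norm_le_l1)
  also have "\<dots> \<le> (\<Sum>b\<in>(Basis::'a set). T)" by (intro sum_mono Tb)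
  finally have "1 + norm x \<le> (1 + real DIM('a)) * T" using T1 by (simp add: algebra_simps)
  then have "(1 + norm x) ^ M \<le> ((1 + real DIM('a)) * T) ^ M"
    by (intro power_mono) auto
  then have "(1 + norm x) ^ M * t \<le> (1 + real DIM('a)) ^ M * (T ^ M * t)"
    using mult_right_mono[OF _ t(1), of "(1 + norm x) ^ M" "(1 + real DIM('a)) ^ M * T ^ M"]
    by (simp add: power_mult_distrib mult.assoc)
  also have "T ^ M * t \<le> K0 + (\<Sum>b\<in>Basis. K b)"
  proof -
    have nn: "K b \<ge> 0" if "b \<in> Basis" for b
      using order_trans[OF _ Kb[OF that]] t by simp
    show ?thesis
      using Tin
    proof
      assume "T = 1" then show ?thesis using t nn by (simp add: sum_nonneg add_increasing2)
    next
      assume "T \<in> (\<lambda>b. \<bar>x \<bullet> b\<bar>) ` Basis"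
      then obtain b where b: "b \<in> Basis" "T = \<bar>x \<bullet> b\<bar>" by auto
      then have "T ^ M * t \<le> K b" using Kb by simp
      also have "\<dots> \<le> (\<Sum>b\<in>Basis. K b)" using b nn by (intro member_le_sum) auto
      finally show ?thesis using t by simp
    qed
  qed
  finally show ?thesis by simp
qed

text \<open>Of all monomials, the constant and the pure powers of single coordinates already control
  every power of 1 + |x|. Conversely, a monomial of degree k is at most (1 + |x|)^k.\<close>

lemma schwartz_decay_iff:
  "f \<in> schwartz_space \<longleftrightarrow> smooth f \<and>
    (\<forall>bs\<in>lists Basis. \<forall>s. \<exists>C. \<forall>x. norm (iter_partial_deriv bs f x) \<le> C * decay s x)"
proof (intro iffI conjI ballI allI)
  assume f: "f \<in> schwartz_space"
  show "smooth f" using f by (simp add: schwartz_space_def)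
  fix bs :: "'a list" and s :: real
  assume bs: "bs \<in> lists Basis"
  define M where "M = nat \<lceil>s\<rceil>"
  have M: "s \<le> real M" unfolding M_def by linarith
  let ?g = "iter_partial_deriv bs f"
  define \<delta> where "\<delta> b = (\<lambda>c. if c = b then M else 0)" for b :: 'a
  have mm: "multi_monom (\<delta> b) x = (x \<bullet> b) ^ M" if "b \<in> Basis" for b and x :: 'a
  proof -
    have "multi_monom (\<delta> b) x = (\<Prod>c\<in>Basis. if c = b then (x \<bullet> b) ^ M else 1)"
      unfolding multi_monom_def \<delta>_def by (intro prod.cong) auto
    then show ?thesis using that by simp
  qed
  have "\<forall>\<beta>. \<exists>C. \<forall>x. norm (multi_monom \<beta> x * ?g x) \<le> C"
    using f bs by (auto simp: schwartz_space_def)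
  then obtain K where K: "\<And>\<beta> x. norm (multi_monom \<beta> x * ?g x) \<le> K \<beta>"
    by metis
  define n where "n = real DIM('a)"
  define C where "C = (1 + n) ^ M * (K (\<lambda>_. 0) + (\<Sum>b\<in>Basis. K (\<delta> b)))"
  show "\<exists>C. \<forall>x. norm (?g x) \<le> C * decay s x"
  proof (intro exI allI)
    fix x
    have K0: "norm (?g x) \<le> K (\<lambda>_. 0)"
      using K[of "\<lambda>_. 0" x] by (simp add: multi_monom_def)
    have Kb: "\<bar>x \<bullet> b\<bar> ^ M * norm (?g x) \<le> K (\<delta> b)" if "b \<in> Basis" for b
      using K[of "\<delta> b" x] by (simp add: mm[OF that] norm_mult power_abs norm_power)
    have "(1 + norm x) ^ M * norm (?g x) \<le> C"
      unfolding C_def n_def by (rule power_norm_bound) (use K0 Kb in auto)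
    then have "norm (?g x) \<le> C * decay M x"
      using one_plus_norm_pos[of x] by (simp add: decay_nat field_simps)
    moreover have "C * decay M x \<le> C * decay s x"
    proof (rule mult_left_mono)
      show "decay M x \<le> decay s x" using M by (rule decay_antimono)
      show "0 \<le> C" using order_trans[OF _ \<open>(1 + norm x) ^ M * norm (?g x) \<le> C\<close>] by simp
    qed
    ultimately show "norm (?g x) \<le> C * decay s x" by linarith
  qed
next
  assume f: "smooth f \<and> (\<forall>bs\<in>lists Basis. \<forall>s. \<exists>C. \<forall>x. norm (iter_partial_deriv bs f x) \<le> C * decay s x)"
  show "f \<in> schwartz_space"
    unfolding schwartz_space_def
  proof (intro CollectI conjI ballI allI)
    show "smooth f" using f by blast
    fix bs :: "'a list" and \<beta> :: "'a \<Rightarrow> nat"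
    assume "bs \<in> lists Basis"
    then obtain C where C: "\<And>x. norm (iter_partial_deriv bs f x) \<le> C * decay (real (multi_size \<beta>)) x"
      using f by blast
    show "\<exists>C. \<forall>x. norm (multi_monom \<beta> x * iter_partial_deriv bs f x) \<le> C"
    proof (intro exI allI)
      fix x
      have "norm (multi_monom \<beta> x * iter_partial_deriv bs f x) \<le> (1 + norm x) ^ multi_size \<beta> * (C * decay (real (multi_size \<beta>)) x)"
        unfolding norm_mult using abs_multi_monom_le[of \<beta> x] C[of x] by (intro mult_mono) auto
      also have "\<dots> = C" using one_plus_norm_pos[of x] by (simp add: decay_nat)
      finally show "norm (multi_monom \<beta> x * iter_partial_deriv bs f x) \<le> C" .
    qed
  qed
qed

lemma schwartz_smooth: "f \<in> schwartz_space \<Longrightarrow> smooth f"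
  by (simp add: schwartz_space_def)

lemma schwartz_decay:
  assumes "f \<in> schwartz_space"
  obtains C where "C > 0" "\<And>x. norm (f x) \<le> C * decay s x"
proof -
  have "\<exists>C. \<forall>x. norm (iter_partial_deriv [] f x) \<le> C * decay s x"
    using assms unfolding schwartz_decay_iff by blast
  then obtain C where C: "\<And>x. norm (f x) \<le> C * decay s x" by auto
  have "norm (f x) \<le> (\<bar>C\<bar> + 1) * decay s x" for x
    using order_trans[OF C[of x] mult_right_mono[of C "\<bar>C\<bar> + 1" "decay s x"]] by simp
  then show ?thesis by (intro that[of "\<bar>C\<bar> + 1"]) auto
qed

lemma schwartz_partial_deriv: "f \<in> schwartz_space \<Longrightarrow> b \<in> Basis \<Longrightarrow> partial_deriv b f \<in> schwartz_space"
  unfolding schwartz_decay_iff using iter_partial_deriv_append[of _ "[b]" f]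
  by (auto simp: smooth_partial_deriv) (metis append_in_lists_conv lists.simps in_lists_conv_set)

lemma schwartz_continuous_on: "f \<in> schwartz_space \<Longrightarrow> continuous_on A f"
  by (simp add: schwartz_smooth smooth_continuous_on)

lemma schwartz_measurable: "f \<in> schwartz_space \<Longrightarrow> f \<in> borel_measurable borel"
  by (intro borel_measurable_continuous_onI schwartz_continuous_on)

lemma schwartz_bounded:
  assumes "f \<in> schwartz_space"
  obtains C where "C > 0" "\<And>x. norm (f x) \<le> C"
proof -
  obtain C where "C > 0" "\<And>x. norm (f x) \<le> C * decay 0 x"
    using schwartz_decay[OF assms, of 0] by metis
  then show ?thesis by (intro that[of C]) auto
qed

lemma schwartz_integrable: "f \<in> schwartz_space \<Longrightarrow> integrable lborel f"
proof -
  assume f: "f \<in> schwartz_space"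
  obtain C where C: "\<And>x. norm (f x) \<le> C * decay (real (2 * DIM('a))) x"
    using schwartz_decay[OF f] by metis
  show ?thesis
  proof (rule Bochner_Integration.integrable_bound)
    show "integrable lborel (\<lambda>x::'a. C * decay (real (2 * DIM('a))) x)"
      by (intro integrable_mult_right integrable_decay) simp
    show "AE x in lborel. norm (f x) \<le> norm (C * decay (real (2 * DIM('a))) x)"
      using order_trans[OF C abs_ge_self] by simp
  qed (simp add: schwartz_measurable[OF f])
qed

lemma partial_deriv_lincomb:
  assumes "f differentiable (at x)" "g differentiable (at x)"
  shows "partial_deriv b (\<lambda>x. c * f x + d * g x) x = c * partial_deriv b f x + d * partial_deriv b g x"
proof -
  have "((\<lambda>x. c * f x + d * g x) has_derivative (\<lambda>h. c * frechet_derivative f (at x) h + d * frechet_derivative g (at x) h)) (at x)"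
    using assms[unfolded frechet_derivative_works] by (auto intro!: derivative_eq_intros)
  then show ?thesis
    by (subst partial_deriv_eqI) (auto simp: partial_deriv_def)
qed

lemma iter_partial_deriv_lincomb:
  assumes "smooth f" "smooth g" "bs \<in> lists Basis"
  shows "iter_partial_deriv bs (\<lambda>x. c * f x + d * g x) = (\<lambda>x. c * iter_partial_deriv bs f x + d * iter_partial_deriv bs g x)"
  using assms(3)
proof (induction bs)
  case (Cons b bs)
  have "iter_partial_deriv bs f differentiable (at x)" "iter_partial_deriv bs g differentiable (at x)" for x
    using assms(1,2) Cons.hyps by (auto simp: smooth_def differentiable_on_def)
  then show ?case
    using Cons by (auto simp: partial_deriv_lincomb)
qed simp

lemma schwartz_lincomb:
  assumes f: "f \<in> schwartz_space" and g: "g \<in> schwartz_space"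
  shows "(\<lambda>x. c * f x + d * g x) \<in> schwartz_space"
  unfolding schwartz_decay_iff
proof (intro conjI ballI allI)
  have sm: "smooth f" "smooth g" using f g by (auto simp: schwartz_smooth)
  note it = iter_partial_deriv_lincomb[OF sm]
  show "smooth (\<lambda>x. c * f x + d * g x)"
    unfolding smooth_def using it sm
    by (auto simp: smooth_def intro!: derivative_intros)
  fix bs :: "'a list" and s assume bs: "bs \<in> lists Basis"
  obtain C where C: "\<And>x. norm (iter_partial_deriv bs f x) \<le> C * decay s x"
    using f bs unfolding schwartz_decay_iff by blast
  obtain D where D: "\<And>x. norm (iter_partial_deriv bs g x) \<le> D * decay s x"
    using g bs unfolding schwartz_decay_iff by blast
  have "norm (c * iter_partial_deriv bs f x + d * iter_partial_deriv bs g x) \<le> (norm c * C + norm d * D) * decay s x" for x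
  proof -
    have "norm (c * iter_partial_deriv bs f x + d * iter_partial_deriv bs g x) \<le> norm c * norm (iter_partial_deriv bs f x) + norm d * norm (iter_partial_deriv bs g x)"
      using norm_triangle_ineq[of "c * iter_partial_deriv bs f x" "d * iter_partial_deriv bs g x"] by (simp add: norm_mult)
    also have "\<dots> \<le> norm c * (C * decay s x) + norm d * (D * decay s x)"
      by (intro add_mono mult_left_mono C D) auto
    finally show ?thesis by (simp add: algebra_simps)
  qed
  then show "\<exists>C. \<forall>x. norm (iter_partial_deriv bs (\<lambda>x. c * f x + d * g x) x) \<le> C * decay s x"
    using it[OF bs] by auto
qed

lemma schwartz_sum:
  assumes "finite I" "I \<noteq> {}" "\<And>i. i \<in> I \<Longrightarrow> f i \<in> schwartz_space"
  shows "(\<lambda>x. \<Sum>i\<in>I. c i * f i x) \<in> schwartz_space"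
  using assms
proof (induction I rule: finite_ne_induct)
  case (singleton i)
  then show ?case using schwartz_lincomb[of "f i" "f i" "c i" 0] by simp
next
  case (insert i I)
  then show ?case using schwartz_lincomb[of "f i" "\<lambda>x. \<Sum>i\<in>I. c i * f i x" "c i" 1] by simp
qed

section \<open>Complex polynomials and Gaussian wave packets\<close>

inductive_set complex_polyfun :: "('a::euclidean_space \<Rightarrow> complex) set" where
  const: "(\<lambda>_. c) \<in> complex_polyfun"
| linear: "(\<lambda>z. complex_of_real (z \<bullet> b)) \<in> complex_polyfun"
| add: "p \<in> complex_polyfun \<Longrightarrow> q \<in> complex_polyfun \<Longrightarrow> (\<lambda>z. p z + q z) \<in> complex_polyfun"
| mult: "p \<in> complex_polyfun \<Longrightarrow> q \<in> complex_polyfun \<Longrightarrow> (\<lambda>z. p z * q z) \<in> complex_polyfun"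

lemma complex_polyfun_has_derivative:
  assumes "p \<in> complex_polyfun"
  shows "\<exists>p'. (\<forall>x. (p has_derivative (\<lambda>h. p' h x)) (at x)) \<and> (\<forall>h. p' h \<in> complex_polyfun)"
  using assms
proof induction
  case (const c)
  show ?case
    by (rule exI[of _ "\<lambda>h x. 0"]) (auto intro: complex_polyfun.intros)
next
  case (linear b)
  show ?case
    by (rule exI[of _ "\<lambda>h x. complex_of_real (h \<bullet> b)"])
      (auto intro: complex_polyfun.intros intro!: derivative_eq_intros)
next
  case (add p q)
  then obtain p' q' where *: "\<And>x. (p has_derivative (\<lambda>h. p' h x)) (at x)" "\<And>h. p' h \<in> complex_polyfun"
    "\<And>x. (q has_derivative (\<lambda>h. q' h x)) (at x)" "\<And>h. q' h \<in> complex_polyfun"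
    by auto
  show ?case
    by (rule exI[of _ "\<lambda>h x. p' h x + q' h x"]) (auto intro!: * derivative_intros complex_polyfun.intros)
next
  case (mult p q)
  then obtain p' q' where *: "\<And>x. (p has_derivative (\<lambda>h. p' h x)) (at x)" "\<And>h. p' h \<in> complex_polyfun"
    "\<And>x. (q has_derivative (\<lambda>h. q' h x)) (at x)" "\<And>h. q' h \<in> complex_polyfun"
    by auto
  show ?case
    by (rule exI[of _ "\<lambda>h x. p x * q' h x + p' h x * q x"]) (auto intro!: * mult derivative_intros complex_polyfun.intros)
qed

lemma complex_polyfun_bound:
  assumes "p \<in> complex_polyfun"
  shows "\<exists>C M. \<forall>x. norm (p x) \<le> C * (1 + norm x) ^ M"
  using assms
proof induction
  case (const c)
  show ?case by (rule exI[of _ "norm c"], rule exI[of _ 0]) simp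
next
  case (linear b)
  have "norm (complex_of_real (x \<bullet> b)) \<le> norm b * (1 + norm x) ^ 1" for x
    using Cauchy_Schwarz_ineq2[of x b] mult_right_mono[of "norm x" "1 + norm x" "norm b"] by (simp add: mult.commute)
  then show ?case by blast
next
  case (add p q)
  then obtain C M D N where *: "\<And>x. norm (p x) \<le> C * (1 + norm x) ^ M" "\<And>x. norm (q x) \<le> D * (1 + norm x) ^ N"
    by blast
  have CD: "C \<ge> 0" "D \<ge> 0" using order_trans[OF norm_ge_zero *(1)[of 0]] order_trans[OF norm_ge_zero *(2)[of 0]] by auto
  have "norm (p x + q x) \<le> (C + D) * (1 + norm x) ^ (M + N)" for x
  proof -
    have "(1 + norm x) ^ M \<le> (1 + norm x) ^ (M + N)" "(1 + norm x) ^ N \<le> (1 + norm x) ^ (M + N)"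
      by (intro power_increasing; simp)+
    then have "C * (1 + norm x) ^ M \<le> C * (1 + norm x) ^ (M + N)" "D * (1 + norm x) ^ N \<le> D * (1 + norm x) ^ (M + N)"
      using CD by (auto intro: mult_left_mono)
    then show ?thesis
      using norm_triangle_ineq[of "p x" "q x"] *(1)[of x] *(2)[of x] unfolding distrib_right by linarith
  qed
  then show ?case by blast
next
  case (mult p q)
  then obtain C M D N where *: "\<And>x. norm (p x) \<le> C * (1 + norm x) ^ M" "\<And>x. norm (q x) \<le> D * (1 + norm x) ^ N"
    by blast
  have "norm (p x * q x) \<le> (C * D) * (1 + norm x) ^ (M + N)" for x
  proof -
    have "norm (p x * q x) \<le> (C * (1 + norm x) ^ M) * (D * (1 + norm x) ^ N)"
      unfolding norm_mult by (intro mult_mono *) (auto intro: order_trans[OF norm_ge_zero *(1)])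
    then show ?thesis by (simp add: power_add mult_ac)
  qed
  then show ?case by blast
qed

text \<open>One family covers the test symbols, the coherent states, and the concentrating functions
  that probe an operator kernel; they differ in the width parameter c, the centre m and the
  frequency w.\<close>

definition gaussian_wave :: "real \<Rightarrow> 'a \<Rightarrow> 'a \<Rightarrow> 'a::euclidean_space \<Rightarrow> complex" where
  "gaussian_wave c m w z = complex_of_real (exp (- c * (norm (z - m))\<^sup>2)) * cis (w \<bullet> z)"

lemma gaussian_wave_has_derivative:
  "(gaussian_wave c m w has_derivative
     (\<lambda>h. (\<i> * (w \<bullet> h) - 2 * c * (complex_of_real (z \<bullet> h) + (- complex_of_real (m \<bullet> h)))) * gaussian_wave c m w z)) (at z)"
proof -
  have eq: "gaussian_wave c m w = (\<lambda>z. exp (complex_of_real (- c * ((z - m) \<bullet> (z - m))) + \<i> * complex_of_real (w \<bullet> z)))"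
    by (rule ext) (simp only: gaussian_wave_def exp_add cis_conv_exp exp_of_real power2_norm_eq_inner)
  have "((\<lambda>z. (z - m) \<bullet> (z - m)) has_derivative (\<lambda>h. 2 * (h \<bullet> (z - m)))) (at z)"
    by (auto intro!: derivative_eq_intros simp: fun_eq_iff inner_commute)
  moreover have "((\<lambda>z. w \<bullet> z) has_derivative (\<lambda>h. w \<bullet> h)) (at z)"
    by (auto intro!: derivative_eq_intros)
  ultimately have "((\<lambda>z. complex_of_real (- c * ((z - m) \<bullet> (z - m))) + \<i> * complex_of_real (w \<bullet> z)) has_derivative
     (\<lambda>h. complex_of_real (- c * (2 * (h \<bullet> (z - m)))) + \<i> * complex_of_real (w \<bullet> h))) (at z)"
    by (intro has_derivative_add has_derivative_of_real has_derivative_mult_right)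
  from has_derivative_compose[OF this DERIV_exp[unfolded has_field_derivative_def]]
  show ?thesis
    unfolding eq
    by (rule has_derivative_eq_rhs) (simp add: fun_eq_iff algebra_simps inner_commute inner_diff_right)
qed

text \<open>1 + t is at most e^t, and completing the square bounds M t - c t^2 by M^2 / (4
  c).\<close>

lemma one_plus_power_exp_bound:
  fixes t c :: real
  assumes "t \<ge> 0" "c > 0"
  shows "(1 + t) ^ M * exp (- c * t\<^sup>2) \<le> exp ((real M)\<^sup>2 / (4 * c))"
proof -
  have "(1 + t) ^ M \<le> exp t ^ M"
    using assms by (intro power_mono exp_ge_add_one_self) auto
  then have "(1 + t) ^ M * exp (- c * t\<^sup>2) \<le> exp (M * t) * exp (- c * t\<^sup>2)"
    by (simp add: exp_of_nat_mult)
  also have "\<dots> = exp (M * t - c * t\<^sup>2)"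
    by (simp add: exp_add[symmetric])
  also have "M * t - c * t\<^sup>2 \<le> (real M)\<^sup>2 / (4 * c)"
  proof -
    have "0 \<le> (2 * c * t - M)\<^sup>2" by simp
    then show ?thesis using assms by (simp add: field_simps power2_eq_square)
  qed
  finally show ?thesis by simp
qed

lemma gaussian_wave_decay:
  assumes "c > 0"
  shows "\<exists>C. \<forall>z. (1 + norm z) ^ M * norm (gaussian_wave c m w z) \<le> C"
proof (intro exI allI)
  fix z
  have "norm z \<le> norm m + norm (z - m)" by (metis norm_triangle_sub)
  then have "1 + norm z \<le> (1 + norm m) * (1 + norm (z - m))"
    using mult_nonneg_nonneg[OF norm_ge_zero[of m] norm_ge_zero[of "z-m"]] unfolding distrib_left distrib_right by linarith
  then have "(1 + norm z) ^ M \<le> (1 + norm m) ^ M * (1 + norm (z - m)) ^ M"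
    unfolding power_mult_distrib[symmetric] by (intro power_mono) auto
  then have "(1 + norm z) ^ M * norm (gaussian_wave c m w z) \<le> ((1 + norm m) ^ M * (1 + norm (z - m)) ^ M) * exp (- c * (norm (z - m))\<^sup>2)"
    by (simp add: gaussian_wave_def norm_mult)
  also have "\<dots> = (1 + norm m) ^ M * ((1 + norm (z - m)) ^ M * exp (- c * (norm (z - m))\<^sup>2))" by simp
  also have "\<dots> \<le> (1 + norm m) ^ M * exp ((real M)\<^sup>2 / (4 * c))"
    using assms by (intro mult_left_mono one_plus_power_exp_bound) auto
  finally show "(1 + norm z) ^ M * norm (gaussian_wave c m w z) \<le> (1 + norm m) ^ M * exp ((real M)\<^sup>2 / (4 * c))" .
qed

text \<open>Polynomial multiples of a fixed wave are closed under differentiation, so every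
  derivative is a polynomial times a Gaussian. The polynomials have complex coefficients because
  differentiating the phase brings down an imaginary factor.\<close>

lemma gaussian_wave_schwartz:
  assumes "c > 0"
  shows "gaussian_wave c m w \<in> schwartz_space"
proof -
  let ?E = "gaussian_wave c m w"
  define S where "S = {\<lambda>z. p z * ?E z | p. p \<in> complex_polyfun}"
  have der: "\<exists>g'. (\<forall>x. (g has_derivative (\<lambda>h. g' h x)) (at x)) \<and> (\<forall>h. g' h \<in> S)" if g: "g \<in> S" for g
  proof -
    obtain p where p: "p \<in> complex_polyfun" "g = (\<lambda>z. p z * ?E z)" using g unfolding S_def by blast
    obtain p' where p': "\<And>x. (p has_derivative (\<lambda>h. p' h x)) (at x)" "\<And>h. p' h \<in> complex_polyfun"
      using complex_polyfun_has_derivative[OF p(1)] by blast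
    \<comment> \<open>Subtractions are written as sums with negated terms, since the closure rules
      of \<open>complex_polyfun\<close> know only sums and products.\<close>
    let ?q = "\<lambda>h z. p' h z + p z * (\<i> * (w \<bullet> h) + (- (2 * c)) * (complex_of_real (z \<bullet> h) + (- complex_of_real (m \<bullet> h))))"
    have "(g has_derivative (\<lambda>h. ?q h x * ?E x)) (at x)" for x
      unfolding p(2)
      by (auto intro!: derivative_eq_intros p' gaussian_wave_has_derivative simp: fun_eq_iff algebra_simps)
    moreover have "?q h \<in> complex_polyfun" for h
      by (intro complex_polyfun.intros p p')
    ultimately show ?thesis
      by (intro exI[of _ "\<lambda>h x. ?q h x * ?E x"]) (auto simp: S_def)
  qed
  have diff: "g differentiable (at x)" if "g \<in> S" for g x
    using der[OF that] unfolding differentiable_def by blast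
  have closed: "partial_deriv b g \<in> S" if g: "g \<in> S" and "b \<in> Basis" for g b
  proof -
    obtain g' where g': "\<And>x. (g has_derivative (\<lambda>h. g' h x)) (at x)" "\<And>h. g' h \<in> S"
      using der[OF g] by blast
    have "partial_deriv b g = g' b"
      by (rule ext, rule partial_deriv_eqI, rule g')
    then show ?thesis using g' by simp
  qed
  have E: "?E \<in> S"
    unfolding S_def by (rule CollectI, rule exI[of _ "\<lambda>_. 1"]) (auto intro: complex_polyfun.intros)
  show ?thesis
    unfolding schwartz_space_def
  proof (intro CollectI conjI ballI allI)
    show "smooth ?E"
      using smooth_coinduct(1)[of ?E S, OF E diff closed] by blast
    fix bs :: "'a list" and \<beta> :: "'a \<Rightarrow> nat"
    assume "bs \<in> lists Basis"
    then have "iter_partial_deriv bs ?E \<in> S"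
      using smooth_coinduct(2)[of ?E S bs, OF E diff closed] by blast
    then obtain p where p: "p \<in> complex_polyfun" "iter_partial_deriv bs ?E = (\<lambda>z. p z * ?E z)"
      by (auto simp: S_def)
    obtain C M where CM: "\<And>x. norm (p x) \<le> C * (1 + norm x) ^ M"
      using complex_polyfun_bound[OF p(1)] by blast
    have C0: "C \<ge> 0" using order_trans[OF norm_ge_zero CM[of 0]] by simp
    obtain D where D: "\<And>z. (1 + norm z) ^ (multi_size \<beta> + M) * norm (?E z) \<le> D"
      using gaussian_wave_decay[OF assms] by blast
    have "norm (multi_monom \<beta> x * iter_partial_deriv bs ?E x) \<le> C * D" for x
    proof -
      have "norm (multi_monom \<beta> x * iter_partial_deriv bs ?E x) = (\<bar>multi_monom \<beta> x\<bar> * norm (p x)) * norm (?E x)"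
        by (simp add: p(2) norm_mult)
      also have "\<dots> \<le> ((1 + norm x) ^ multi_size \<beta> * (C * (1 + norm x) ^ M)) * norm (?E x)"
        using one_plus_norm_pos[of x] by (intro mult_right_mono mult_mono abs_multi_monom_le CM) (auto simp: less_imp_le)
      also have "\<dots> = C * ((1 + norm x) ^ (multi_size \<beta> + M) * norm (?E x))"
        by (simp add: power_add)
      also have "\<dots> \<le> C * D" using C0 D by (intro mult_left_mono)
      finally show ?thesis .
    qed
    then show "\<exists>C. \<forall>x. norm (multi_monom \<beta> x * iter_partial_deriv bs ?E x) \<le> C" by blast
  qed
qed

lemma gelfand_shilov_subset_schwartz: "gelfand_shilov_half \<subseteq> schwartz_space"
proof
  fix f :: "'a \<Rightarrow> complex" assume f: "f \<in> gelfand_shilov_half"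
  then obtain h C where h: "h > 0" and C: "\<And>bs \<beta> x. bs \<in> lists Basis \<Longrightarrow>
        norm (multi_monom \<beta> x * iter_partial_deriv bs f x) /
          (h ^ (length bs + multi_size \<beta>) * sqrt (multi_fact (count_list bs) * multi_fact \<beta>)) \<le> C"
    and sm: "smooth f"
    unfolding gelfand_shilov_half_def by blast
  have pos: "multi_fact \<beta> > 0" for \<beta> :: "'a \<Rightarrow> nat" unfolding multi_fact_def by (intro prod_pos) auto
  show "f \<in> schwartz_space"
    unfolding schwartz_space_def
  proof (intro CollectI conjI ballI allI sm)
    fix bs :: "'a list" and \<beta> :: "'a \<Rightarrow> nat"
    assume bs: "bs \<in> lists Basis"
    define K where "K = h ^ (length bs + multi_size \<beta>) * sqrt (multi_fact (count_list bs) * multi_fact \<beta>)"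
    have "K > 0" unfolding K_def using h pos by simp
    then have "norm (multi_monom \<beta> x * iter_partial_deriv bs f x) \<le> C * K" for x
      using C[OF bs, of \<beta> x] unfolding K_def[symmetric] by (simp add: divide_le_eq)
    then show "\<exists>C. \<forall>x. norm (multi_monom \<beta> x * iter_partial_deriv bs f x) \<le> C" by blast
  qed
qed


section \<open>Composition of operators of finite rank\<close>

lemma continuous_on_parametric_integral:
  fixes F :: "'p::metric_space \<Rightarrow> 'a::euclidean_space \<Rightarrow> complex"
  assumes cont: "\<And>z. continuous_on UNIV (\<lambda>p. F p z)"
    and meas: "\<And>p. F p \<in> borel_measurable borel"
    and w: "integrable lborel w" and dom: "\<And>p z. norm (F p z) \<le> w z"
  shows "continuous_on UNIV (\<lambda>p. \<integral>z. F p z \<partial>lborel)"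
  unfolding continuous_on_eq_continuous_at[OF open_UNIV] continuous_at_sequentially
proof (intro ballI allI impI)
  fix p and x :: "nat \<Rightarrow> 'p" assume x: "x \<longlonglongrightarrow> p"
  show "((\<lambda>p. \<integral>z. F p z \<partial>lborel) \<circ> x) \<longlonglongrightarrow> (\<integral>z. F p z \<partial>lborel)"
    unfolding o_def
  proof (rule integral_dominated_convergence[OF _ _ w])
    show "AE z in lborel. (\<lambda>n. F (x n) z) \<longlonglongrightarrow> F p z"
      using continuous_on_tendsto_compose[OF cont x] by simp
  qed (use meas dom in auto)
qed

lemma integral_gaussian_wave_1:
  fixes w :: "'a::euclidean_space"
  shows "(\<integral>z. gaussian_wave 1 0 w z \<partial>lborel) = complex_of_real (sqrt pi ^ DIM('a) * exp (- (norm w)\<^sup>2 / 4))"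
proof -
  \<comment> \<open>This dilation turns exp(-|z|^2) into the standard normal exponent -|z|^2 /
    2.\<close>
  define r where "r = 1 / sqrt 2"
  have r: "r > 0" "r\<^sup>2 = 1/2" by (simp_all add: r_def power_divide)
  have eq: "gaussian_wave 1 0 w (0 + r *\<^sub>R z) = complex_of_real (exp (- (norm z)\<^sup>2 / 2)) * cis ((r *\<^sub>R w) \<bullet> z)" for z :: 'a
    using r by (simp add: gaussian_wave_def power_mult_distrib)
  have m: "gaussian_wave 1 0 w \<in> borel_measurable borel"
    by (intro schwartz_measurable gaussian_wave_schwartz) simp
  have "(\<integral>z. gaussian_wave 1 0 w z \<partial>lborel) = \<bar>r\<bar> ^ DIM('a) *\<^sub>R complex_of_real (sqrt (2 * pi) ^ DIM('a) * exp (- (norm (r *\<^sub>R w))\<^sup>2 / 2))"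
    using r by (subst integral_lborel_affine[OF m, of r 0]) (simp_all only: eq integral_gaussian_cis)
  also have "\<dots> = complex_of_real ((r * sqrt (2 * pi)) ^ DIM('a) * exp (- (norm w)\<^sup>2 / 4))"
    using r by (simp add: scaleR_conv_of_real power_mult_distrib)
  also have "r * sqrt (2 * pi) = sqrt pi"
    by (simp add: r_def real_sqrt_mult)
  finally show ?thesis .
qed

text \<open>The bound is uniform in q and its order is calibrated to the dimension of the second
  factor: it dominates the integral over the second variable for all q at once.\<close>

lemma schwartz_slice_bound:
  fixes c :: "'a::euclidean_space \<times> 'b::euclidean_space \<Rightarrow> complex"
  assumes "c \<in> schwartz_space"
  obtains C where "C > 0" "\<And>q \<xi>. norm (c (q, \<xi>)) \<le> C * decay (real (2 * DIM('b))) \<xi>"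
proof -
  obtain C where C: "C > 0" "\<And>z. norm (c z) \<le> C * decay (real (2 * DIM('b))) z"
    using schwartz_decay[OF assms] by metis
  have "norm (c (q, \<xi>)) \<le> C * decay (real (2 * DIM('b))) \<xi>" for q \<xi>
  proof -
    have "decay (real (2 * DIM('b))) (q, \<xi>) \<le> decay (real (2 * DIM('b))) \<xi>"
      by (rule decay_mono_norm) (auto simp: norm_snd_le)
    then show ?thesis using C order_trans[OF C(2) mult_left_mono] by (simp add: less_imp_le)
  qed
  with C that show ?thesis by blast
qed

lemma weyl_integrand_integrable:
  fixes c :: "'a::euclidean_space \<times> 'a \<Rightarrow> complex"
  assumes c: "c \<in> schwartz_space" and f: "integrable lborel f"
  shows "integrable (lborel \<Otimes>\<^sub>M lborel)
    (\<lambda>(y, \<xi>). c ((1/2) *\<^sub>R (x + y), \<xi>) * f y * exp (\<i> * complex_of_real ((x - y) \<bullet> \<xi>)))"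
proof -
  obtain C where C: "C > 0" "\<And>q \<xi>. norm (c (q, \<xi>)) \<le> C * decay (real (2 * DIM('a))) \<xi>"
    using schwartz_slice_bound[OF c] by blast
  have [measurable]: "f \<in> borel_measurable borel" using f by (simp add: borel_measurable_integrable)
  have [measurable]: "c \<in> borel_measurable borel" using c by (rule schwartz_measurable)
  have cc: "continuous_on UNIV c" using c by (rule schwartz_continuous_on)
  have [measurable]: "(\<lambda>p::'a\<times>'a. c ((1/2) *\<^sub>R (x + fst p), snd p)) \<in> borel_measurable (borel \<Otimes>\<^sub>M borel)"
    unfolding borel_prod
    by (intro borel_measurable_continuous_onI continuous_on_compose2[OF cc] continuous_intros) auto
  have int: "integrable (lborel \<Otimes>\<^sub>M lborel) (\<lambda>(y::'a, \<xi>::'a). f y * decay (real (2 * DIM('a))) \<xi>)"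
  proof (rule lborel_pair.Fubini_integrable)
    show "(\<lambda>(y::'a, \<xi>::'a). f y * decay (real (2 * DIM('a))) \<xi>) \<in> borel_measurable (lborel \<Otimes>\<^sub>M lborel)"
      unfolding split_beta by measurable
    show "integrable lborel (\<lambda>x. \<integral>y. norm (case (x, y) of (y::'a, \<xi>::'a) \<Rightarrow> f y * decay (real (2 * DIM('a))) \<xi>) \<partial>lborel)"
      using f by (simp add: norm_mult)
    show "AE x in lborel. integrable lborel (\<lambda>y. case (x, y) of (y::'a, \<xi>::'a) \<Rightarrow> f y * decay (real (2 * DIM('a))) \<xi>)"
      using integrable_decay[where 'a='a, of "real (2 * DIM('a))"] by (simp add: integrable_of_real)
  qed
  show ?thesis
  proof (rule Bochner_Integration.integrable_bound[OF integrable_mult_right[of C, OF integrable_norm[OF int]]])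
    show "(\<lambda>(y, \<xi>). c ((1/2) *\<^sub>R (x + y), \<xi>) * f y * exp (\<i> * complex_of_real ((x - y) \<bullet> \<xi>)))
       \<in> borel_measurable (lborel \<Otimes>\<^sub>M lborel)"
      unfolding split_beta by measurable
    show "AE p in lborel \<Otimes>\<^sub>M lborel. norm (case p of (y, \<xi>) \<Rightarrow> c ((1/2) *\<^sub>R (x + y), \<xi>) * f y * exp (\<i> * complex_of_real ((x - y) \<bullet> \<xi>)))
       \<le> norm (C * norm (case p of (y, \<xi>) \<Rightarrow> f y * complex_of_real (decay (real (2 * DIM('a))) \<xi>)))"
    proof (rule AE_I2)
      fix p :: "'a \<times> 'a"
      obtain y \<xi> where p: "p = (y, \<xi>)" by force
      have "norm (c ((1/2) *\<^sub>R (x + y), \<xi>)) * norm (f y) \<le> (C * decay (real (2 * DIM('a))) \<xi>) * norm (f y)"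
        by (intro mult_right_mono C) auto
      then show "norm (case p of (y, \<xi>) \<Rightarrow> c ((1/2) *\<^sub>R (x + y), \<xi>) * f y * exp (\<i> * complex_of_real ((x - y) \<bullet> \<xi>)))
       \<le> norm (C * norm (case p of (y, \<xi>) \<Rightarrow> f y * complex_of_real (decay (real (2 * DIM('a))) \<xi>)))"
        using C(1) by (simp add: p norm_mult abs_mult mult_ac)
    qed
  qed
qed

text \<open>The inner integral is the kernel of the operator, a partial Fourier transform of the
  symbol. The action of the atoms and the injectivity of the quantization are both read off from
  it.\<close>

lemma weyl_op_Fubini:
  fixes c :: "'a::euclidean_space \<times> 'a \<Rightarrow> complex"
  assumes c: "c \<in> schwartz_space" and f: "integrable lborel f"
  shows "weyl_op c f x = complex_of_real (1 / (2 * pi) ^ DIM('a)) *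
    (\<integral>y. f y * (\<integral>\<xi>. c ((1/2) *\<^sub>R (x + y), \<xi>) * cis ((x - y) \<bullet> \<xi>) \<partial>lborel) \<partial>lborel)"
proof -
  let ?F = "\<lambda>y \<xi>. c ((1/2) *\<^sub>R (x + y), \<xi>) * f y * exp (\<i> * complex_of_real ((x - y) \<bullet> \<xi>))"
  have "(LINT (y, \<xi>)|lborel. ?F y \<xi>) = (\<integral>p. case_prod ?F p \<partial>(lborel \<Otimes>\<^sub>M lborel))"
    by (simp only: lborel_prod)
  also have "\<dots> = (\<integral>y. (\<integral>\<xi>. ?F y \<xi> \<partial>lborel) \<partial>lborel)"
    using lborel_pair.integral_fst'[OF weyl_integrand_integrable[OF c f, of x]] by simp
  also have "\<dots> = (\<integral>y. f y * (\<integral>\<xi>. c ((1/2) *\<^sub>R (x + y), \<xi>) * cis ((x - y) \<bullet> \<xi>) \<partial>lborel) \<partial>lborel)"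
    unfolding integral_mult_right_zero[symmetric] by (simp only: cis_conv_exp mult_ac)
  finally show ?thesis by (simp add: weyl_op_def)
qed

lemma weyl_op_sum:
  assumes "finite I" "\<And>i. i \<in> I \<Longrightarrow> a i \<in> schwartz_space" "integrable lborel f"
  shows "weyl_op (\<lambda>z. \<Sum>i\<in>I. c i * a i z) f x = (\<Sum>i\<in>I. c i * weyl_op (a i) f x)"
proof -
  let ?G = "\<lambda>i (y, \<xi>). a i ((1/2) *\<^sub>R (x + y), \<xi>) * f y * exp (\<i> * complex_of_real ((x - y) \<bullet> \<xi>))"
  have int: "integrable lborel (\<lambda>p. c i * ?G i p)" if "i \<in> I" for i
    using weyl_integrand_integrable[OF assms(2)[OF that] assms(3), of x] unfolding lborel_prod
    by (rule integrable_mult_right)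
  have "(LINT (y, \<xi>)|lborel. (\<Sum>i\<in>I. c i * a i ((1/2) *\<^sub>R (x + y), \<xi>)) * f y * exp (\<i> * complex_of_real ((x - y) \<bullet> \<xi>)))
     = (LINT p|lborel. (\<Sum>i\<in>I. c i * ?G i p))"
    by (rule Bochner_Integration.integral_cong) (auto simp: sum_distrib_left sum_distrib_right mult_ac)
  also have "\<dots> = (\<Sum>i\<in>I. LINT p|lborel. c i * ?G i p)"
    by (rule Bochner_Integration.integral_sum) (rule int)
  finally show ?thesis
    unfolding weyl_op_def integral_mult_right_zero by (simp add: sum_distrib_left mult_ac)
qed

text \<open>Up to a constant, this is the cross-Wigner distribution of the Gaussians centred at x
  and y: it sits at their midpoint and oscillates with their difference.\<close>

definition atom :: "'a::euclidean_space \<Rightarrow> 'a \<Rightarrow> 'a \<times> 'a \<Rightarrow> complex" where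
  "atom x y = gaussian_wave 1 ((1/2) *\<^sub>R (x + y), 0) (0, y - x)"

lemma atom_schwartz: "atom x y \<in> schwartz_space"
  unfolding atom_def by (rule gaussian_wave_schwartz) simp

abbreviation coherent :: "'a::euclidean_space \<Rightarrow> 'a \<Rightarrow> complex" where
  "coherent x \<equiv> gaussian_wave (1/2) x 0"

lemma coherent_schwartz: "coherent x \<in> schwartz_space"
  by (rule gaussian_wave_schwartz) simp

lemma integrable_coherent_mult:
  assumes "integrable lborel f"
  shows "integrable lborel (\<lambda>t. coherent y t * f t)"
proof (rule Bochner_Integration.integrable_bound[OF assms])
  have [measurable]: "f \<in> borel_measurable borel" "coherent y \<in> borel_measurable borel"
    using assms by (auto intro: schwartz_measurable coherent_schwartz simp: borel_measurable_integrable)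
  show "(\<lambda>t. coherent y t * f t) \<in> borel_measurable lborel" by measurable
  show "AE t in lborel. norm (coherent y t * f t) \<le> norm (f t)"
    by (auto simp: gaussian_wave_def norm_mult intro!: mult_left_le_one_le)
qed

text \<open>Up to a constant, the operator with symbol \<^term>\<open>atom x y\<close> is the rank-one operator
  \<open>f \<mapsto> \<langle>f, g\<^sub>y\<rangle> g\<^sub>x\<close> for the coherent states \<open>g\<^sub>x\<close> and \<open>g\<^sub>y\<close>.\<close>
lemma weyl_op_atom:
  fixes x y :: "'a::euclidean_space"
  assumes f: "integrable lborel f"
  shows "weyl_op (atom x y) f s = complex_of_real (1 / (2 * sqrt pi) ^ DIM('a)) * coherent x s * (\<integral>t. coherent y t * f t \<partial>lborel)"
proof -
  have inner: "(\<integral>\<xi>. atom x y ((1/2) *\<^sub>R (s + t), \<xi>) * cis ((s - t) \<bullet> \<xi>) \<partial>lborel)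
     = complex_of_real (sqrt pi ^ DIM('a)) * coherent x s * coherent y t" for t
  proof -
    let ?w = "(s - t) + (y - x)"
    have eq: "atom x y ((1/2) *\<^sub>R (s + t), \<xi>) * cis ((s - t) \<bullet> \<xi>)
       = complex_of_real (exp (- (norm ((1/2) *\<^sub>R (s + t) - (1/2) *\<^sub>R (x + y)))\<^sup>2)) * gaussian_wave 1 0 ?w \<xi>" for \<xi>
    proof -
      let ?m = "(1/2) *\<^sub>R (s + t) - (1/2) *\<^sub>R (x + y)"
      have "exp (- 1 * (norm (((1/2) *\<^sub>R (s + t), \<xi>) - ((1/2) *\<^sub>R (x + y), 0)))\<^sup>2) = exp (- (norm ?m)\<^sup>2) * exp (- 1 * (norm (\<xi> - 0))\<^sup>2)"
        by (simp add: norm_Pair exp_add[symmetric])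
      moreover have "cis (?w \<bullet> \<xi>) = cis ((0, y - x) \<bullet> ((1/2) *\<^sub>R (s + t), \<xi>)) * cis ((s - t) \<bullet> \<xi>)"
        by (simp add: inner_add_left cis_mult add.commute)
      ultimately show ?thesis
        unfolding atom_def gaussian_wave_def by (simp only: of_real_mult mult_ac)
    qed
    \<comment> \<open>The parallelogram law for s - x and t - y. It splits the kernel into a
      function of s times a function of t, so the operator has rank one.\<close>
    have "(norm ((1/2) *\<^sub>R (s + t) - (1/2) *\<^sub>R (x + y)))\<^sup>2 + (norm ?w)\<^sup>2 / 4 = (norm (s - x))\<^sup>2 / 2 + (norm (t - y))\<^sup>2 / 2"
      unfolding power2_norm_eq_inner by (simp add: inner_simps field_simps inner_commute)
    then have e: "exp (- (norm ((1/2) *\<^sub>R (s + t) - (1/2) *\<^sub>R (x + y)))\<^sup>2) * exp (- (norm ?w)\<^sup>2 / 4) = exp (- (1/2) * (norm (s - x))\<^sup>2) * exp (- (1/2) * (norm (t - y))\<^sup>2)"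
      unfolding exp_add[symmetric] by (simp add: field_simps)
    show ?thesis
      unfolding eq integral_mult_right_zero integral_gaussian_wave_1
      using arg_cong[OF e, of complex_of_real] by (simp add: gaussian_wave_def mult_ac)
  qed
  have "weyl_op (atom x y) f s = complex_of_real (1 / (2 * pi) ^ DIM('a)) *
    (\<integral>t. complex_of_real (sqrt pi ^ DIM('a)) * coherent x s * (coherent y t * f t) \<partial>lborel)"
    unfolding weyl_op_Fubini[OF atom_schwartz f] inner by (simp only: mult_ac)
  also have "\<dots> = complex_of_real (1 / (2 * pi) ^ DIM('a) * sqrt pi ^ DIM('a)) * coherent x s * (\<integral>t. coherent y t * f t \<partial>lborel)"
    unfolding integral_mult_right_zero by simp
  \<comment> \<open>The factor (2 pi)^(-d) comes from the quantization, sqrt(pi)^d from the Gaussian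
    integral over the second variable.\<close>
  also have "1 / (2 * pi) ^ DIM('a) * sqrt pi ^ DIM('a) = 1 / (2 * sqrt pi) ^ DIM('a)"
  proof -
    have "(2 * pi) ^ DIM('a) = (2 * sqrt pi) ^ DIM('a) * sqrt pi ^ DIM('a)"
      unfolding power_mult_distrib[symmetric] mult.assoc by (simp del: power_mult_distrib)
    then show ?thesis by simp
  qed
  finally show ?thesis .
qed

text \<open>Completing the square at the midpoint of y and y'. This overlap is the source of the
  factor exp(-|y - y'|^2 / 4) that suppresses cross terms.\<close>

lemma integral_coherent_mult:
  fixes y y' :: "'a::euclidean_space"
  shows "(\<integral>t. coherent y t * coherent y' t \<partial>lborel) = complex_of_real (sqrt pi ^ DIM('a) * exp (- (norm (y - y'))\<^sup>2 / 4))"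
proof -
  let ?c = "(1/2) *\<^sub>R (y + y')"
  have "coherent y t * coherent y' t = complex_of_real (exp (- (norm (y - y'))\<^sup>2 / 4)) * gaussian_wave 1 0 0 (- ?c + t)" for t
  proof -
    have "(norm (t - y))\<^sup>2 / 2 + (norm (t - y'))\<^sup>2 / 2 = (norm (- ?c + t))\<^sup>2 + (norm (y - y'))\<^sup>2 / 4"
      unfolding power2_norm_eq_inner by (simp add: inner_simps field_simps inner_commute)
    then have "exp (- (1/2) * (norm (t - y))\<^sup>2) * exp (- (1/2) * (norm (t - y'))\<^sup>2) = exp (- (norm (y - y'))\<^sup>2 / 4) * exp (- 1 * (norm (- ?c + t - 0))\<^sup>2)"
      unfolding exp_add[symmetric] by (simp add: field_simps)
    from arg_cong[OF this, of complex_of_real] show ?thesis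
      by (simp add: gaussian_wave_def)
  qed
  then have "(\<integral>t. coherent y t * coherent y' t \<partial>lborel) = complex_of_real (exp (- (norm (y - y'))\<^sup>2 / 4)) * (\<integral>t. gaussian_wave 1 0 (0::'a) (- ?c + t) \<partial>lborel)"
    by simp
  also have "(\<integral>t. gaussian_wave 1 0 (0::'a) (- ?c + t) \<partial>lborel) = (\<integral>t. gaussian_wave 1 0 (0::'a) t \<partial>lborel)"
    by (rule integral_lborel_translate) (intro schwartz_measurable gaussian_wave_schwartz, simp)
  finally show ?thesis unfolding integral_gaussian_wave_1 by simp
qed

text \<open>Testing with Gaussians that concentrate at y0 shows that the kernel vanishes. For fixed
  q the kernel at (q + v/2, q - v/2) is the Fourier transform of \<open>c (q, _)\<close> at v, so
  Fourier uniqueness finishes.\<close>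

lemma weyl_op_injective:
  fixes c :: "'a::euclidean_space \<times> 'a \<Rightarrow> complex"
  assumes c: "c \<in> schwartz_space" and zero: "\<And>f x. f \<in> schwartz_space \<Longrightarrow> weyl_op c f x = 0"
  shows "c z = 0"
proof -
  obtain C where C: "C > 0" "\<And>q \<xi>. norm (c (q, \<xi>)) \<le> C * decay (real (2 * DIM('a))) \<xi>"
    using schwartz_slice_bound[OF c] by blast
  have cc: "continuous_on UNIV c" using c by (rule schwartz_continuous_on)
  have int: "integrable lborel (\<lambda>\<xi>::'a. C * decay (real (2 * DIM('a))) \<xi>)"
    by (intro integrable_mult_right integrable_decay) simp
  define K where "K x y = (\<integral>\<xi>. c ((1/2) *\<^sub>R (x + y), \<xi>) * cis ((x - y) \<bullet> \<xi>) \<partial>lborel)" for x y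
  have "K x y0 = 0" for x y0
  proof (rule gaussian_approximate_identity[where h = "K x"])
    have meas: "(\<lambda>\<xi>. c ((1/2) *\<^sub>R (x + y), \<xi>) * cis ((x - y) \<bullet> \<xi>)) \<in> borel_measurable borel" for y
      unfolding cis_conv_exp
      by (intro borel_measurable_continuous_onI continuous_intros continuous_on_compose2[OF cc]) auto
    show contK: "continuous_on UNIV (K x)"
      unfolding K_def[abs_def]
    proof (rule continuous_on_parametric_integral[OF _ meas int])
      show "continuous_on UNIV (\<lambda>y. c ((1/2) *\<^sub>R (x + y), \<xi>) * cis ((x - y) \<bullet> \<xi>))" for \<xi>
        unfolding cis_conv_exp by (intro continuous_intros continuous_on_compose2[OF cc]) auto
    qed (use C(2) in \<open>auto simp: norm_mult\<close>)
    show "norm (K x y) \<le> (\<integral>\<xi>. C * decay (real (2 * DIM('a))) (\<xi>::'a) \<partial>lborel)" for y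
      unfolding K_def
    proof (rule Bochner_Integration.integral_norm_bound_integral[OF _ int])
      have *: "norm (c ((1/2) *\<^sub>R (x + y), \<xi>) * cis ((x - y) \<bullet> \<xi>)) \<le> C * decay (real (2 * DIM('a))) \<xi>" for \<xi>
        unfolding norm_mult norm_cis mult_1_right by (rule C(2))
      then show "norm (c ((1/2) *\<^sub>R (x + y), \<xi>) * cis ((x - y) \<bullet> \<xi>)) \<le> C * decay (real (2 * DIM('a))) \<xi>" for \<xi> .
      show "integrable lborel (\<lambda>\<xi>. c ((1/2) *\<^sub>R (x + y), \<xi>) * cis ((x - y) \<bullet> \<xi>))"
        by (rule Bochner_Integration.integrable_bound[OF int])
          (use meas order_trans[OF * abs_ge_self] in auto)
    qed
    fix s :: real assume s: "s > 0"
    \<comment> \<open>The width is chosen such that substituting y0 + s w produces exactly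
      exp(-|w|^2 / 2).\<close>
    let ?f = "gaussian_wave (1 / (2 * s\<^sup>2)) y0 0"
    have f: "?f \<in> schwartz_space" using s by (intro gaussian_wave_schwartz) simp
    have "0 = (\<integral>y. ?f y * K x y \<partial>lborel)"
      using zero[OF f, of x] by (simp add: weyl_op_Fubini[OF c schwartz_integrable[OF f]] K_def)
    also have "\<dots> = \<bar>s\<bar> ^ DIM('a) *\<^sub>R (\<integral>w. ?f (y0 + s *\<^sub>R w) * K x (y0 + s *\<^sub>R w) \<partial>lborel)"
      using s by (intro integral_lborel_affine borel_measurable_times schwartz_measurable f borel_measurable_continuous_onI contK) auto
    also have "(\<lambda>w. ?f (y0 + s *\<^sub>R w) * K x (y0 + s *\<^sub>R w)) = (\<lambda>w. K x (y0 + s *\<^sub>R w) * exp (- (norm w)\<^sup>2 / 2))"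
      using s by (simp add: gaussian_wave_def power_mult_distrib mult.commute)
    finally show "(\<integral>w. K x (y0 + s *\<^sub>R w) * exp (- (norm w)\<^sup>2 / 2) \<partial>lborel) = 0"
      using s by simp
  qed
  note K0 = this
  obtain q \<xi>0 where z: "z = (q, \<xi>0)" by force
  have "c (q, \<xi>0) = 0"
  proof (rule fourier_injective[where h = "\<lambda>\<xi>. c (q, \<xi>)"])
    show cont: "continuous_on UNIV (\<lambda>\<xi>. c (q, \<xi>))"
      by (intro continuous_intros continuous_on_compose2[OF cc]) auto
    show "norm (c (q, \<xi>)) \<le> C" for \<xi>
      by (rule order_trans[OF C(2)]) (use C(1) decay_le_1[of "real (2 * DIM('a))" \<xi>] in \<open>simp add: mult_left_le\<close>)
    show "integrable lborel (\<lambda>\<xi>. c (q, \<xi>))"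
      by (rule Bochner_Integration.integrable_bound[OF int])
        (use borel_measurable_continuous_onI[OF cont] order_trans[OF C(2) abs_ge_self] in auto)
    show "(\<integral>\<xi>. c (q, \<xi>) * cis (v \<bullet> \<xi>) \<partial>lborel) = 0" for v
    proof -
      \<comment> \<open>The pair of points with midpoint q and difference v.\<close>
      have 1: "(1/2) *\<^sub>R ((q + (1/2) *\<^sub>R v) + (q - (1/2) *\<^sub>R v)) = q"
        by (simp add: scaleR_add_right[symmetric] flip: scaleR_2)
      have 2: "(q + (1/2) *\<^sub>R v) - (q - (1/2) *\<^sub>R v) = v"
        by (simp add: scaleR_add_left[symmetric])
      show ?thesis using K0[of "q + (1/2) *\<^sub>R v" "q - (1/2) *\<^sub>R v"] unfolding K_def 1 2 .
    qed
  qed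
  then show ?thesis by (simp add: z)
qed

text \<open>A definite description can be evaluated only once uniqueness is known; here it follows
  from injectivity of the quantization.\<close>

lemma weyl_product_eqI:
  assumes c: "c \<in> schwartz_space" and eq: "\<And>f. f \<in> schwartz_space \<Longrightarrow> weyl_op c f = weyl_op a (weyl_op b f)"
  shows "a #\<^sub>w b = c"
  unfolding weyl_product_def
proof (rule the_equality)
  show "c \<in> schwartz_space \<and> (\<forall>f\<in>schwartz_space. weyl_op c f = weyl_op a (weyl_op b f))"
    using assms by blast
  fix c' assume c': "c' \<in> schwartz_space \<and> (\<forall>f\<in>schwartz_space. weyl_op c' f = weyl_op a (weyl_op b f))"
  \<comment> \<open>The difference c' - c is written as a sum over two booleans so that the lemmas
    on finite sums apply.\<close>
  let ?I = "{True, False}"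
  let ?k = "\<lambda>i. if i then 1 else - 1 :: complex" and ?a = "\<lambda>i. if i then c' else c"
  have "(\<lambda>z. \<Sum>i\<in>?I. ?k i * ?a i z) z = 0" for z
  proof (rule weyl_op_injective)
    show "(\<lambda>z. \<Sum>i\<in>?I. ?k i * ?a i z) \<in> schwartz_space"
      using c c' by (intro schwartz_sum) auto
    fix f :: "'a \<Rightarrow> complex" and x assume f: "f \<in> schwartz_space"
    have "weyl_op (\<lambda>z. \<Sum>i\<in>?I. ?k i * ?a i z) f x = (\<Sum>i\<in>?I. ?k i * weyl_op (?a i) f x)"
      using c c' schwartz_integrable[OF f] by (intro weyl_op_sum) auto
    also have "\<dots> = 0" using f c' eq by simp
    finally show "weyl_op (\<lambda>z. \<Sum>i\<in>?I. ?k i * ?a i z) f x = 0" .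
  qed
  then show "c' = c" by (simp add: fun_eq_iff)
qed

text \<open>Composing two rank-one operators leaves the outer states and multiplies by the overlap
  of the inner ones. The pairs with y = y' behave like products of matrix units, up to the common
  factor 2^(-d).\<close>

lemma weyl_product_atoms:
  fixes x y :: "'i \<Rightarrow> 'a::euclidean_space" and y' z :: "'j \<Rightarrow> 'a"
  assumes I: "finite I" "I \<noteq> {}" and J: "finite J" "J \<noteq> {}"
  shows "(\<lambda>Z. \<Sum>i\<in>I. c i * atom (x i) (y i) Z) #\<^sub>w (\<lambda>Z. \<Sum>j\<in>J. d j * atom (y' j) (z j) Z)
    = (\<lambda>Z. \<Sum>(i, j)\<in>I \<times> J. (c i * d j * of_real ((1/2) ^ DIM('a) * exp (- (norm (y i - y' j))\<^sup>2 / 4))) * atom (x i) (z j) Z)"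
    (is "?a #\<^sub>w ?b = ?c")
proof (rule weyl_product_eqI)
  let ?k = "\<lambda>i j. c i * d j * of_real ((1/2) ^ DIM('a) * exp (- (norm (y i - y' j))\<^sup>2 / 4))"
  have c_eq: "?c = (\<lambda>Z. \<Sum>p\<in>I \<times> J. ?k (fst p) (snd p) * atom (x (fst p)) (z (snd p)) Z)"
    by (simp add: split_beta)
  show "?c \<in> schwartz_space"
    unfolding c_eq using I J by (intro schwartz_sum atom_schwartz) auto
  fix f :: "'a \<Rightarrow> complex" assume "f \<in> schwartz_space"
  then have f: "integrable lborel f" by (rule schwartz_integrable)
  define \<kappa> where "\<kappa> = complex_of_real (1 / (2 * sqrt pi) ^ DIM('a))"
  define L where "L j = (\<integral>t. coherent (z j) t * f t \<partial>lborel)" for j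
  define h where "h = weyl_op ?b f"
  have h: "h = (\<lambda>s. \<Sum>j\<in>J. (d j * \<kappa> * L j) * coherent (y' j) s)"
    unfolding h_def using J
    by (simp add: weyl_op_sum[OF _ atom_schwartz f] weyl_op_atom[OF f] \<kappa>_def L_def mult_ac fun_eq_iff)
  have hi: "integrable lborel h"
    unfolding h by (intro Bochner_Integration.integrable_sum integrable_mult_right schwartz_integrable coherent_schwartz)
  have ih: "(\<integral>t. coherent v t * h t \<partial>lborel) = (\<Sum>j\<in>J. d j * \<kappa> * L j * of_real (sqrt pi ^ DIM('a) * exp (- (norm (v - y' j))\<^sup>2 / 4)))" for v
  proof -
    have "(\<integral>t. coherent v t * h t \<partial>lborel) = (\<integral>t. (\<Sum>j\<in>J. (d j * \<kappa> * L j) * (coherent v t * coherent (y' j) t)) \<partial>lborel)"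
      by (simp add: h sum_distrib_left mult_ac)
    also have "\<dots> = (\<Sum>j\<in>J. (\<integral>t. (d j * \<kappa> * L j) * (coherent v t * coherent (y' j) t) \<partial>lborel))"
      by (intro Bochner_Integration.integral_sum integrable_mult_right integrable_coherent_mult schwartz_integrable coherent_schwartz)
    finally show ?thesis unfolding integral_mult_right_zero integral_coherent_mult .
  qed
  \<comment> \<open>Each quantized atom contributes one factor \<open>\<kappa>\<close>. One of the
    two merges with the overlap into 2^(-d), the other belongs to the quantized atom of the
    product.\<close>
  have \<kappa>: "\<kappa> * of_real (sqrt pi ^ DIM('a) * E) = of_real ((1/2) ^ DIM('a) * E)" for E
    by (simp add: \<kappa>_def power_mult_distrib power_divide)
  show "weyl_op ?c f = weyl_op ?a (weyl_op ?b f)"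
  proof
    fix s
    have "weyl_op ?a h s = (\<Sum>i\<in>I. c i * (\<kappa> * coherent (x i) s * (\<Sum>j\<in>J. d j * \<kappa> * L j * of_real (sqrt pi ^ DIM('a) * exp (- (norm (y i - y' j))\<^sup>2 / 4)))))"
      using I by (simp add: weyl_op_sum[OF _ atom_schwartz hi] weyl_op_atom[OF hi] ih \<kappa>_def)
    also have "\<dots> = (\<Sum>i\<in>I. \<Sum>j\<in>J. c i * d j * (\<kappa> * of_real (sqrt pi ^ DIM('a) * exp (- (norm (y i - y' j))\<^sup>2 / 4))) * (\<kappa> * coherent (x i) s * L j))"
      by (simp only: sum_distrib_left mult_ac)
    also have "\<dots> = (\<Sum>i\<in>I. \<Sum>j\<in>J. ?k i j * (\<kappa> * coherent (x i) s * L j))"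
      unfolding \<kappa> ..
    also have "\<dots> = (\<Sum>p\<in>I \<times> J. ?k (fst p) (snd p) * (\<kappa> * coherent (x (fst p)) s * L (snd p)))"
      unfolding sum.cartesian_product by (simp add: split_beta)
    also have "\<dots> = weyl_op ?c f s"
      unfolding c_eq using I J by (subst weyl_op_sum[OF _ atom_schwartz f]) (auto simp: weyl_op_atom[OF f] \<kappa>_def L_def)
    finally show "weyl_op ?c f s = weyl_op ?a (weyl_op ?b f) s" by (simp add: h_def)
  qed
qed


section \<open>Short-time Fourier transforms\<close>

text \<open>The difference quotients have integral 0 by translation invariance and converge to the
  derivative; dominated convergence carries the 0 to the limit.\<close>

lemma integral_partial_deriv_eq_0:
  fixes u :: "'a::euclidean_space \<Rightarrow> complex"
  assumes der: "\<And>z. (u has_derivative u' z) (at z)"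
    and u: "integrable lborel u" and u': "\<And>z. norm (u' z b) \<le> C * decay (real (2 * DIM('a))) z"
    and meas: "(\<lambda>z. u' z b) \<in> borel_measurable borel"
  shows "(\<integral>z. u' z b \<partial>lborel) = 0"
proof -
  let ?s = "real (2 * DIM('a))"
  have C: "C \<ge> 0" using order_trans[OF norm_ge_zero u'[of 0]] decay_pos[of "real (2 * DIM('a))" "0::'a"]
    by (simp only: zero_le_mult_iff) linarith
  have [measurable]: "u \<in> borel_measurable borel" using u by (simp add: borel_measurable_integrable)
  have line: "((\<lambda>t. u (z + t *\<^sub>R b)) has_derivative (\<lambda>t. u' (z + x *\<^sub>R b) (t *\<^sub>R b))) (at x)" for z x
  proof -
    have "((\<lambda>t. z + t *\<^sub>R b) has_derivative (\<lambda>t. t *\<^sub>R b)) (at x)"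
      by (auto intro!: derivative_eq_intros)
    from has_derivative_compose[OF this der] show ?thesis .
  qed
  define q where "q n z = real (Suc n) *\<^sub>R (u (z + inverse (Suc n) *\<^sub>R b) - u z)" for n z
  have "(\<lambda>n. \<integral>z. q n z \<partial>lborel) \<longlonglongrightarrow> (\<integral>z. u' z b \<partial>lborel)"
  proof (rule integral_dominated_convergence[where w = "\<lambda>z. C * (decay ?s z / decay ?s b)"])
    show "AE z in lborel. (\<lambda>n. q n z) \<longlonglongrightarrow> u' z b"
    proof (rule AE_I2)
      fix z
      have "((\<lambda>t. u (z + t *\<^sub>R b)) has_derivative (\<lambda>t. u' z (t *\<^sub>R b))) (at 0)"
        using line[of z 0] by simp
      then have "((\<lambda>t. u (z + t *\<^sub>R b)) has_vector_derivative u' z b) (at 0)"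
        using linear_scale[OF has_derivative_linear[OF der[of z]]] by (simp add: has_vector_derivative_def)
      then have "((\<lambda>t. norm (u (z + (0 + t) *\<^sub>R b) - u (z + 0 *\<^sub>R b) - t *\<^sub>R u' z b) / norm t) \<longlongrightarrow> 0) (at 0)"
        unfolding has_vector_derivative_def has_derivative_at by blast
      then have "((\<lambda>t. norm (u (z + t *\<^sub>R b) - u z - t *\<^sub>R u' z b) / norm t) \<longlongrightarrow> 0) (at 0)"
        by simp
      moreover have "filterlim (\<lambda>n. inverse (real (Suc n))) (at 0) sequentially"
        by (intro filterlim_atI LIMSEQ_inverse_real_of_nat) auto
      ultimately have "(\<lambda>n. norm (u (z + inverse (real (Suc n)) *\<^sub>R b) - u z - inverse (real (Suc n)) *\<^sub>R u' z b) / norm (inverse (real (Suc n)))) \<longlonglongrightarrow> 0"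
        by (rule filterlim_compose[of "\<lambda>t. norm (u (z + t *\<^sub>R b) - u z - t *\<^sub>R u' z b) / norm t" _ _ "\<lambda>n. inverse (real (Suc n))"])
      moreover have "norm (u (z + inverse (real (Suc n)) *\<^sub>R b) - u z - inverse (real (Suc n)) *\<^sub>R u' z b) / norm (inverse (real (Suc n))) = norm (q n z - u' z b)" for n
      proof -
        have "q n z - u' z b = real (Suc n) *\<^sub>R (u (z + inverse (real (Suc n)) *\<^sub>R b) - u z - inverse (real (Suc n)) *\<^sub>R u' z b)"
          by (simp add: q_def scaleR_diff_right del: of_nat_Suc)
        then show ?thesis by (simp add: divide_inverse del: of_nat_Suc)
      qed
      ultimately have "(\<lambda>n. norm (q n z - u' z b)) \<longlonglongrightarrow> 0" by simp
      then show "(\<lambda>n. q n z) \<longlonglongrightarrow> u' z b"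
        by (rule LIM_zero_cancel[OF tendsto_norm_zero_cancel])
    qed
    show "AE z in lborel. norm (q n z) \<le> C * (decay ?s z / decay ?s b)" for n
    proof (rule AE_I2)
      fix z
      let ?h = "inverse (real (Suc n))"
      have h: "0 < ?h" "?h \<le> 1" by (auto simp: field_simps)
      have d: "((\<lambda>t. u (z + t *\<^sub>R b)) has_derivative (\<lambda>t. u' (z + x *\<^sub>R b) (t *\<^sub>R b))) (at x)" for x
        by (rule line)
      \<comment> \<open>By the mean value theorem the quotient is at most the derivative at some z +
        x b with 0 < x < 1. Peetre's inequality moves the decay back to z at the cost of the
        constant factor \<open>1 / decay ?s b\<close>, uniformly in n.\<close>
      have "\<exists>x\<in>{0<..<?h}. norm (u (z + ?h *\<^sub>R b) - u (z + 0 *\<^sub>R b)) \<le> norm (u' (z + x *\<^sub>R b) ((?h - 0) *\<^sub>R b))"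
        by (rule mvt_general[OF h(1)])
          (rule has_derivative_continuous_on[OF has_derivative_at_withinI[OF d]], rule d)
      then obtain x where x: "0 < x" "x < ?h" and le: "norm (u (z + ?h *\<^sub>R b) - u z) \<le> norm (u' (z + x *\<^sub>R b) (?h *\<^sub>R b))"
        by auto
      have "norm (q n z) = real (Suc n) * norm (u (z + ?h *\<^sub>R b) - u z)"
        by (simp add: q_def del: of_nat_Suc)
      also have "\<dots> \<le> real (Suc n) * norm (u' (z + x *\<^sub>R b) (?h *\<^sub>R b))"
        using le by (intro mult_left_mono) auto
      also have "\<dots> = norm (u' (z + x *\<^sub>R b) b)"
        using linear_scale[OF has_derivative_linear[OF der[of "z + x *\<^sub>R b"]]] by simp
      also have "\<dots> \<le> C * decay ?s (z + x *\<^sub>R b)" by (rule u')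
      also have "\<dots> \<le> C * (decay ?s z / decay ?s b)"
      proof (rule mult_left_mono[OF _ C])
        have "x \<le> 1" using x h by linarith
        then have "decay ?s b \<le> decay ?s (x *\<^sub>R b)"
          using x(1) by (intro decay_mono_norm) (auto simp: mult_left_le_one_le)
        then have "decay ?s (z + x *\<^sub>R b) * decay ?s b \<le> decay ?s (z + x *\<^sub>R b) * decay ?s (x *\<^sub>R b)"
          by (intro mult_left_mono) auto
        also have "\<dots> \<le> decay ?s z"
          using decay_Peetre[of ?s z "- (x *\<^sub>R b)"] by simp
        finally show "decay ?s (z + x *\<^sub>R b) \<le> decay ?s z / decay ?s b"
          by (simp add: pos_le_divide_eq)
      qed
      finally show "norm (q n z) \<le> C * (decay ?s z / decay ?s b)" .
    qed
    show "integrable lborel (\<lambda>z::'a. C * (decay ?s z / decay ?s b))"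
      by (intro integrable_mult_right integrable_divide_zero integrable_decay) simp
    show "q n \<in> borel_measurable lborel" for n
      unfolding q_def by measurable
  qed (use meas in simp)
  moreover have "(\<integral>z. q n z \<partial>lborel) = 0" for n
  proof -
    let ?c = "inverse (real (Suc n)) *\<^sub>R b"
    have "(\<integral>z. q n z \<partial>lborel) = real (Suc n) *\<^sub>R (\<integral>z. u (?c + z) - u z \<partial>lborel)"
      unfolding q_def integral_scaleR_right by (simp only: add.commute)
    also have "(\<integral>z. u (?c + z) - u z \<partial>lborel) = (\<integral>z. u (?c + z) \<partial>lborel) - (\<integral>z. u z \<partial>lborel)"
      by (rule Bochner_Integration.integral_diff[OF integrable_lborel_translate[OF u] u])
    also have "(\<integral>z. u (?c + z) \<partial>lborel) = (\<integral>z. u z \<partial>lborel)"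
      by (rule integral_lborel_translate) simp
    finally show ?thesis by simp
  qed
  ultimately have "(\<lambda>n. 0) \<longlonglongrightarrow> (\<integral>z. u' z b \<partial>lborel)" by (simp only:)
  then show ?thesis by (rule LIMSEQ_unique[OF _ tendsto_const])
qed

text \<open>An unnormalised Euclidean version with phase of positive sign. The symplectic transform
  is a constant times its value at frequency \<open>2 *\<^sub>R rot Y\<close>.\<close>

definition stft :: "('a::euclidean_space \<Rightarrow> complex) \<Rightarrow> ('a \<Rightarrow> complex) \<Rightarrow> 'a \<Rightarrow> 'a \<Rightarrow> complex" where
  "stft \<phi> g x \<eta> = (\<integral>z. g z * cnj (\<phi> (z - x)) * cis (\<eta> \<bullet> z) \<partial>lborel)"

context
  fixes g \<phi> :: "'a::euclidean_space \<Rightarrow> complex"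
  assumes g: "g \<in> schwartz_space" and \<phi>: "\<phi> \<in> schwartz_space"
begin

lemma stft_integrand_measurable: "(\<lambda>z. g z * cnj (\<phi> (z - x)) * cis (\<eta> \<bullet> z)) \<in> borel_measurable borel"
proof -
  have [measurable]: "g \<in> borel_measurable borel" "\<phi> \<in> borel_measurable borel"
    using g \<phi> by (auto intro: schwartz_measurable)
  have [measurable]: "cnj \<in> borel_measurable borel"
    by (intro borel_measurable_continuous_onI continuous_intros)
  show ?thesis by measurable
qed

text \<open>The factor g supplies order s + 2d: 2d for integrability in z, and s to be combined with
  the decay of the window at z - x into decay in x.\<close>

lemma stft_integrand_bound:
  assumes "s \<ge> 0"
  shows "\<exists>C>0. \<forall>x \<eta> z. norm (g z * cnj (\<phi> (z - x)) * cis (\<eta> \<bullet> z)) \<le> C * decay s x * decay (real (2 * DIM('a))) z"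
proof -
  let ?n = "real (2 * DIM('a))"
  obtain A where A: "A > 0" "\<And>z. norm (g z) \<le> A * decay (s + ?n) z" using schwartz_decay[OF g] by metis
  obtain B where B: "B > 0" "\<And>z. norm (\<phi> z) \<le> B * decay s z" using schwartz_decay[OF \<phi>] by metis
  have "norm (g z * cnj (\<phi> (z - x)) * cis (\<eta> \<bullet> z)) \<le> A * B * decay s x * decay ?n z" for x \<eta> z
  proof -
    have "norm (g z * cnj (\<phi> (z - x)) * cis (\<eta> \<bullet> z)) \<le> (A * decay (s + ?n) z) * (B * decay s (z - x))"
      unfolding norm_mult using A B by (auto simp: less_imp_le intro!: mult_mono)
    also have "\<dots> = A * B * (decay s (x - z) * decay s z) * decay ?n z"
      by (simp add: decay_add decay_minus_commute[of s z x] mult_ac)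
    also have "\<dots> \<le> A * B * decay s x * decay ?n z"
      using A(1) B(1) decay_Peetre[OF assms, of x z] by (intro mult_right_mono mult_left_mono) auto
    finally show ?thesis .
  qed
  then show ?thesis using A B by (intro exI[of _ "A * B"]) auto
qed

lemma stft_integrable: "integrable lborel (\<lambda>z. g z * cnj (\<phi> (z - x)) * cis (\<eta> \<bullet> z))"
proof -
  obtain C where C: "\<And>x \<eta> z. norm (g z * cnj (\<phi> (z - x)) * cis (\<eta> \<bullet> z)) \<le> C * decay 0 x * decay (real (2 * DIM('a))) z"
    using stft_integrand_bound[of 0] by auto
  show ?thesis
  proof (rule Bochner_Integration.integrable_bound)
    show "integrable lborel (\<lambda>z::'a. C * decay 0 x * decay (real (2 * DIM('a))) z)"
      by (intro integrable_mult_right integrable_decay) simp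
    show "AE z in lborel. norm (g z * cnj (\<phi> (z - x)) * cis (\<eta> \<bullet> z)) \<le> norm (C * decay 0 x * decay (real (2 * DIM('a))) z)"
      by (rule AE_I2) (metis C order_trans abs_ge_self real_norm_def)
  qed (use stft_integrand_measurable in simp)
qed

lemma stft_bound_position:
  assumes "s \<ge> 0"
  shows "\<exists>C>0. \<forall>x \<eta>. norm (stft \<phi> g x \<eta>) \<le> C * decay s x"
proof -
  let ?n = "real (2 * DIM('a))"
  obtain C where C0: "C > 0" and C: "\<And>x \<eta> z. norm (g z * cnj (\<phi> (z - x)) * cis (\<eta> \<bullet> z)) \<le> C * decay s x * decay ?n z"
    using stft_integrand_bound[OF assms] by auto
  define D where "D = (\<integral>z. decay ?n (z::'a) \<partial>lborel)"
  have D: "D \<ge> 0" unfolding D_def by (rule integral_nonneg_AE) auto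
  have "norm (stft \<phi> g x \<eta>) \<le> C * (D + 1) * decay s x" for x \<eta>
  proof -
    have "norm (stft \<phi> g x \<eta>) \<le> (\<integral>z. C * decay s x * decay ?n (z::'a) \<partial>lborel)"
      unfolding stft_def
      by (rule Bochner_Integration.integral_norm_bound_integral[OF stft_integrable])
         (auto intro!: C integrable_mult_right integrable_decay simp del: of_nat_mult)
    also have "\<dots> = C * decay s x * D" unfolding D_def by simp
    also have "\<dots> \<le> C * decay s x * (D + 1)" using C0 by (intro mult_left_mono) auto
    finally show ?thesis by (simp only: mult_ac)
  qed
  then show ?thesis using C0 D by (intro exI[of _ "C * (D + 1)"]) auto
qed

lemma continuous_on_stft: "continuous_on UNIV (\<lambda>p. stft \<phi> g (fst p) (snd p))"
proof -
  let ?n = "real (2 * DIM('a))"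
  obtain C where C0: "C > 0" and C: "\<And>x \<eta> z. norm (g z * cnj (\<phi> (z - x)) * cis (\<eta> \<bullet> z)) \<le> C * decay 0 x * decay ?n z"
    using stft_integrand_bound[of 0] by auto
  show ?thesis
    unfolding stft_def
  proof (rule continuous_on_parametric_integral)
    show "continuous_on UNIV (\<lambda>p. g z * cnj (\<phi> (z - fst p)) * cis (snd p \<bullet> z))" for z
      unfolding cis_conv_exp
      by (intro continuous_intros continuous_on_compose2[OF schwartz_continuous_on[OF \<phi>, of UNIV]]) auto
    show "integrable lborel (\<lambda>z::'a. C * decay ?n z)"
      by (intro integrable_mult_right integrable_decay) simp
    show "norm (g z * cnj (\<phi> (z - fst p)) * cis (snd p \<bullet> z)) \<le> C * decay ?n z" for p z
      using C[of z "fst p" "snd p"] by simp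
  qed (rule stft_integrand_measurable)
qed

end

text \<open>The derivative of the integrand has integral 0. Its three product-rule terms exchange a
  factor of frequency for a derivative of either g or the window.\<close>

lemma stft_by_parts:
  fixes g \<phi> :: "'a::euclidean_space \<Rightarrow> complex"
  assumes g: "g \<in> schwartz_space" and \<phi>: "\<phi> \<in> schwartz_space" and b: "b \<in> Basis"
  shows "\<i> * complex_of_real (\<eta> \<bullet> b) * stft \<phi> g x \<eta> = - stft \<phi> (partial_deriv b g) x \<eta> - stft (partial_deriv b \<phi>) g x \<eta>"
proof -
  let ?n = "real (2 * DIM('a))"
  note g' = schwartz_partial_deriv[OF g b] and \<phi>' = schwartz_partial_deriv[OF \<phi> b]
  let ?P = "\<lambda>\<phi> g z. g z * cnj (\<phi> (z - x)) * cis (\<eta> \<bullet> z)"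
  let ?u = "?P \<phi> g"
  define u' where "u' z h = frechet_derivative g (at z) h * cnj (\<phi> (z - x)) * cis (\<eta> \<bullet> z)
     + g z * cnj (frechet_derivative \<phi> (at (z - x)) h) * cis (\<eta> \<bullet> z) + \<i> * complex_of_real (\<eta> \<bullet> h) * ?u z" for z h
  have u'b: "u' z b = ?P \<phi> (partial_deriv b g) z + ?P (partial_deriv b \<phi>) g z + \<i> * complex_of_real (\<eta> \<bullet> b) * ?u z" for z
    by (simp add: u'_def partial_deriv_def)
  have der: "(?u has_derivative u' z) (at z)" for z
  proof -
    have 1: "(g has_derivative frechet_derivative g (at z)) (at z)"
      by (rule smooth_has_derivative[OF schwartz_smooth[OF g]])
    have "((\<lambda>z. \<phi> (z - x)) has_derivative (\<lambda>h. frechet_derivative \<phi> (at (z - x)) h)) (at z)"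
      by (rule has_derivative_compose[of "\<lambda>z. z - x" "\<lambda>h. h" _ UNIV \<phi>, OF _ smooth_has_derivative[OF schwartz_smooth[OF \<phi>]]])
         (auto intro!: derivative_eq_intros)
    then have 2: "((\<lambda>z. cnj (\<phi> (z - x))) has_derivative (\<lambda>h. cnj (frechet_derivative \<phi> (at (z - x)) h))) (at z)"
      by (rule bounded_linear.has_derivative[OF bounded_linear_cnj])
    have "((\<lambda>z. \<i> * complex_of_real (\<eta> \<bullet> z)) has_derivative (\<lambda>h. \<i> * complex_of_real (\<eta> \<bullet> h))) (at z)"
      by (auto intro!: derivative_eq_intros)
    from has_derivative_compose[OF this DERIV_exp[unfolded has_field_derivative_def]]
    have 3: "((\<lambda>z. cis (\<eta> \<bullet> z)) has_derivative (\<lambda>h. cis (\<eta> \<bullet> z) * (\<i> * complex_of_real (\<eta> \<bullet> h)))) (at z)"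
      by (simp add: cis_conv_exp)
    show ?thesis
      by (rule has_derivative_eq_rhs[OF has_derivative_mult[OF has_derivative_mult[OF 1 2] 3]])
         (simp add: u'_def fun_eq_iff algebra_simps)
  qed
  obtain A where A: "\<And>z. norm (?P \<phi> (partial_deriv b g) z) \<le> A * decay ?n z"
    using stft_integrand_bound[OF g' \<phi>, of 0] by fastforce
  obtain B where B: "\<And>z. norm (?P (partial_deriv b \<phi>) g z) \<le> B * decay ?n z"
    using stft_integrand_bound[OF g \<phi>', of 0] by fastforce
  obtain C where C: "\<And>z. norm (?u z) \<le> C * decay ?n z"
    using stft_integrand_bound[OF g \<phi>, of 0] by fastforce
  have bound: "norm (u' z b) \<le> (A + B + \<bar>\<eta> \<bullet> b\<bar> * C) * decay ?n z" for z
  proof -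
    have "norm (u' z b) \<le> norm (?P \<phi> (partial_deriv b g) z) + norm (?P (partial_deriv b \<phi>) g z) + norm (\<i> * complex_of_real (\<eta> \<bullet> b) * ?u z)"
      unfolding u'b by (intro norm_triangle_le add_right_mono norm_triangle_ineq)
    also have "norm (\<i> * complex_of_real (\<eta> \<bullet> b) * ?u z) = \<bar>\<eta> \<bullet> b\<bar> * norm (?u z)"
      by (simp add: norm_mult)
    also have "norm (?P \<phi> (partial_deriv b g) z) + norm (?P (partial_deriv b \<phi>) g z) + \<bar>\<eta> \<bullet> b\<bar> * norm (?u z)
      \<le> A * decay ?n z + B * decay ?n z + \<bar>\<eta> \<bullet> b\<bar> * (C * decay ?n z)"
      by (intro add_mono A B mult_left_mono C) auto
    finally show ?thesis by (simp only: distrib_right mult.assoc)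
  qed
  have meas: "(\<lambda>z. u' z b) \<in> borel_measurable borel"
    unfolding u'b by (intro borel_measurable_add borel_measurable_times borel_measurable_const stft_integrand_measurable g \<phi> g' \<phi>')
  have "0 = (\<integral>z. u' z b \<partial>lborel)"
    using integral_partial_deriv_eq_0[OF der stft_integrable[OF g \<phi>] bound meas] by simp
  also have "\<dots> = stft \<phi> (partial_deriv b g) x \<eta> + stft (partial_deriv b \<phi>) g x \<eta> + \<i> * complex_of_real (\<eta> \<bullet> b) * stft \<phi> g x \<eta>"
    unfolding u'b stft_def
    by (simp only: Bochner_Integration.integral_add Bochner_Integration.integrable_add integrable_mult_right
        stft_integrable[OF g \<phi>] stft_integrable[OF g' \<phi>] stft_integrable[OF g \<phi>'] integral_mult_right_zero)
  finally show ?thesis by (simp add: eq_neg_iff_add_eq_0 algebra_simps)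
qed

text \<open>The induction runs over all g and windows simultaneously, because integration by parts
  replaces one of them by its derivative.\<close>

lemma stft_bound_power:
  fixes g \<phi> :: "'a::euclidean_space \<Rightarrow> complex"
  assumes "g \<in> schwartz_space" and "\<phi> \<in> schwartz_space" and b: "b \<in> Basis" and s: "s \<ge> 0"
  shows "\<exists>C. \<forall>x \<eta>. \<bar>\<eta> \<bullet> b\<bar> ^ M * norm (stft \<phi> g x \<eta>) \<le> C * decay s x"
  using assms(1,2)
proof (induction M arbitrary: g \<phi>)
  case 0
  then show ?case using stft_bound_position[OF 0(1,2) s] by auto
next
  case (Suc M)
  note g' = schwartz_partial_deriv[OF Suc.prems(1) b] and \<phi>' = schwartz_partial_deriv[OF Suc.prems(2) b]
  obtain A where A: "\<And>x \<eta>. \<bar>\<eta> \<bullet> b\<bar> ^ M * norm (stft \<phi> (partial_deriv b g) x \<eta>) \<le> A * decay s x"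
    using Suc.IH[OF g' Suc.prems(2)] by blast
  obtain B where B: "\<And>x \<eta>. \<bar>\<eta> \<bullet> b\<bar> ^ M * norm (stft (partial_deriv b \<phi>) g x \<eta>) \<le> B * decay s x"
    using Suc.IH[OF Suc.prems(1) \<phi>'] by blast
  have "\<bar>\<eta> \<bullet> b\<bar> ^ Suc M * norm (stft \<phi> g x \<eta>) \<le> (A + B) * decay s x" for x \<eta>
  proof -
    have "\<bar>\<eta> \<bullet> b\<bar> * norm (stft \<phi> g x \<eta>) = norm (\<i> * complex_of_real (\<eta> \<bullet> b) * stft \<phi> g x \<eta>)"
      by (simp add: norm_mult)
    also have "\<dots> \<le> norm (stft \<phi> (partial_deriv b g) x \<eta>) + norm (stft (partial_deriv b \<phi>) g x \<eta>)"
      unfolding stft_by_parts[OF Suc.prems b] by (rule order_trans[OF norm_triangle_ineq4]) simp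
    finally have "\<bar>\<eta> \<bullet> b\<bar> ^ M * (\<bar>\<eta> \<bullet> b\<bar> * norm (stft \<phi> g x \<eta>)) \<le> \<bar>\<eta> \<bullet> b\<bar> ^ M * (norm (stft \<phi> (partial_deriv b g) x \<eta>) + norm (stft (partial_deriv b \<phi>) g x \<eta>))"
      by (intro mult_left_mono) auto
    then show ?thesis using A[of \<eta> x] B[of \<eta> x] by (simp add: distrib_left distrib_right mult_ac)
  qed
  then show ?case by blast
qed

lemma stft_decay:
  fixes g \<phi> :: "'a::euclidean_space \<Rightarrow> complex"
  assumes g: "g \<in> schwartz_space" and \<phi>: "\<phi> \<in> schwartz_space" and s: "s \<ge> 0"
  shows "\<exists>C>0. \<forall>x \<eta>. norm (stft \<phi> g x \<eta>) \<le> C * decay s x * decay s \<eta>"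
proof -
  define M where "M = nat \<lceil>s\<rceil>"
  have M: "s \<le> real M" unfolding M_def by linarith
  obtain C0 where C0: "C0 > 0" "\<And>x \<eta>. norm (stft \<phi> g x \<eta>) \<le> C0 * decay s x"
    using stft_bound_position[OF g \<phi> s] by blast
  have "\<forall>b\<in>(Basis::'a set). \<exists>C. \<forall>x \<eta>. \<bar>\<eta> \<bullet> b\<bar> ^ M * norm (stft \<phi> g x \<eta>) \<le> C * decay s x"
    using stft_bound_power[OF g \<phi> _ s] by blast
  then obtain K where K: "\<And>b x \<eta>. b \<in> Basis \<Longrightarrow> \<bar>\<eta> \<bullet> b\<bar> ^ M * norm (stft \<phi> g x \<eta>) \<le> K b * decay s x"
    by (metis (lifting))
  define C where "C = (1 + real DIM('a)) ^ M * (C0 + (\<Sum>b\<in>Basis. K b))"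
  have le: "(1 + norm \<eta>) ^ M * norm (stft \<phi> g x \<eta>) \<le> C * decay s x" for x \<eta>
  proof -
    have "(1 + norm \<eta>) ^ M * norm (stft \<phi> g x \<eta>) \<le> (1 + real DIM('a)) ^ M * (C0 * decay s x + (\<Sum>b\<in>Basis. K b * decay s x))"
      by (rule power_norm_bound) (use C0 K in auto)
    then show ?thesis by (simp add: C_def sum_distrib_right[symmetric] distrib_right[symmetric] mult.assoc)
  qed
  have "norm (stft \<phi> g x \<eta>) \<le> (\<bar>C\<bar> + 1) * decay s x * decay s \<eta>" for x \<eta>
  proof -
    have "norm (stft \<phi> g x \<eta>) \<le> C * decay s x * decay (real M) \<eta>"
      using le[of \<eta> x] one_plus_norm_pos[of \<eta>] by (simp add: decay_nat field_simps)
    also have "\<dots> \<le> (\<bar>C\<bar> + 1) * decay s x * decay s \<eta>"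
      by (intro mult_mono decay_antimono M) auto
    finally show ?thesis .
  qed
  then show ?thesis by (intro exI[of _ "\<bar>C\<bar> + 1"]) auto
qed

text \<open>At position 0 the transform is the Fourier transform of g times the conjugate window. If
  it vanished identically, so would that product, and then the window, as g has no zeros.\<close>

lemma stft_nonzero:
  fixes g \<phi> :: "'a::euclidean_space \<Rightarrow> complex"
  assumes g: "g \<in> schwartz_space" and \<phi>: "\<phi> \<in> schwartz_space" and nz: "\<And>z. g z \<noteq> 0" "\<phi> \<noteq> (\<lambda>_. 0)"
  shows "\<exists>\<eta>. stft \<phi> g 0 \<eta> \<noteq> 0"
proof (rule ccontr)
  assume "\<not> ?thesis"
  then have zero: "stft \<phi> g 0 \<eta> = 0" for \<eta> by blast
  obtain A where A: "A > 0" "\<And>z. norm (g z) \<le> A" using schwartz_bounded[OF g] by metis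
  obtain B where B: "B > 0" "\<And>z. norm (\<phi> z) \<le> B" using schwartz_bounded[OF \<phi>] by metis
  have "g z * cnj (\<phi> z) = 0" for z
  proof (rule fourier_injective[where h = "\<lambda>z. g z * cnj (\<phi> z)"])
    show "continuous_on UNIV (\<lambda>z. g z * cnj (\<phi> z))"
      by (intro continuous_on_mult continuous_on_cnj schwartz_continuous_on g \<phi>)
    show "norm (g z * cnj (\<phi> z)) \<le> A * B" for z
      unfolding norm_mult complex_mod_cnj by (intro mult_mono A B less_imp_le[OF A(1)] norm_ge_zero)
    show "integrable lborel (\<lambda>z. g z * cnj (\<phi> z))"
      using stft_integrable[OF g \<phi>, of 0 0] by simp
    show "(\<integral>z. g z * cnj (\<phi> z) * cis (\<eta> \<bullet> z) \<partial>lborel) = 0" for \<eta>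
      using zero[of \<eta>] by (simp add: stft_def)
  qed
  then show False using nz by auto
qed

section \<open>The symplectic short-time Fourier transform of the test symbols\<close>

abbreviation sgauss :: "'a::euclidean_space \<Rightarrow> complex" where
  "sgauss \<equiv> gaussian_wave 1 0 0"

lemma sgauss_schwartz: "sgauss \<in> schwartz_space"
  by (rule gaussian_wave_schwartz) simp

text \<open>The standard symplectic matrix; it turns the symplectic form into the inner product and
  is an isometry.\<close>

definition rot :: "'a::euclidean_space \<times> 'a \<Rightarrow> 'a \<times> 'a" where
  "rot Y = (snd Y, - fst Y)"

lemma symp_eq_inner: "symp Y Z = rot Y \<bullet> Z"
  by (simp add: symp_def rot_def inner_prod_def inner_commute)

lemma norm_rot [simp]: "norm (rot Y) = norm Y"
  by (simp add: rot_def norm_prod_def add.commute)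

lemma symp_stft_eq_stft:
  fixes a :: "'a::euclidean_space \<times> 'a \<Rightarrow> complex"
  shows "symp_stft \<Phi> a X Y = complex_of_real (1 / pi ^ DIM('a)) * stft \<Phi> a X (2 *\<^sub>R rot Y)"
  by (simp add: symp_stft_def symp_fourier_def stft_def symp_eq_inner cis_conv_exp mult_ac)

lemma symp_stft_sum:
  fixes a :: "'i \<Rightarrow> 'a::euclidean_space \<times> 'a \<Rightarrow> complex"
  assumes "\<Phi> \<in> schwartz_space" "\<And>i. i \<in> I \<Longrightarrow> a i \<in> schwartz_space"
  shows "symp_stft \<Phi> (\<lambda>Z. \<Sum>i\<in>I. c i * a i Z) X Y = (\<Sum>i\<in>I. c i * symp_stft \<Phi> (a i) X Y)"
proof -
  have "stft \<Phi> (\<lambda>Z. \<Sum>i\<in>I. c i * a i Z) X \<eta> = (\<Sum>i\<in>I. c i * stft \<Phi> (a i) X \<eta>)" for \<eta>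
  proof -
    have "stft \<Phi> (\<lambda>Z. \<Sum>i\<in>I. c i * a i Z) X \<eta> = (\<integral>z. (\<Sum>i\<in>I. c i * (a i z * cnj (\<Phi> (z - X)) * cis (\<eta> \<bullet> z))) \<partial>lborel)"
      unfolding stft_def by (simp only: sum_distrib_right mult.assoc)
    also have "\<dots> = (\<Sum>i\<in>I. (\<integral>z. c i * (a i z * cnj (\<Phi> (z - X)) * cis (\<eta> \<bullet> z)) \<partial>lborel))"
      by (intro Bochner_Integration.integral_sum integrable_mult_right stft_integrable assms)
    finally show ?thesis unfolding stft_def integral_mult_right_zero .
  qed
  then show ?thesis by (simp add: symp_stft_eq_stft sum_distrib_left mult_ac)
qed

text \<open>An atom is a translated and modulated \<open>sgauss\<close>, so up to a unimodular
  factor its transform is a translate of one fixed function. All estimates for atoms thereby become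
  uniform in x and y.\<close>

lemma symp_stft_atom:
  fixes x y :: "'a::euclidean_space"
  assumes \<Phi>: "\<Phi> \<in> schwartz_space"
  shows "norm (symp_stft \<Phi> (atom x y) X Y) = norm (symp_stft \<Phi> sgauss (X - ((1/2) *\<^sub>R (x + y), 0)) (Y - ((1/2) *\<^sub>R (y - x), 0)))"
proof -
  let ?m = "((1/2) *\<^sub>R (x + y), 0) :: 'a \<times> 'a" and ?w = "((1/2) *\<^sub>R (y - x), 0) :: 'a \<times> 'a"
  let ?F = "\<lambda>Z. atom x y Z * cnj (\<Phi> (Z - X)) * cis ((2 *\<^sub>R rot Y) \<bullet> Z)"
  have F: "?F (?m + Z) = cis ((2 *\<^sub>R rot Y) \<bullet> ?m) * (sgauss Z * cnj (\<Phi> (Z - (X - ?m))) * cis ((2 *\<^sub>R rot (Y - ?w)) \<bullet> Z))" for Z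
  proof -
    \<comment> \<open>Twice \<open>rot\<close> maps ((y - x)/2, 0) to (0, x - y), so the modulation
      by y - x shifts Y by half of it.\<close>
    have "(0, y - x) \<bullet> (?m + Z) + (2 *\<^sub>R rot Y) \<bullet> (?m + Z) = (2 *\<^sub>R rot Y) \<bullet> ?m + (2 *\<^sub>R rot (Y - ?w)) \<bullet> Z"
      by (cases Y; cases Z) (simp add: rot_def inner_prod_def inner_simps algebra_simps)
    then have c: "cis ((0, y - x) \<bullet> (?m + Z)) * cis ((2 *\<^sub>R rot Y) \<bullet> (?m + Z)) = cis ((2 *\<^sub>R rot Y) \<bullet> ?m) * cis ((2 *\<^sub>R rot (Y - ?w)) \<bullet> Z)"
      by (simp only: cis_mult)
    have s: "?m + Z - X = Z - (X - ?m)" "?m + Z - ?m = Z" by simp_all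
    have "?F (?m + Z) = exp (- 1 * (norm Z)\<^sup>2) * cnj (\<Phi> (Z - (X - ?m))) * (cis ((0, y - x) \<bullet> (?m + Z)) * cis ((2 *\<^sub>R rot Y) \<bullet> (?m + Z)))"
      unfolding atom_def gaussian_wave_def s by (simp only: mult_ac)
    also have "\<dots> = cis ((2 *\<^sub>R rot Y) \<bullet> ?m) * (exp (- 1 * (norm Z)\<^sup>2) * cnj (\<Phi> (Z - (X - ?m))) * cis ((2 *\<^sub>R rot (Y - ?w)) \<bullet> Z))"
      unfolding c by (simp only: mult_ac)
    finally show ?thesis by (simp add: gaussian_wave_def)
  qed
  have "stft \<Phi> (atom x y) X (2 *\<^sub>R rot Y) = (\<integral>Z. ?F (?m + Z) \<partial>lborel)"
    unfolding stft_def by (rule integral_lborel_translate[symmetric]) (rule stft_integrand_measurable[OF atom_schwartz \<Phi>])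
  then have "stft \<Phi> (atom x y) X (2 *\<^sub>R rot Y) = cis ((2 *\<^sub>R rot Y) \<bullet> ?m) * stft \<Phi> sgauss (X - ?m) (2 *\<^sub>R rot (Y - ?w))"
    unfolding F stft_def integral_mult_right_zero .
  then show ?thesis by (simp add: symp_stft_eq_stft norm_mult norm_divide)
qed

lemma symp_stft_decay:
  fixes \<Phi> g :: "'a::euclidean_space \<times> 'a \<Rightarrow> complex"
  assumes g: "g \<in> schwartz_space" and \<Phi>: "\<Phi> \<in> schwartz_space" and s: "s \<ge> 0"
  shows "\<exists>C>0. \<forall>X Y. norm (symp_stft \<Phi> g X Y) \<le> C * decay s X * decay s Y"
proof -
  obtain C where C: "C > 0" "\<And>x \<eta>. norm (stft \<Phi> g x \<eta>) \<le> C * decay s x * decay s \<eta>"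
    using stft_decay[OF assms] by blast
  have "norm (symp_stft \<Phi> g X Y) \<le> (1 / pi ^ DIM('a) * C) * decay s X * decay s Y" for X Y
  proof -
    have "norm (stft \<Phi> g X (2 *\<^sub>R rot Y)) \<le> C * decay s X * decay s (2 *\<^sub>R rot Y)" by (rule C)
    also have "\<dots> \<le> C * decay s X * decay s Y"
      using C(1) s by (intro mult_left_mono decay_mono_norm) auto
    finally have "1 / pi ^ DIM('a) * norm (stft \<Phi> g X (2 *\<^sub>R rot Y)) \<le> 1 / pi ^ DIM('a) * (C * decay s X * decay s Y)"
      by (intro mult_left_mono) auto
    then show ?thesis by (simp add: symp_stft_eq_stft norm_mult norm_divide norm_power mult.assoc)
  qed
  then show ?thesis using C(1) by (intro exI[of _ "1 / pi ^ DIM('a) * C"]) auto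
qed

lemma continuous_on_symp_stft:
  fixes \<Phi> g :: "'a::euclidean_space \<times> 'a \<Rightarrow> complex"
  assumes g: "g \<in> schwartz_space" and \<Phi>: "\<Phi> \<in> schwartz_space"
  shows "continuous_on UNIV (\<lambda>p. symp_stft \<Phi> g (fst p) (snd p))"
proof -
  have "continuous_on UNIV (\<lambda>p::('a \<times> 'a) \<times> ('a \<times> 'a). (fst p, 2 *\<^sub>R rot (snd p)))"
    unfolding rot_def by (intro continuous_intros)
  from continuous_on_compose2[OF continuous_on_stft[OF g \<Phi>] this]
  show ?thesis unfolding symp_stft_eq_stft by (intro continuous_intros) simp
qed

text \<open>Nonvanishing at one point spreads to a neighbourhood by continuity. Where that point
  lies depends on the window, so the centres of the balls in the lower estimates are shifted by (X0,
  Y0).\<close>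

lemma symp_stft_lower_bound:
  fixes \<Phi> g :: "'a::euclidean_space \<times> 'a \<Rightarrow> complex"
  assumes g: "g \<in> schwartz_space" and \<Phi>: "\<Phi> \<in> schwartz_space" and nz: "\<And>z. g z \<noteq> 0" "\<Phi> \<noteq> (\<lambda>_. 0)"
  shows "\<exists>X0 Y0 \<delta> c. \<delta> > 0 \<and> c > 0 \<and> (\<forall>X\<in>ball X0 \<delta>. \<forall>Y\<in>ball Y0 \<delta>. norm (symp_stft \<Phi> g X Y) \<ge> c)"
proof -
  obtain \<eta> where \<eta>: "stft \<Phi> g 0 \<eta> \<noteq> 0" using stft_nonzero[OF assms] by blast
  define Y0 where "Y0 = (- ((1/2) *\<^sub>R snd \<eta>), (1/2) *\<^sub>R fst \<eta>)"
  have "2 *\<^sub>R rot Y0 = \<eta>" by (simp add: Y0_def rot_def)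
  then have n: "symp_stft \<Phi> g 0 Y0 \<noteq> 0" using \<eta> by (simp add: symp_stft_eq_stft)
  define c where "c = norm (symp_stft \<Phi> g 0 Y0) / 2"
  have c: "c > 0" using n by (simp add: c_def)
  let ?h = "\<lambda>p. symp_stft \<Phi> g (fst p) (snd p)"
  have "isCont ?h (0, Y0)"
    using continuous_on_symp_stft[OF g \<Phi>] continuous_on_eq_continuous_at[OF open_UNIV] by blast
  then obtain d where d: "d > 0" "\<And>p. dist p (0, Y0) < d \<Longrightarrow> dist (?h p) (?h (0, Y0)) < c"
    using c unfolding continuous_at_eps_delta by (metis dist_commute)
  have "norm (symp_stft \<Phi> g X Y) \<ge> c" if X: "X \<in> ball 0 (d/2)" and Y: "Y \<in> ball Y0 (d/2)" for X Y
  proof -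
    have "dist (X, Y) (0, Y0) \<le> dist X 0 + dist Y Y0"
      unfolding dist_Pair_Pair by (rule sqrt_sum_squares_le_sum) auto
    also have "\<dots> < d" using X Y by (simp add: dist_commute)
    finally have "dist (?h (X, Y)) (?h (0, Y0)) < c" by (rule d)
    then have "norm (symp_stft \<Phi> g X Y - symp_stft \<Phi> g 0 Y0) < c" by (simp add: dist_norm)
    moreover have "norm (symp_stft \<Phi> g 0 Y0) \<le> norm (symp_stft \<Phi> g X Y) + norm (symp_stft \<Phi> g X Y - symp_stft \<Phi> g 0 Y0)"
      by (metis norm_minus_commute norm_triangle_sub)
    ultimately show ?thesis by (simp add: c_def)
  qed
  then show ?thesis using d(1) c by (intro exI[of _ 0] exI[of _ Y0] exI[of _ "d/2"] exI[of _ c]) auto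
qed


section \<open>Mixed norms\<close>

text \<open>A real-valued 1/p, so that it can serve as an exponent of \<open>powr\<close>; the value
  0 at infinity lets the finite and infinite cases share one formula.\<close>

definition recip :: "ennreal \<Rightarrow> real" where
  "recip p = (if p = \<infinity> then 0 else 1 / enn2real p)"

lemma recip_nonneg [simp]: "recip p \<ge> 0"
  by (simp add: recip_def)

lemma recip_top [simp]: "recip \<top> = 0" by (simp add: recip_def)

lemma recip_pos:
  assumes "0 < p" "p \<noteq> \<infinity>"
  shows "enn2real p > 0" "recip p = 1 / enn2real p" "p = ennreal (enn2real p)"
  using assms by (auto simp: recip_def enn2real_positive_iff less_top)

lemma ennpowr_ennreal: "x \<ge> 0 \<Longrightarrow> ennpowr (ennreal x) r = ennreal (x powr r)"
  by (simp add: ennpowr_def)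

lemma ennpowr_mono:
  assumes "x \<le> y" "r \<ge> 0"
  shows "ennpowr x r \<le> ennpowr y r"
proof (cases "y = \<infinity>")
  case False
  then have "y < \<top>" by (simp add: less_top)
  then have "x < \<top>" using assms by (simp add: le_less_trans)
  then show ?thesis using assms False \<open>y < \<top>\<close>
    by (auto simp: ennpowr_def intro!: ennreal_leI powr_mono2 enn2real_mono)
qed (simp add: ennpowr_def)

lemma borel_measurable_ennpowr [measurable]: "(\<lambda>x. ennpowr x r) \<in> borel_measurable borel"
  unfolding ennpowr_def by measurable

lemma Lp_qnorm_top: "Lp_qnorm \<top> F = esssup lebesgue F"
  by (simp add: Lp_qnorm_def)

lemma Lp_qnorm_finite:
  "p \<noteq> \<infinity> \<Longrightarrow> Lp_qnorm p F = ennpowr (\<integral>\<^sup>+ x. ennpowr (F x) (enn2real p) \<partial>lborel) (recip p)"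
  by (simp add: Lp_qnorm_def recip_def nn_integral_completion)

text \<open>The summand 1 keeps the constant positive; its power with exponent 0, which occurs for p
  = \<infinity>, is then 1, whereas 0 \<open>powr\<close> 0 would be 0.\<close>

definition decay_mass :: "'b::euclidean_space itself \<Rightarrow> real" where
  "decay_mass _ = 1 + enn2real (\<integral>\<^sup>+x. ennreal (decay (real (2 * DIM('b))) (x::'b)) \<partial>lborel)"

lemma decay_mass_ge_1: "decay_mass TYPE('b::euclidean_space) \<ge> 1"
  by (simp add: decay_mass_def)

lemma nn_integral_decay_le:
  fixes c :: "'b::euclidean_space" and s :: real
  assumes "s \<ge> 2 * DIM('b)"
  shows "(\<integral>\<^sup>+x. ennreal (decay s (x - c)) \<partial>lborel) \<le> ennreal (decay_mass TYPE('b))"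
proof -
  have "(\<integral>\<^sup>+x. ennreal (decay s (x - c)) \<partial>lborel) \<le> (\<integral>\<^sup>+x. ennreal (decay (real (2 * DIM('b))) (- c + x)) \<partial>lborel)"
    using assms by (intro nn_integral_mono ennreal_leI) (simp add: decay_antimono)
  also have "\<dots> = (\<integral>\<^sup>+x. ennreal (decay (real (2 * DIM('b))) (x::'b)) \<partial>lborel)"
    by (rule nn_integral_lborel_translate) measurable
  also have "\<dots> = ennreal (enn2real (\<integral>\<^sup>+x. ennreal (decay (real (2 * DIM('b))) (x::'b)) \<partial>lborel))"
    using nn_integral_decay_finite[where 'a='b, of "real (2 * DIM('b))"] by (simp add: ennreal_enn2real less_top)
  also have "\<dots> \<le> ennreal (decay_mass TYPE('b))"
    unfolding decay_mass_def by (intro ennreal_leI) simp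
  finally show ?thesis .
qed

text \<open>At each point F lies below one bump, so its p-th power lies below the sum of the p-th
  powers of all bumps. No convexity enters, which admits p < 1.\<close>

lemma Lp_qnorm_upper_finite:
  fixes c :: "'i \<Rightarrow> 'b::euclidean_space" and s :: real
  assumes p: "0 < p" "p \<noteq> \<infinity>" and I: "finite I" and s: "s * enn2real p \<ge> 2 * DIM('b)"
    and t: "\<And>i. i \<in> I \<Longrightarrow> t i \<ge> 0"
    and F: "\<And>x. \<exists>i\<in>I. F x \<le> ennreal (t i * decay s (x - c i))"
  shows "Lp_qnorm p F \<le> ennreal (((\<Sum>i\<in>I. t i powr enn2real p) * decay_mass TYPE('b)) powr recip p)"
proof -
  let ?p = "enn2real p"
  note pp = recip_pos[OF p]
  have "(\<integral>\<^sup>+ x. ennpowr (F x) ?p \<partial>lborel) \<le> (\<integral>\<^sup>+ x. (\<Sum>i\<in>I. ennreal (t i powr ?p) * ennreal (decay (s * ?p) (x - c i))) \<partial>lborel)"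
  proof (rule nn_integral_mono)
    fix x
    obtain i where i: "i \<in> I" "F x \<le> ennreal (t i * decay s (x - c i))" using F by blast
    have "ennpowr (F x) ?p \<le> ennpowr (ennreal (t i * decay s (x - c i))) ?p"
      using i pp by (intro ennpowr_mono) auto
    also have "\<dots> = ennreal (t i powr ?p) * ennreal (decay (s * ?p) (x - c i))"
      using t[OF i(1)] by (subst ennpowr_ennreal) (simp_all add: powr_mult decay_powr ennreal_mult)
    also have "\<dots> \<le> (\<Sum>i\<in>I. ennreal (t i powr ?p) * ennreal (decay (s * ?p) (x - c i)))"
      using I i by (intro member_le_sum) auto
    finally show "ennpowr (F x) ?p \<le> (\<Sum>i\<in>I. ennreal (t i powr ?p) * ennreal (decay (s * ?p) (x - c i)))" .
  qed
  also have "\<dots> = (\<Sum>i\<in>I. ennreal (t i powr ?p) * (\<integral>\<^sup>+ x. ennreal (decay (s * ?p) (x - c i)) \<partial>lborel))"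
    by (simp add: nn_integral_sum nn_integral_cmult)
  also have "\<dots> \<le> (\<Sum>i\<in>I. ennreal (t i powr ?p) * ennreal (decay_mass TYPE('b)))"
    using s by (intro sum_mono mult_left_mono nn_integral_decay_le) auto
  also have "\<dots> = ennreal ((\<Sum>i\<in>I. t i powr ?p) * decay_mass TYPE('b))"
    using decay_mass_ge_1[where 'b='b]
    by (subst ennreal_mult) (auto simp: sum_nonneg sum_distrib_right[symmetric])
  finally have "Lp_qnorm p F \<le> ennpowr (ennreal ((\<Sum>i\<in>I. t i powr ?p) * decay_mass TYPE('b))) (recip p)"
    unfolding Lp_qnorm_finite[OF p(2)] by (intro ennpowr_mono) auto
  also have "\<dots> = ennreal (((\<Sum>i\<in>I. t i powr ?p) * decay_mass TYPE('b)) powr recip p)"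
    using decay_mass_ge_1[where 'b='b] by (intro ennpowr_ennreal mult_nonneg_nonneg sum_nonneg) auto
  finally show ?thesis .
qed

text \<open>Equal heights t give the factor \<open>card I\<close> to the power 1/p. For p =
  \<infinity> measurability is assumed because \<open>esssup\<close> takes the value top on
  non-measurable functions.\<close>

lemma Lp_qnorm_upper:
  fixes c :: "'i \<Rightarrow> 'b::euclidean_space" and s :: real
  assumes p: "0 < p" and I: "finite I" and s: "s \<ge> 2 * DIM('b) * recip p"
    and t: "t \<ge> 0" and meas: "p = \<infinity> \<Longrightarrow> F \<in> borel_measurable lebesgue"
    and F: "\<And>x. \<exists>i\<in>I. F x \<le> ennreal (t * decay s (x - c i))"
  shows "Lp_qnorm p F \<le> ennreal (t * (card I * decay_mass TYPE('b)) powr recip p)"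
proof -
  have s0: "s \<ge> 0" using s by (rule order_trans[rotated]) simp
  have "I \<noteq> {}" using F by blast
  then have card: "card I > 0" using I by (simp add: card_gt_0_iff)
  show ?thesis
  proof (cases "p = \<infinity>")
    case True
    have "F x \<le> ennreal t" for x
    proof -
      obtain i where "F x \<le> ennreal (t * decay s (x - c i))" using F by blast
      also have "\<dots> \<le> ennreal t"
        using t by (intro ennreal_leI mult_left_le decay_le_1 s0)
      finally show ?thesis .
    qed
    then have "esssup lebesgue F \<le> ennreal t"
      using meas True by (intro esssup_I) auto
    then show ?thesis using True card decay_mass_ge_1[where 'b='b] by (simp add: Lp_qnorm_top)
  next
    case False
    note pp = recip_pos[OF p False]
    have "s * enn2real p \<ge> 2 * DIM('b)" using s pp(1) unfolding pp(2) by (simp add: field_simps)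
    from Lp_qnorm_upper_finite[OF p False I this _ F] t
    have "Lp_qnorm p F \<le> ennreal ((card I * t powr enn2real p * decay_mass TYPE('b)) powr recip p)" by simp
    also have "card I * t powr enn2real p * decay_mass TYPE('b) = t powr enn2real p * (card I * decay_mass TYPE('b))" by simp
    also have "\<dots> powr recip p = t * (card I * decay_mass TYPE('b)) powr recip p"
      using pp t decay_mass_ge_1[where 'b='b] by (subst powr_mult) (auto simp: powr_powr)
    finally show ?thesis .
  qed
qed

lemma emeasure_lborel_ball_ennreal: "emeasure lborel (ball (c::'b::euclidean_space) \<delta>) = ennreal (measure lborel (ball (0::'b) \<delta>))"
proof -
  have "emeasure lborel (ball c \<delta>) = emeasure lborel (ball (0::'b) \<delta>)"
  proof -
    have "(\<integral>\<^sup>+x. indicator (ball (0::'b) \<delta>) (- c + x) \<partial>lborel) = (\<integral>\<^sup>+x. indicator (ball (0::'b) \<delta>) x \<partial>lborel)"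
      by (rule nn_integral_lborel_translate, rule borel_measurable_indicator) simp
    moreover have "indicator (ball (0::'b) \<delta>) (- c + x) = (indicator (ball c \<delta>) x :: ennreal)" for x
      by (auto simp: indicator_def dist_norm norm_minus_commute)
    ultimately show ?thesis by simp
  qed
  then show ?thesis
    using emeasure_lborel_ball_finite[of "0::'b" \<delta>] by (simp add: emeasure_eq_ennreal_measure less_top)
qed

lemma measure_ball_pos: "\<delta> > 0 \<Longrightarrow> measure lborel (ball (c::'b::euclidean_space) \<delta>) > 0"
proof -
  assume "\<delta> > 0"
  then have "ball c \<delta> \<notin> null_sets lborel"
    by (metis open_not_negligible open_ball centre_in_ball empty_iff negligible_iff_null_sets null_sets_completionI)
  then have "emeasure lborel (ball c \<delta>) \<noteq> 0" by (auto simp: null_sets_def)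
  then show ?thesis
    using emeasure_lborel_ball_finite[of c \<delta>]
    by (simp add: measure_def enn2real_positive_iff zero_less_iff_neq_zero)
qed

text \<open>Separation by 2 \<open>\<delta>\<close> makes the balls disjoint, so their measures add
  up.\<close>

lemma Lp_qnorm_lower:
  fixes c :: "'i \<Rightarrow> 'b::euclidean_space"
  assumes p: "0 < p" and I: "finite I" "I \<noteq> {}" and \<delta>: "\<delta> > 0"
    and sep: "\<And>i j. i \<in> I \<Longrightarrow> j \<in> I \<Longrightarrow> i \<noteq> j \<Longrightarrow> 2 * \<delta> \<le> norm (c i - c j)"
    and a: "a \<ge> 0" and F: "\<And>i x. i \<in> I \<Longrightarrow> x \<in> ball (c i) \<delta> \<Longrightarrow> ennreal a \<le> F x"
  shows "ennreal (a * (card I * measure lborel (ball (0::'b) \<delta>)) powr recip p) \<le> Lp_qnorm p F"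
proof -
  let ?V = "measure lborel (ball (0::'b) \<delta>)"
  have V: "?V > 0" using measure_ball_pos[OF \<delta>] .
  have card: "card I > 0" using I by (simp add: card_gt_0_iff)
  show ?thesis
  proof (cases "p = \<infinity>")
    case True
    have "ennreal a \<le> esssup lebesgue F"
    proof (rule ccontr)
      assume "\<not> ?thesis"
      moreover obtain i where i: "i \<in> I" using I by blast
      moreover have "AE x in lebesgue. F x \<le> esssup lebesgue F" by (rule esssup_AE)
      ultimately have "AE x in lebesgue. x \<notin> ball (c i) \<delta>"
        using F[OF i] by (auto elim!: eventually_mono) (meson dual_order.trans mem_ball)
      then have "ball (c i) \<delta> \<in> null_sets lebesgue"
        by (subst (asm) AE_iff_null_sets[symmetric]) auto
      then have "emeasure lborel (ball (c i) \<delta>) = 0"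
        by (simp add: null_sets_def)
      then show False using V by (simp add: emeasure_lborel_ball_ennreal)
    qed
    then show ?thesis using True V card by (simp add: Lp_qnorm_top)
  next
    case False
    let ?p = "enn2real p"
    note pp = recip_pos[OF p False]
    have disj: "disjoint_family_on (\<lambda>i. ball (c i) \<delta>) I"
      unfolding disjoint_family_on_def
    proof (intro ballI impI)
      fix i j assume ij: "i \<in> I" "j \<in> I" "i \<noteq> j"
      show "ball (c i) \<delta> \<inter> ball (c j) \<delta> = {}"
      proof (rule ccontr)
        assume "\<not> ?thesis"
        then obtain x where x: "dist (c i) x < \<delta>" "dist (c j) x < \<delta>" by auto
        then have "dist (c i) (c j) < 2 * \<delta>" using dist_triangle2[of "c i" "c j" x] by linarith
        then show False using sep[OF ij] by (simp add: dist_norm)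
      qed
    qed
    have "ennreal (a powr ?p * (card I * ?V)) = ennreal (a powr ?p) * (\<Sum>i\<in>I. emeasure lborel (ball (c i) \<delta>))"
      by (simp add: emeasure_lborel_ball_ennreal ennreal_mult ennreal_of_nat_eq_real_of_nat)
    also have "\<dots> = ennreal (a powr ?p) * emeasure lborel (\<Union>i\<in>I. ball (c i) \<delta>)"
      using I disj by (subst sum_emeasure) auto
    also have "\<dots> = (\<integral>\<^sup>+ x. ennreal (a powr ?p) * indicator (\<Union>i\<in>I. ball (c i) \<delta>) x \<partial>lborel)"
      using I by (intro nn_integral_cmult_indicator[symmetric]) auto
    also have "\<dots> \<le> (\<integral>\<^sup>+ x. ennpowr (F x) ?p \<partial>lborel)"
    proof (rule nn_integral_mono)
      fix x
      show "ennreal (a powr ?p) * indicator (\<Union>i\<in>I. ball (c i) \<delta>) x \<le> ennpowr (F x) ?p"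
      proof (cases "x \<in> (\<Union>i\<in>I. ball (c i) \<delta>)")
        case True
        then obtain i where "i \<in> I" "x \<in> ball (c i) \<delta>" by blast
        then have "ennpowr (ennreal a) ?p \<le> ennpowr (F x) ?p"
          using F pp by (intro ennpowr_mono) auto
        then show ?thesis using True a by (simp add: ennpowr_ennreal)
      qed simp
    qed
    finally have "ennpowr (ennreal (a powr ?p * (card I * ?V))) (recip p) \<le> Lp_qnorm p F"
      unfolding Lp_qnorm_finite[OF False] by (intro ennpowr_mono) auto
    moreover have "ennpowr (ennreal (a powr ?p * (card I * ?V))) (recip p) = ennreal (a * (card I * ?V) powr recip p)"
      using pp a V by (subst ennpowr_ennreal) (auto simp: powr_mult powr_powr)
    ultimately show ?thesis by simp
  qed
qed

text \<open>One order of decay is split off as \<open>h\<close>. Two centres at distance 2N in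
  position or in frequency cannot both lie within N of the given point, so at most one index has
  \<open>h\<close> above 1/N. Hence the \<open>h\<close> sum to at most 1 + 1, and the remaining
  factors are bounded by the largest of them.\<close>

lemma sum_decay_le:
  fixes m w :: "'i \<Rightarrow> 'b::euclidean_space"
  assumes I: "finite I" "I \<noteq> {}" and s: "s \<ge> 0"
    and sep: "\<And>i j. i \<in> I \<Longrightarrow> j \<in> I \<Longrightarrow> i \<noteq> j \<Longrightarrow> 2 * real (card I) \<le> norm (m i - m j) \<or> 2 * real (card I) \<le> norm (w i - w j)"
  shows "\<exists>i\<in>I. (\<Sum>i\<in>I. decay (s + 1) (X - m i) * decay (s + 1) (Y - w i)) \<le> 2 * (decay s (X - m i) * decay s (Y - w i))"
proof -
  let ?N = "real (card I)"
  define g where "g i = decay s (X - m i) * decay s (Y - w i)" for i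
  define h where "h i = decay 1 (X - m i) * decay 1 (Y - w i)" for i
  have card: "?N > 0" using I by (simp add: card_gt_0_iff)
  have d1: "decay 1 (A - m) \<le> 1 / ?N \<or> decay 1 (A - m') \<le> 1 / ?N" if "2 * ?N \<le> norm (m - m')" for A m m' :: 'b
  proof -
    have "norm (m - m') \<le> norm (A - m) + norm (A - m')"
      using norm_triangle_ineq[of "m - A" "A - m'"] by (simp add: norm_minus_commute)
    then have "?N \<le> norm (A - m) \<or> ?N \<le> norm (A - m')" using that by linarith
    moreover have "decay 1 B \<le> 1 / ?N" if "?N \<le> norm B" for B :: 'b
    proof -
      have "decay 1 B = 1 / (1 + norm B)" using decay_nat[of 1 B] by simp
      also have "\<dots> \<le> 1 / ?N" using that card by (intro divide_left_mono) (auto intro!: mult_pos_pos add_pos_nonneg)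
      finally show ?thesis .
    qed
    ultimately show ?thesis by blast
  qed
  have h1: "h i \<le> 1" for i unfolding h_def by (intro mult_le_one decay_le_1) auto
  have hle: "h i \<le> decay 1 (X - m i)" "h i \<le> decay 1 (Y - w i)" for i
    unfolding h_def by (auto intro!: mult_left_le mult_left_le_one_le decay_le_1)
  have hh: "h i \<le> 1 / ?N \<or> h j \<le> 1 / ?N" if ij: "i \<in> I" "j \<in> I" "i \<noteq> j" for i j
    using sep[OF ij] d1[of "m i" "m j" X] d1[of "w i" "w j" Y] hle[of i] hle[of j] by linarith
  have hsum: "(\<Sum>i\<in>I. h i) \<le> 2"
  proof (cases "\<exists>k\<in>I. h k > 1 / ?N")
    case True
    then obtain k where k: "k \<in> I" "h k > 1 / ?N" by blast
    have "(\<Sum>i\<in>I. h i) = h k + (\<Sum>i\<in>I - {k}. h i)" using I k by (simp add: sum.remove)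
    also have "(\<Sum>i\<in>I - {k}. h i) \<le> (\<Sum>i\<in>I - {k}. 1 / ?N)"
    proof (rule sum_mono)
      fix i assume "i \<in> I - {k}"
      then show "h i \<le> 1 / ?N" using hh[of i k] k by auto
    qed
    also have "\<dots> \<le> (\<Sum>i\<in>I. 1 / ?N)" using I by (intro sum_mono2) auto
    finally show ?thesis using h1[of k] card by simp
  next
    case False
    then have "(\<Sum>i\<in>I. h i) \<le> (\<Sum>i\<in>I. 1 / ?N)" by (intro sum_mono) (auto simp: not_less)
    then show ?thesis using card by simp
  qed
  obtain k where k: "k \<in> I" "\<And>i. i \<in> I \<Longrightarrow> g i \<le> g k"
  proof -
    have "Max (g ` I) \<in> g ` I" using I by (intro Max_in) auto
    then obtain k where "k \<in> I" "Max (g ` I) = g k" by blast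
    then show ?thesis using I by (intro that[of k]) (auto simp flip: \<open>Max (g ` I) = g k\<close>)
  qed
  have "(\<Sum>i\<in>I. decay (s + 1) (X - m i) * decay (s + 1) (Y - w i)) = (\<Sum>i\<in>I. g i * h i)"
    by (simp add: g_def h_def decay_add mult_ac)
  also have "\<dots> \<le> (\<Sum>i\<in>I. g k * h i)"
    using k by (intro sum_mono mult_right_mono) (auto simp: h_def)
  also have "\<dots> = g k * (\<Sum>i\<in>I. h i)" by (simp add: sum_distrib_left)
  also have "\<dots> \<le> g k * 2" using hsum by (intro mult_left_mono) (auto simp: g_def)
  finally show ?thesis using k(1) by (intro bexI[of _ k]) (simp_all add: g_def mult_ac)
qed

definition mixed_qnorm :: "ennreal \<Rightarrow> ennreal \<Rightarrow> ('b::euclidean_space \<Rightarrow> 'b \<Rightarrow> real) \<Rightarrow> ennreal" where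
  "mixed_qnorm p q H = Lp_qnorm q (\<lambda>Y. Lp_qnorm p (\<lambda>X. ennreal (H X Y)))"

text \<open>Both the inner function and the inner norm as a function of Y may be fed to
  \<open>esssup\<close>, which requires measurability to give a finite value.\<close>

definition mixed_measurable :: "ennreal \<Rightarrow> ('b::euclidean_space \<Rightarrow> 'b \<Rightarrow> real) \<Rightarrow> bool" where
  "mixed_measurable p H \<longleftrightarrow> (\<forall>Y. (\<lambda>X. ennreal (H X Y)) \<in> borel_measurable lebesgue) \<and>
     (\<lambda>Y. Lp_qnorm p (\<lambda>X. ennreal (H X Y))) \<in> borel_measurable lebesgue"

text \<open>Bumps over one frequency fill the inner norm and give \<open>card I\<close> to the power
  1/p; bumps at separated frequencies are seen one at a time by the inner norm and give the power
  1/q. In the order s, the multiples of the dimension pay for integrability and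
  \<open>recip p\<close> for the collapse of the inner sum in the second case.\<close>

lemma mixed_qnorm_upper:
  fixes m w :: "'i \<Rightarrow> 'b::euclidean_space"
  assumes p: "0 < p" and q: "0 < q" and I: "finite I" "I \<noteq> {}" and A: "A \<ge> 0"
    and s: "s \<ge> recip p + 2 * DIM('b) * (recip p + recip q)"
    and meas: "mixed_measurable p H"
    and H: "\<And>X Y. H X Y \<le> A * (\<Sum>i\<in>I. decay (s + 1) (X - m i) * decay (s + 1) (Y - w i))"
  shows mixed_qnorm_upper_position:
      "(\<And>i. i \<in> I \<Longrightarrow> w i = 0) \<Longrightarrow>
       (\<And>i j. i \<in> I \<Longrightarrow> j \<in> I \<Longrightarrow> i \<noteq> j \<Longrightarrow> 2 * real (card I) \<le> norm (m i - m j)) \<Longrightarrow>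
       mixed_qnorm p q H \<le> ennreal (2 * A * decay_mass TYPE('b) powr recip p * decay_mass TYPE('b) powr recip q * card I powr recip p)"
    and mixed_qnorm_upper_frequency:
      "(\<And>i j. i \<in> I \<Longrightarrow> j \<in> I \<Longrightarrow> i \<noteq> j \<Longrightarrow> 2 * real (card I) \<le> norm (w i - w j)) \<Longrightarrow>
       mixed_qnorm p q H \<le> ennreal (2 * A * (2 * decay_mass TYPE('b)) powr recip p * decay_mass TYPE('b) powr recip q * card I powr recip q)"
proof -
  let ?D = "decay_mass TYPE('b)" and ?n = "real (2 * DIM('b))"
  have D: "?D \<ge> 1" by (rule decay_mass_ge_1)
  have m1: "(\<lambda>X. ennreal (H X Y)) \<in> borel_measurable lebesgue" for Y
    using meas by (simp add: mixed_measurable_def)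
  have m2: "(\<lambda>Y. Lp_qnorm p (\<lambda>X. ennreal (H X Y))) \<in> borel_measurable lebesgue"
    using meas by (simp add: mixed_measurable_def)
  have s_split: "s \<ge> recip p + (?n * recip p + ?n * recip q)" using s by (simp add: distrib_left)
  have nn: "?n * recip p \<ge> 0" "?n * recip q \<ge> 0" by auto
  have sp: "s \<ge> ?n * recip p" and sq: "s \<ge> ?n * recip q" and s0: "s \<ge> 0"
    and spq: "s - recip p \<ge> ?n * recip q"
    using s_split nn recip_nonneg[of p] by linarith+
  have H2: "\<exists>i\<in>I. ennreal (H X Y) \<le> ennreal (2 * A * decay s (Y - w i) * decay s (X - m i))"
    if sep: "\<And>i j. i \<in> I \<Longrightarrow> j \<in> I \<Longrightarrow> i \<noteq> j \<Longrightarrow> 2 * real (card I) \<le> norm (m i - m j) \<or> 2 * real (card I) \<le> norm (w i - w j)" for X Y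
  proof -
    have "\<exists>i\<in>I. (\<Sum>i\<in>I. decay (s + 1) (X - m i) * decay (s + 1) (Y - w i)) \<le> 2 * (decay s (X - m i) * decay s (Y - w i))"
      by (rule sum_decay_le[OF I s0 sep])
    then obtain i where i: "i \<in> I" "(\<Sum>i\<in>I. decay (s + 1) (X - m i) * decay (s + 1) (Y - w i)) \<le> 2 * (decay s (X - m i) * decay s (Y - w i))"
      by blast
    have "H X Y \<le> A * (2 * (decay s (X - m i) * decay s (Y - w i)))"
      using order_trans[OF H mult_left_mono[OF i(2) A]] .
    then show ?thesis using i(1) by (intro bexI[of _ i] ennreal_leI) (simp_all add: mult_ac)
  qed
  show "mixed_qnorm p q H \<le> ennreal (2 * A * ?D powr recip p * ?D powr recip q * card I powr recip p)"
    if w: "\<And>i. i \<in> I \<Longrightarrow> w i = 0" and sep: "\<And>i j. i \<in> I \<Longrightarrow> j \<in> I \<Longrightarrow> i \<noteq> j \<Longrightarrow> 2 * real (card I) \<le> norm (m i - m j)"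
  proof -
    let ?K = "(card I * ?D) powr recip p"
    have inner: "Lp_qnorm p (\<lambda>X. ennreal (H X Y)) \<le> ennreal (2 * A * ?K * decay s (Y - 0))" for Y
    proof -
      have "Lp_qnorm p (\<lambda>X. ennreal (H X Y)) \<le> ennreal (2 * A * decay s Y * ?K)"
      proof (rule Lp_qnorm_upper[OF p I(1), where s = s and c = m])
        show "\<exists>i\<in>I. ennreal (H X Y) \<le> ennreal (2 * A * decay s Y * decay s (X - m i))" for X
          using H2[of X Y] sep w by fastforce
      qed (use A sp m1 in auto)
      then show ?thesis by (simp add: mult_ac)
    qed
    \<comment> \<open>As a function of Y the inner norm is a single bump at frequency 0, hence the
      one-point index set.\<close>
    have "mixed_qnorm p q H \<le> ennreal (2 * A * ?K * (card {()} * ?D) powr recip q)"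
      unfolding mixed_qnorm_def
      by (rule Lp_qnorm_upper[OF q, where s = s and c = "\<lambda>_. 0"]) (use A sq m2 inner in auto)
    then show ?thesis using D by (simp add: powr_mult mult_ac)
  qed
  show "mixed_qnorm p q H \<le> ennreal (2 * A * (2 * ?D) powr recip p * ?D powr recip q * card I powr recip q)"
    if sep: "\<And>i j. i \<in> I \<Longrightarrow> j \<in> I \<Longrightarrow> i \<noteq> j \<Longrightarrow> 2 * real (card I) \<le> norm (w i - w j)"
  proof -
    let ?K = "(2 * ?D) powr recip p" and ?s = "s - recip p"
    have inner: "\<exists>i\<in>I. Lp_qnorm p (\<lambda>X. ennreal (H X Y)) \<le> ennreal (2 * A * ?K * decay ?s (Y - w i))" for Y
    proof (cases "p = \<infinity>")
      case True
      \<comment> \<open>For p = \<infinity> the inner norm is governed by the frequency closest to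
        Y, and no decay is lost.\<close>
      have "Max ((\<lambda>i. decay s (Y - w i)) ` I) \<in> (\<lambda>i. decay s (Y - w i)) ` I"
        using I by (intro Max_in) auto
      then obtain k where k: "k \<in> I" "Max ((\<lambda>i. decay s (Y - w i)) ` I) = decay s (Y - w k)" by blast
      have le: "decay s (Y - w i) \<le> decay s (Y - w k)" if "i \<in> I" for i
        unfolding k(2)[symmetric] using I that by (intro Max_ge) auto
      have "Lp_qnorm p (\<lambda>X. ennreal (H X Y)) \<le> ennreal (2 * A * decay s (Y - w k) * (card I * ?D) powr recip p)"
      proof (rule Lp_qnorm_upper[OF p I(1), where s = s and c = m])
        show "\<exists>i\<in>I. ennreal (H X Y) \<le> ennreal (2 * A * decay s (Y - w k) * decay s (X - m i))" for X
        proof -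
          obtain i where i: "i \<in> I" "ennreal (H X Y) \<le> ennreal (2 * A * decay s (Y - w i) * decay s (X - m i))"
            using H2[of X Y] sep by blast
          have "2 * A * decay s (Y - w i) * decay s (X - m i) \<le> 2 * A * decay s (Y - w k) * decay s (X - m i)"
            using A le[OF i(1)] by (intro mult_right_mono mult_left_mono) auto
          then show ?thesis using i by (meson ennreal_leI order_trans)
        qed
      qed (use A sp m1 in auto)
      then show ?thesis using True k(1) I D by (intro bexI[of _ k]) (auto simp: card_gt_0_iff)
    next
      case False
      let ?p = "enn2real p"
      note pp = recip_pos[OF p False]
      \<comment> \<open>After raising to the power p the bumps have order s p. Spending one unit of
        it in \<open>sum_decay_le\<close> avoids a factor \<open>card I\<close>; after the p-th root
        this costs order 1/p.\<close>
      define \<sigma> where "\<sigma> = s * ?p - 1"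
      have sp': "s * ?p \<ge> ?n" using sp pp(1) unfolding pp(2) by (simp add: field_simps)
      have "recip p \<le> s" using s_split nn by linarith
      then have \<sigma>0: "\<sigma> \<ge> 0" using pp(1) unfolding pp(2) \<sigma>_def by (simp add: field_simps)
      \<comment> \<open>All positions are collapsed to 0, where \<open>decay\<close> is 1, so that
        the lemma acts on the frequencies alone.\<close>
      obtain k where k: "k \<in> I" "(\<Sum>i\<in>I. decay (\<sigma> + 1) (0 - 0::'b) * decay (\<sigma> + 1) (Y - w i)) \<le> 2 * (decay \<sigma> (0 - 0::'b) * decay \<sigma> (Y - w k))"
        using sum_decay_le[OF I \<sigma>0, of "\<lambda>_. 0" w 0 Y] sep by blast
      have "Lp_qnorm p (\<lambda>X. ennreal (H X Y)) \<le> ennreal (((\<Sum>i\<in>I. (2 * A * decay s (Y - w i)) powr ?p) * ?D) powr recip p)"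
        by (rule Lp_qnorm_upper_finite[OF p False I(1), where s = s and c = m]) (use A sp' H2 sep in auto)
      also have "((\<Sum>i\<in>I. (2 * A * decay s (Y - w i)) powr ?p) * ?D) powr recip p \<le> ((2 * A * decay ?s (Y - w k)) powr ?p * (2 * ?D)) powr recip p"
      proof (rule powr_mono2)
        have "(\<Sum>i\<in>I. (2 * A * decay s (Y - w i)) powr ?p) = (2 * A) powr ?p * (\<Sum>i\<in>I. decay (\<sigma> + 1) (Y - w i))"
          using A by (simp add: powr_mult decay_powr \<sigma>_def sum_distrib_left)
        also have "\<dots> \<le> (2 * A) powr ?p * (2 * decay \<sigma> (Y - w k))"
          using k(2) by (intro mult_left_mono) (auto simp: decay_def)
        also have "\<sigma> = ?s * ?p" using pp by (simp add: \<sigma>_def left_diff_distrib)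
        also have "(2 * A) powr ?p * (2 * decay (?s * ?p) (Y - w k)) = (2 * A * decay ?s (Y - w k)) powr ?p * 2"
          using A by (simp add: powr_mult decay_powr)
        finally have "(\<Sum>i\<in>I. (2 * A * decay s (Y - w i)) powr ?p) * ?D \<le> ((2 * A * decay ?s (Y - w k)) powr ?p * 2) * ?D"
          using D by (intro mult_right_mono) auto
        then show "(\<Sum>i\<in>I. (2 * A * decay s (Y - w i)) powr ?p) * ?D \<le> (2 * A * decay ?s (Y - w k)) powr ?p * (2 * ?D)"
          by (simp only: mult.assoc)
        show "0 \<le> (\<Sum>i\<in>I. (2 * A * decay s (Y - w i)) powr ?p) * ?D"
          using D by (intro mult_nonneg_nonneg sum_nonneg) auto
      qed simp
      also have "((2 * A * decay ?s (Y - w k)) powr ?p * (2 * ?D)) powr recip p = 2 * A * ?K * decay ?s (Y - w k)"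
      proof -
        have "((2 * A * decay ?s (Y - w k)) powr ?p * (2 * ?D)) powr recip p = ((2 * A * decay ?s (Y - w k)) powr ?p) powr recip p * ?K"
          by (rule powr_mult)
        also have "((2 * A * decay ?s (Y - w k)) powr ?p) powr recip p = 2 * A * decay ?s (Y - w k)"
          using pp A by (simp add: powr_powr)
        finally show ?thesis by simp
      qed
      finally show ?thesis using k(1) by (auto simp: ennreal_leI)
    qed
    have "mixed_qnorm p q H \<le> ennreal (2 * A * ?K * (card I * ?D) powr recip q)"
      unfolding mixed_qnorm_def
      by (rule Lp_qnorm_upper[OF q I(1), where s = ?s and c = w]) (use A spq m2 inner in auto)
    then show ?thesis using D by (simp add: powr_mult mult_ac)
  qed
qed

text \<open>Over a common frequency ball the inner norm sees every position ball; over separated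
  frequency balls it sees one position ball each time. The common frequency \<open>w0\<close> is
  left free because the balls will be shifted by Y0.\<close>

lemma mixed_qnorm_lower:
  fixes m w :: "'i \<Rightarrow> 'b::euclidean_space"
  assumes p: "0 < p" and q: "0 < q" and I: "finite I" "I \<noteq> {}" and a: "a \<ge> 0" and \<delta>: "\<delta> > 0"
    and H: "\<And>i X Y. i \<in> I \<Longrightarrow> X \<in> ball (m i) \<delta> \<Longrightarrow> Y \<in> ball (w i) \<delta> \<Longrightarrow> a \<le> H X Y"
  shows mixed_qnorm_lower_position:
      "(\<And>i. i \<in> I \<Longrightarrow> w i = w0) \<Longrightarrow>
       (\<And>i j. i \<in> I \<Longrightarrow> j \<in> I \<Longrightarrow> i \<noteq> j \<Longrightarrow> 2 * \<delta> \<le> norm (m i - m j)) \<Longrightarrow>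
       ennreal (a * measure lborel (ball (0::'b) \<delta>) powr recip p * measure lborel (ball (0::'b) \<delta>) powr recip q * card I powr recip p) \<le> mixed_qnorm p q H"
    and mixed_qnorm_lower_frequency:
      "(\<And>i j. i \<in> I \<Longrightarrow> j \<in> I \<Longrightarrow> i \<noteq> j \<Longrightarrow> 2 * \<delta> \<le> norm (w i - w j)) \<Longrightarrow>
       ennreal (a * measure lborel (ball (0::'b) \<delta>) powr recip p * measure lborel (ball (0::'b) \<delta>) powr recip q * card I powr recip q) \<le> mixed_qnorm p q H"
proof -
  let ?V = "measure lborel (ball (0::'b) \<delta>)"
  have V: "?V > 0" using measure_ball_pos[OF \<delta>] .
  show "ennreal (a * ?V powr recip p * ?V powr recip q * card I powr recip p) \<le> mixed_qnorm p q H"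
    if w: "\<And>i. i \<in> I \<Longrightarrow> w i = w0" and sep: "\<And>i j. i \<in> I \<Longrightarrow> j \<in> I \<Longrightarrow> i \<noteq> j \<Longrightarrow> 2 * \<delta> \<le> norm (m i - m j)"
  proof -
    have inner: "ennreal (a * (card I * ?V) powr recip p) \<le> Lp_qnorm p (\<lambda>X. ennreal (H X Y))" if "Y \<in> ball w0 \<delta>" for Y
      by (rule Lp_qnorm_lower[OF p I \<delta> sep a]) (use H w that in \<open>auto intro!: ennreal_leI\<close>)
    have "ennreal (a * (card I * ?V) powr recip p * (card {()} * ?V) powr recip q) \<le> mixed_qnorm p q H"
      unfolding mixed_qnorm_def
      by (rule Lp_qnorm_lower[OF q _ _ \<delta>, where c = "\<lambda>_. w0"]) (use a inner in auto)
    then show ?thesis using V by (simp add: powr_mult mult_ac)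
  qed
  show "ennreal (a * ?V powr recip p * ?V powr recip q * card I powr recip q) \<le> mixed_qnorm p q H"
    if sep: "\<And>i j. i \<in> I \<Longrightarrow> j \<in> I \<Longrightarrow> i \<noteq> j \<Longrightarrow> 2 * \<delta> \<le> norm (w i - w j)"
  proof -
    have inner: "ennreal (a * (card {()} * ?V) powr recip p) \<le> Lp_qnorm p (\<lambda>X. ennreal (H X Y))" if "i \<in> I" "Y \<in> ball (w i) \<delta>" for i Y
      by (rule Lp_qnorm_lower[OF p _ _ \<delta> _ a, where c = "\<lambda>_. m i"]) (use H that in \<open>auto intro!: ennreal_leI\<close>)
    have "ennreal (a * (card {()} * ?V) powr recip p * (card I * ?V) powr recip q) \<le> mixed_qnorm p q H"
      unfolding mixed_qnorm_def
      by (rule Lp_qnorm_lower[OF q I \<delta> sep]) (use a inner in auto)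
    then show ?thesis using V by (simp add: powr_mult mult_ac)
  qed
qed

text \<open>The essential supremum is at most c exactly when the set where G exceeds c has measure 0
  in the slice, and the measure of the slice depends measurably on Y by Tonelli.\<close>

lemma borel_measurable_esssup_section:
  fixes G :: "'b::euclidean_space \<Rightarrow> 'b \<Rightarrow> ennreal"
  assumes G[measurable]: "(\<lambda>(X, Y). G X Y) \<in> borel_measurable (borel \<Otimes>\<^sub>M borel)"
  shows "(\<lambda>Y. esssup lebesgue (\<lambda>X. G X Y)) \<in> borel_measurable borel"
proof (rule borel_measurableI_le)
  fix c :: ennreal
  have 1: "(esssup lebesgue (\<lambda>X. G X Y) \<le> c) \<longleftrightarrow> (\<integral>\<^sup>+X. indicator {c<..} (G X Y) \<partial>lborel) = 0" for Y
  proof -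
    have m: "(\<lambda>X. G X Y) \<in> borel_measurable lebesgue" by (rule measurable_completion) measurable
    have "(esssup lebesgue (\<lambda>X. G X Y) \<le> c) \<longleftrightarrow> (AE X in lebesgue. G X Y \<le> c)"
    proof
      assume "esssup lebesgue (\<lambda>X. G X Y) \<le> c"
      then show "AE X in lebesgue. G X Y \<le> c"
        using esssup_AE[of "\<lambda>X. G X Y" lebesgue] by (auto elim!: eventually_mono)
    qed (rule esssup_I[OF m])
    also have "\<dots> \<longleftrightarrow> (AE X in lborel. G X Y \<le> c)"
      by (simp add: AE_completion_iff)
    also have "\<dots> \<longleftrightarrow> (AE X in lborel. indicator {c<..} (G X Y) = (0::ennreal))"
      by (intro AE_cong) (auto simp: indicator_def)
    also have "\<dots> \<longleftrightarrow> (\<integral>\<^sup>+X. indicator {c<..} (G X Y) \<partial>lborel) = 0"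
      by (subst nn_integral_0_iff_AE) auto
    finally show ?thesis .
  qed
  have [measurable]: "(\<lambda>Y. \<integral>\<^sup>+X. indicator {c<..} (G X Y) \<partial>lborel) \<in> borel_measurable borel"
    by measurable
  show "{Y \<in> space borel. esssup lebesgue (\<lambda>X. G X Y) \<le> c} \<in> sets borel"
    unfolding 1 by measurable
qed

lemma Lp_qnorm_AE_cong:
  assumes "F \<in> borel_measurable lebesgue" "G \<in> borel_measurable lebesgue" "AE x in lborel. F x = G x"
  shows "Lp_qnorm p F = Lp_qnorm p G"
proof (cases "p = \<infinity>")
  case True
  then show ?thesis
    using assms by (auto simp: Lp_qnorm_top intro!: esssup_AE_cong AE_completion)
next
  case False
  have "(\<integral>\<^sup>+ x. ennpowr (F x) (enn2real p) \<partial>lborel) = (\<integral>\<^sup>+ x. ennpowr (G x) (enn2real p) \<partial>lborel)"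
    using assms(3) by (intro nn_integral_cong_AE) auto
  then show ?thesis using False by (simp add: Lp_qnorm_finite)
qed

lemma AE_lborel_translate:
  fixes c :: "'b::euclidean_space"
  assumes "AE x in lborel. P x"
  shows "AE x in lborel. P (c + x)"
proof (rule AE_distrD[of "(+) c" lborel borel P])
  show "AE x in distr lborel borel ((+) c). P x"
    unfolding lborel_distr_plus by (rule assms)
qed simp

lemma lebesgue_measurable_translate: "(\<lambda>x. c + x) \<in> lebesgue \<rightarrow>\<^sub>M (lebesgue :: 'b::euclidean_space measure)"
  using lebesgue_affine_measurable[of "\<lambda>_::'b. 1" c] by (simp add: euclidean_representation)

text \<open>The weights are only Lebesgue measurable. Since they enter through translates
  of functions of one variable, they can be replaced by Borel functions on almost every point of
  \<^emph>\<open>every\<close> slice, which is what makes the inner norm measurable.\<close>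
lemma mixed_measurable_weight:
  fixes v :: "'b::euclidean_space \<Rightarrow> 'b \<Rightarrow> complex" and \<theta> \<theta>' :: "'b \<Rightarrow> real"
  assumes v: "continuous_on UNIV (\<lambda>p. v (fst p) (snd p))"
    and \<theta>: "\<theta> \<in> borel_measurable lebesgue" "\<theta>' \<in> borel_measurable lebesgue"
    and H: "\<And>X Y. H X Y = norm (v X Y) * \<bar>\<theta> (X - Y) / \<theta>' (X + Y)\<bar>"
  shows "mixed_measurable p H"
proof -
  obtain \<eta> where \<eta>[measurable]: "\<eta> \<in> borel_measurable borel" "AE x in lborel. \<theta> x = \<eta> x"
    using completion_ex_borel_measurable_real[OF \<theta>(1)] by auto
  obtain \<eta>' where \<eta>'[measurable]: "\<eta>' \<in> borel_measurable borel" "AE x in lborel. \<theta>' x = \<eta>' x"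
    using completion_ex_borel_measurable_real[OF \<theta>(2)] by auto
  have v': "(\<lambda>p. v (fst p) (snd p)) \<in> borel_measurable (borel \<Otimes>\<^sub>M borel)"
    unfolding borel_prod using v by (rule borel_measurable_continuous_onI)
  define G where "G X Y = ennreal (norm (v X Y) * \<bar>\<eta> (X - Y) / \<eta>' (X + Y)\<bar>)" for X Y
  have G: "(\<lambda>(X, Y). G X Y) \<in> borel_measurable (borel \<Otimes>\<^sub>M borel)"
    unfolding G_def split_beta using v' by measurable
  have Gm: "(\<lambda>X. G X Y) \<in> borel_measurable lebesgue" for Y
    by (rule measurable_completion) (use measurable_compose[OF measurable_Pair2'[of Y borel borel] G] in simp)
  have Hm: "(\<lambda>X. ennreal (H X Y)) \<in> borel_measurable lebesgue" for Y
  proof -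
    have "(\<lambda>X. \<theta> (- Y + X)) \<in> borel_measurable lebesgue" "(\<lambda>X. \<theta>' (Y + X)) \<in> borel_measurable lebesgue"
      by (rule measurable_compose[OF lebesgue_measurable_translate \<theta>(1)], rule measurable_compose[OF lebesgue_measurable_translate \<theta>(2)])
    moreover have "(\<lambda>X. norm (v X Y)) \<in> borel_measurable lebesgue"
    proof -
      have "continuous_on UNIV (\<lambda>X. v (fst (X, Y)) (snd (X, Y)))"
        by (rule continuous_on_compose2[OF v]) (intro continuous_intros, simp)
      then have "(\<lambda>X. norm (v X Y)) \<in> borel_measurable borel"
        by (intro borel_measurable_continuous_onI continuous_on_norm) simp
      then show ?thesis by (intro measurable_completion) simp
    qed
    ultimately have "(\<lambda>X. norm (v X Y) * \<bar>\<theta> (- Y + X) / \<theta>' (Y + X)\<bar>) \<in> borel_measurable lebesgue"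
      by (intro borel_measurable_times borel_measurable_abs borel_measurable_divide)
    then show ?thesis unfolding H by (simp add: add.commute)
  qed
  have AE: "AE X in lborel. ennreal (H X Y) = G X Y" for Y
    using AE_lborel_translate[OF \<eta>(2), of "- Y"] AE_lborel_translate[OF \<eta>'(2), of Y]
    by eventually_elim (simp add: H G_def add.commute)
  have eq: "Lp_qnorm p (\<lambda>X. ennreal (H X Y)) = Lp_qnorm p (\<lambda>X. G X Y)" for Y
    by (rule Lp_qnorm_AE_cong[OF Hm Gm AE])
  have "(\<lambda>Y. Lp_qnorm p (\<lambda>X. G X Y)) \<in> borel_measurable borel"
  proof (cases "p = \<infinity>")
    case True
    then show ?thesis using borel_measurable_esssup_section[OF G] by (simp add: Lp_qnorm_top)
  next
    case False
    have [measurable]: "(\<lambda>(X, Y). G X Y) \<in> borel_measurable (borel \<Otimes>\<^sub>M borel)" by (rule G)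
    show ?thesis unfolding Lp_qnorm_finite[OF False]
      by (rule measurable_compose[OF _ borel_measurable_ennpowr]) measurable
  qed
  then have "(\<lambda>Y. Lp_qnorm p (\<lambda>X. ennreal (H X Y))) \<in> borel_measurable lebesgue"
    unfolding eq by (intro measurable_completion) simp
  with Hm show ?thesis by (simp add: mixed_measurable_def)
qed

section \<open>Polynomially moderate weights\<close>

lemma real_polynomial_function_complex_polyfun:
  fixes v :: "'b::euclidean_space \<Rightarrow> real"
  assumes "real_polynomial_function v"
  shows "(\<lambda>x. complex_of_real (v x)) \<in> complex_polyfun"
  using assms
proof (induction rule: real_polynomial_function.induct)
  case (linear f)
  then have "f x = x \<bullet> adjoint f 1" for x
    using adjoint_works[of f x 1] by (simp add: bounded_linear.linear inner_commute)
  then show ?case using complex_polyfun.linear[of "adjoint f 1"] by simp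
qed (auto intro: complex_polyfun.intros)

text \<open>The polynomial is moved to the left as a negative power of 1 + |y|, where spare decay of
  the transform can absorb it.\<close>

lemma poly_moderate_bound:
  fixes \<omega> :: "'b::euclidean_space \<Rightarrow> real"
  assumes "\<omega> \<in> poly_moderate_weights"
  obtains C L where "C > 0" "L \<ge> 0" "\<And>x y. \<omega> (x + y) * decay L y \<le> C * \<omega> x"
proof -
  from assms obtain v C where v: "real_polynomial_function v" and C: "C > 0" "\<And>x y. \<omega> (x + y) \<le> C * (\<omega> x * v y)"
    and pos: "\<And>x. \<omega> x > 0"
    by (auto simp: poly_moderate_weights_def weight_def)
  obtain D M where D: "\<And>x. \<bar>v x\<bar> \<le> D * (1 + norm x) ^ M"
    using complex_polyfun_bound[OF real_polynomial_function_complex_polyfun[OF v]] by auto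
  have "\<omega> (x + y) * decay (real M) y \<le> C * (\<bar>D\<bar> + 1) * \<omega> x" for x y
  proof -
    have "v y \<le> (\<bar>D\<bar> + 1) * (1 + norm y) ^ M"
    proof -
      have "D * (1 + norm y) ^ M \<le> (\<bar>D\<bar> + 1) * (1 + norm y) ^ M" by (intro mult_right_mono) auto
      then show ?thesis using D[of y] by linarith
    qed
    then have "C * (\<omega> x * v y) \<le> C * (\<omega> x * ((\<bar>D\<bar> + 1) * (1 + norm y) ^ M))"
      using C pos[of x] by (intro mult_left_mono) auto
    then have "\<omega> (x + y) \<le> C * (\<bar>D\<bar> + 1) * \<omega> x * (1 + norm y) ^ M"
      using C(2)[of x y] by (simp add: mult_ac)
    then show ?thesis
      using one_plus_norm_pos[of y] by (simp add: decay_nat divide_le_eq)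
  qed
  then show ?thesis using C(1) by (intro that[of "C * (\<bar>D\<bar> + 1)" "real M"]) auto
qed

lemma weight_pos: "\<omega> \<in> poly_moderate_weights \<Longrightarrow> \<omega> x > 0"
  by (simp add: poly_moderate_weights_def weight_def)

lemma weight_measurable: "\<omega> \<in> poly_moderate_weights \<Longrightarrow> \<omega> \<in> borel_measurable lebesgue"
  by (simp add: poly_moderate_weights_def weight_def locally_ess_bounded_def)

lemma decay_Pair: "L \<ge> 0 \<Longrightarrow> decay L x * decay L y \<le> decay L (x, y)"
proof -
  assume L: "L \<ge> 0"
  have "norm (x, y) \<le> norm x + norm y" by (rule norm_Pair_le)
  also have "\<dots> + 0 \<le> norm x + norm y + norm x * norm y" by (intro add_left_mono) simp
  finally have "1 + norm (x, y) \<le> (1 + norm x) * (1 + norm y)" by (simp add: algebra_simps)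
  then have "((1 + norm x) * (1 + norm y)) powr (- L) \<le> (1 + norm (x, y)) powr (- L)"
    using L one_plus_norm_pos[of "(x, y)"] by (intro powr_mono2') auto
  then show ?thesis using one_plus_norm_pos[of x] one_plus_norm_pos[of y] by (simp add: decay_def powr_mult)
qed

lemma poly_moderate_bound_Pair:
  fixes \<omega> :: "'b::euclidean_space \<times> 'c::euclidean_space \<Rightarrow> real"
  assumes "\<omega> \<in> poly_moderate_weights"
  obtains C L where "C > 0" "L \<ge> 0"
    "\<And>X Y m w. \<omega> (X, Y) * (decay L (X - m) * decay L (Y - w)) \<le> C * \<omega> (m, w)"
    "\<And>X Y m w. \<omega> (m, w) * (decay L (X - m) * decay L (Y - w)) \<le> C * \<omega> (X, Y)"
proof -
  obtain C L where *: "C > 0" "L \<ge> 0" "\<And>x y. \<omega> (x + y) * decay L y \<le> C * \<omega> x"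
    using poly_moderate_bound[OF assms] by blast
  have 1: "\<omega> (X, Y) * (decay L (X - m) * decay L (Y - w)) \<le> C * \<omega> (m, w)" for X Y m w
  proof -
    have "\<omega> (X, Y) * (decay L (X - m) * decay L (Y - w)) \<le> \<omega> (X, Y) * decay L (X - m, Y - w)"
      using weight_pos[OF assms] *(2) by (intro mult_left_mono decay_Pair) (auto simp: less_imp_le)
    also have "\<dots> \<le> C * \<omega> (m, w)" using *(3)[of "(m, w)" "(X - m, Y - w)"] by simp
    finally show ?thesis .
  qed
  \<comment> \<open>Exchanging the two points turns the upper estimate into a lower one for the
    weight near (m, w).\<close>
  have "\<omega> (m, w) * (decay L (X - m) * decay L (Y - w)) \<le> C * \<omega> (X, Y)" for X Y m w
    using 1[of m w X Y] unfolding decay_minus_commute[of L m X] decay_minus_commute[of L w Y] .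
  with *(1,2) 1 show ?thesis by (rule that)
qed


section \<open>Test symbols\<close>

text \<open>Position and, with \<open>atom_offset\<close>, frequency of the point around which the
  transform of an atom is concentrated. The second components are 0 because the Gaussians involved
  carry no momentum.\<close>

definition atom_center :: "'a::euclidean_space \<Rightarrow> 'a \<Rightarrow> 'a \<times> 'a" where
  "atom_center x y = ((1/2) *\<^sub>R (x + y), 0)"

definition atom_offset :: "'a::euclidean_space \<Rightarrow> 'a \<Rightarrow> 'a \<times> 'a" where
  "atom_offset x y = ((1/2) *\<^sub>R (y - x), 0)"

text \<open>Together with \<open>center_plus_offset\<close> this explains the shape of the weights:
  at the phase space point of the atom, a quotient of the form \<theta>(X - Y)/\<theta>'(X + Y)
  separates into a function of x and one of y.\<close>

lemma center_minus_offset: "atom_center x y - atom_offset x y = (x, 0)"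
  by (simp add: atom_center_def atom_offset_def scaleR_diff_right scaleR_add_right flip: scaleR_add_left)

lemma center_plus_offset: "atom_center x y + atom_offset x y = (y, 0)"
  by (simp add: atom_center_def atom_offset_def scaleR_diff_right scaleR_add_right flip: scaleR_add_left)

lemma norm_symp_stft_atom:
  "\<Phi> \<in> schwartz_space \<Longrightarrow>
   norm (symp_stft \<Phi> (atom x y) X Y) = norm (symp_stft \<Phi> sgauss (X - atom_center x y) (Y - atom_offset x y))"
  unfolding atom_center_def atom_offset_def by (rule symp_stft_atom)

text \<open>The two situations in which the norm of a sum of atoms is read off: the atoms lie on the
  diagonal and are separated in position, or they are separated in frequency.\<close>
definition spread :: "real \<Rightarrow> 'i set \<Rightarrow> ('i \<Rightarrow> 'a::euclidean_space) \<Rightarrow> ('i \<Rightarrow> 'a) \<Rightarrow> ennreal \<Rightarrow> ennreal \<Rightarrow> real \<Rightarrow> bool" where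
  "spread R I x y p q e \<longleftrightarrow>
     e = recip p \<and> (\<forall>i\<in>I. x i = y i) \<and> (\<forall>i\<in>I. \<forall>j\<in>I. i \<noteq> j \<longrightarrow> R \<le> norm (x i - x j)) \<or>
     e = recip q \<and> (\<forall>i\<in>I. \<forall>j\<in>I. i \<noteq> j \<longrightarrow> 2 * R \<le> norm ((y i - x i) - (y j - x j)))"

lemma spread_cases:
  assumes "spread R I x y p q e"
  obtains (position) "e = recip p" "\<And>i. i \<in> I \<Longrightarrow> atom_offset (x i) (y i) = 0"
      "\<And>i j. i \<in> I \<Longrightarrow> j \<in> I \<Longrightarrow> i \<noteq> j \<Longrightarrow> R \<le> norm (atom_center (x i) (y i) - atom_center (x j) (y j))"
    | (frequency) "e = recip q"
      "\<And>i j. i \<in> I \<Longrightarrow> j \<in> I \<Longrightarrow> i \<noteq> j \<Longrightarrow> R \<le> norm (atom_offset (x i) (y i) - atom_offset (x j) (y j))"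
proof -
  have c: "norm (atom_center a a - atom_center b b) = norm (a - b)" for a b :: 'b
    by (simp add: atom_center_def norm_Pair scaleR_2[symmetric])
  \<comment> \<open>The offset is half of y - x, which accounts for the factor 2 in the frequency
    alternative of \<open>spread\<close>.\<close>
  have s: "norm (atom_offset a b - atom_offset a' b') = norm ((b - a) - (b' - a')) / 2" for a b a' b' :: 'b
    by (simp add: atom_offset_def norm_Pair scaleR_diff_right[symmetric] del: scaleR_right_diff_distrib)
  show thesis
    using assms unfolding spread_def
  proof (elim disjE conjE)
    assume a: "e = recip p" "\<forall>i\<in>I. x i = y i" "\<forall>i\<in>I. \<forall>j\<in>I. i \<noteq> j \<longrightarrow> R \<le> norm (x i - x j)"
    show thesis
    proof (rule position[OF a(1)])
      show "atom_offset (x i) (y i) = 0" if "i \<in> I" for i using a that by (simp add: atom_offset_def zero_prod_def)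
      show "R \<le> norm (atom_center (x i) (y i) - atom_center (x j) (y j))" if "i \<in> I" "j \<in> I" "i \<noteq> j" for i j
        using a that c[of "y i" "y j"] by metis
    qed
  next
    assume a: "e = recip q" "\<forall>i\<in>I. \<forall>j\<in>I. i \<noteq> j \<longrightarrow> 2 * R \<le> norm ((y i - x i) - (y j - x j))"
    show thesis
    proof (rule frequency[OF a(1)])
      show "R \<le> norm (atom_offset (x i) (y i) - atom_offset (x j) (y j))" if "i \<in> I" "j \<in> I" "i \<noteq> j" for i j
        using a(2)[rule_format, OF that] unfolding s by simp
    qed
  qed
qed

lemma spread_positionI:
  assumes "\<And>i. i \<in> I \<Longrightarrow> x i = y i" "\<And>i j. i \<in> I \<Longrightarrow> j \<in> I \<Longrightarrow> i \<noteq> j \<Longrightarrow> R \<le> norm (x i - x j)"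
  shows "spread R I x y p q (recip p)"
  using assms unfolding spread_def by blast

lemma spread_frequencyI:
  assumes "\<And>i j. i \<in> I \<Longrightarrow> j \<in> I \<Longrightarrow> i \<noteq> j \<Longrightarrow> 2 * R \<le> norm ((y i - x i) - (y j - x j))"
  shows "spread R I x y p q (recip q)"
  using assms unfolding spread_def by blast

text \<open>Each coefficient is the reciprocal of the weight at the phase space point of its atom,
  so all terms have comparable weighted size.\<close>

definition test_symbol where
  "test_symbol \<theta> \<theta>' I x y = (\<lambda>Z. \<Sum>i\<in>I. complex_of_real (\<theta>' (y i, 0) / \<theta> (x i, 0)) * atom (x i) (y i) Z)"

lemma test_symbol_schwartz: "finite I \<Longrightarrow> I \<noteq> {} \<Longrightarrow> test_symbol \<theta> \<theta>' I x y \<in> schwartz_space"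
  unfolding test_symbol_def by (intro schwartz_sum atom_schwartz)

lemma modulation_qnorm_eq_mixed:
  "modulation_qnorm \<Phi> p q \<omega> a = mixed_qnorm p q (\<lambda>X Y. norm (symp_stft \<Phi> a X Y * \<omega> (X, Y)))"
  by (simp add: modulation_qnorm_def mixed_qnorm_def)

text \<open>The transform decays to any order; the order L consumed by moderateness is added in
  advance, so that the weight can be frozen at the centre.\<close>

lemma weighted_stft_decay:
  fixes \<Phi> :: "'a::euclidean_space \<times> 'a \<Rightarrow> complex"
  assumes \<Phi>: "\<Phi> \<in> schwartz_space" and \<omega>: "\<omega> \<in> poly_moderate_weights" and s: "s \<ge> 0"
  shows "\<exists>A>0. \<forall>X Y m w. norm (symp_stft \<Phi> sgauss (X - m) (Y - w)) * \<omega> (X, Y) \<le> A * \<omega> (m, w) * (decay s (X - m) * decay s (Y - w))"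
proof -
  obtain C L where C: "C > 0" "L \<ge> 0"
    "\<And>X Y m w. \<omega> (X, Y) * (decay L (X - m) * decay L (Y - w)) \<le> C * \<omega> (m, w)"
    using poly_moderate_bound_Pair[OF \<omega>] by metis
  obtain B where B: "B > 0" "\<And>X Y. norm (symp_stft \<Phi> sgauss X Y) \<le> B * decay (s + L) X * decay (s + L) Y"
    using symp_stft_decay[OF sgauss_schwartz \<Phi>, of "s + L"] s C(2) by auto
  have "norm (symp_stft \<Phi> sgauss (X - m) (Y - w)) * \<omega> (X, Y) \<le> (B * C) * \<omega> (m, w) * (decay s (X - m) * decay s (Y - w))" for X Y m w
  proof -
    have "norm (symp_stft \<Phi> sgauss (X - m) (Y - w)) * \<omega> (X, Y) \<le> (B * decay (s + L) (X - m) * decay (s + L) (Y - w)) * \<omega> (X, Y)"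
      using weight_pos[OF \<omega>] by (intro mult_right_mono B) (auto simp: less_imp_le)
    also have "\<dots> = B * (decay s (X - m) * decay s (Y - w)) * (\<omega> (X, Y) * (decay L (X - m) * decay L (Y - w)))"
      by (simp add: decay_add mult_ac)
    also have "\<dots> \<le> B * (decay s (X - m) * decay s (Y - w)) * (C * \<omega> (m, w))"
      using B(1) by (intro mult_left_mono C) auto
    finally show ?thesis by (simp only: mult_ac)
  qed
  then show ?thesis using B C by (intro exI[of _ "B * C"]) auto
qed

text \<open>Freezing the weight at the centres cancels the coefficients and leaves a plain sum of
  bumps. The constant is chosen before the index set, the spacing and the points, which is what
  makes the comparison of exponents possible.\<close>

lemma test_symbol_upper:
  fixes \<Phi> :: "'a::euclidean_space \<times> 'a \<Rightarrow> complex"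
  assumes \<Phi>: "\<Phi> \<in> schwartz_space" and p: "0 < p" and q: "0 < q"
    and \<omega>: "\<omega> \<in> poly_moderate_weights" and \<theta>: "\<theta> \<in> poly_moderate_weights" "\<theta>' \<in> poly_moderate_weights"
    and eq: "\<And>X Y. \<omega> (X, Y) = \<theta> (X - Y) / \<theta>' (X + Y)"
  shows "\<exists>K>0. \<forall>I R e. \<forall>x y :: nat \<Rightarrow> 'a. finite I \<longrightarrow> I \<noteq> {} \<longrightarrow> 2 * real (card I) \<le> R \<longrightarrow> spread R I x y p q e \<longrightarrow>
    modulation_qnorm \<Phi> p q \<omega> (test_symbol \<theta> \<theta>' I x y) \<le> ennreal (K * card I powr e)"
proof -
  let ?D = "decay_mass TYPE('a \<times> 'a)"
  define s where "s = recip p + 2 * DIM('a \<times> 'a) * (recip p + recip q)"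
  have s0: "s \<ge> 0" unfolding s_def by (intro add_nonneg_nonneg mult_nonneg_nonneg) auto
  obtain A where A: "A > 0" "\<And>X Y m w. norm (symp_stft \<Phi> sgauss (X - m) (Y - w)) * \<omega> (X, Y) \<le> A * \<omega> (m, w) * (decay (s + 1) (X - m) * decay (s + 1) (Y - w))"
    using weighted_stft_decay[OF \<Phi> \<omega>, of "s + 1"] s0 by auto
  define K1 where "K1 = 2 * A * ?D powr recip p * ?D powr recip q"
  define K2 where "K2 = 2 * A * (2 * ?D) powr recip p * ?D powr recip q"
  have D: "?D > 0" using decay_mass_ge_1[where 'b="'a \<times> 'a"] by linarith
  have K: "K1 > 0" "K2 > 0" unfolding K1_def K2_def using A D by auto
  have "modulation_qnorm \<Phi> p q \<omega> (test_symbol \<theta> \<theta>' I x y) \<le> ennreal (max K1 K2 * card I powr e)"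
    if I: "finite I" "I \<noteq> {}" and R: "2 * real (card I) \<le> R" and sp: "spread R I x y p q e" for I R e and x y :: "nat \<Rightarrow> 'a"
  proof -
    let ?a = "test_symbol \<theta> \<theta>' I x y"
    let ?m = "\<lambda>i. atom_center (x i) (y i)" and ?w = "\<lambda>i. atom_offset (x i) (y i)"
    define H where "H X Y = norm (symp_stft \<Phi> ?a X Y * \<omega> (X, Y))" for X Y
    have meas: "mixed_measurable p H"
    proof (rule mixed_measurable_weight)
      show "continuous_on UNIV (\<lambda>p. symp_stft \<Phi> ?a (fst p) (snd p))"
        by (rule continuous_on_symp_stft[OF test_symbol_schwartz[OF I] \<Phi>])
      show "H X Y = norm (symp_stft \<Phi> ?a X Y) * \<bar>\<theta> (X - Y) / \<theta>' (X + Y)\<bar>" for X Y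
        unfolding H_def norm_mult eq norm_of_real ..
    qed (use \<theta> weight_measurable in auto)
    have bound: "H X Y \<le> A * (\<Sum>i\<in>I. decay (s + 1) (X - ?m i) * decay (s + 1) (Y - ?w i))" for X Y
    proof -
      let ?c = "\<lambda>i. \<theta>' (y i, 0) / \<theta> (x i, 0)"
      have c0: "?c i \<ge> 0" for i using weight_pos[OF \<theta>(1)] weight_pos[OF \<theta>(2)] by (simp add: less_imp_le)
      \<comment> \<open>The cancellation for which the coefficients were designed.\<close>
      have c\<omega>: "?c i * \<omega> (?m i, ?w i) = 1" for i
        using weight_pos[OF \<theta>(1), of "(x i, 0)"] weight_pos[OF \<theta>(2), of "(y i, 0)"]
        unfolding eq center_minus_offset center_plus_offset by simp
      have "symp_stft \<Phi> ?a X Y = (\<Sum>i\<in>I. complex_of_real (?c i) * symp_stft \<Phi> (atom (x i) (y i)) X Y)"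
        unfolding test_symbol_def by (rule symp_stft_sum[OF \<Phi> atom_schwartz])
      then have "norm (symp_stft \<Phi> ?a X Y) \<le> (\<Sum>i\<in>I. ?c i * norm (symp_stft \<Phi> sgauss (X - ?m i) (Y - ?w i)))"
        by (simp only: norm_mult norm_of_real abs_of_nonneg[OF c0] norm_symp_stft_atom[OF \<Phi>] order_refl sum_norm_le)
      then have "H X Y \<le> (\<Sum>i\<in>I. ?c i * norm (symp_stft \<Phi> sgauss (X - ?m i) (Y - ?w i))) * \<omega> (X, Y)"
        unfolding H_def norm_mult using weight_pos[OF \<omega>, of "(X, Y)"] by (simp add: mult_right_mono less_imp_le)
      also have "\<dots> = (\<Sum>i\<in>I. ?c i * (norm (symp_stft \<Phi> sgauss (X - ?m i) (Y - ?w i)) * \<omega> (X, Y)))"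
        by (simp add: sum_distrib_right mult.assoc)
      also have "\<dots> \<le> (\<Sum>i\<in>I. ?c i * (A * \<omega> (?m i, ?w i) * (decay (s + 1) (X - ?m i) * decay (s + 1) (Y - ?w i))))"
        by (intro sum_mono mult_left_mono A c0)
      also have "\<dots> = (\<Sum>i\<in>I. (?c i * \<omega> (?m i, ?w i)) * (A * (decay (s + 1) (X - ?m i) * decay (s + 1) (Y - ?w i))))"
        by (simp only: mult_ac)
      also have "\<dots> = A * (\<Sum>i\<in>I. decay (s + 1) (X - ?m i) * decay (s + 1) (Y - ?w i))"
        unfolding c\<omega> by (simp add: sum_distrib_left)
      finally show ?thesis .
    qed
    have A0: "A \<ge> 0" using A by simp
    note up = mixed_qnorm_upper_position[OF p q I A0 _ meas bound] mixed_qnorm_upper_frequency[OF p q I A0 _ meas bound]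
    have "mixed_qnorm p q H \<le> ennreal (max K1 K2 * card I powr e)"
      using sp
    proof (cases rule: spread_cases)
      case position
      have "mixed_qnorm p q H \<le> ennreal (K1 * card I powr recip p)"
        unfolding K1_def by (rule up(1)) (use position R s_def in force)+
      also have "\<dots> \<le> ennreal (max K1 K2 * card I powr e)"
        unfolding position(1) by (intro ennreal_leI mult_right_mono) auto
      finally show ?thesis .
    next
      case frequency
      have "mixed_qnorm p q H \<le> ennreal (K2 * card I powr recip q)"
        unfolding K2_def by (rule up(2)) (use frequency R s_def in force)+
      also have "\<dots> \<le> ennreal (max K1 K2 * card I powr e)"
        unfolding frequency(1) by (intro ennreal_leI mult_right_mono) auto
      finally show ?thesis .
    qed
    then show ?thesis unfolding modulation_qnorm_eq_mixed H_def[abs_def] .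
  qed
  then show ?thesis using K by (intro exI[of _ "max K1 K2"]) (auto simp: less_max_iff_disj)
qed

text \<open>The quotient of weights grows at most polynomially in |u - v|, and the Gaussian overlap
  beats it. Only the rate 1/R is recorded, since R can later be made proportional to the number of
  terms.\<close>

lemma cross_coefficient_bound:
  fixes \<theta> :: "'a::euclidean_space \<times> 'a \<Rightarrow> real"
  assumes \<theta>: "\<theta> \<in> poly_moderate_weights"
  shows "\<exists>C>0. \<forall>u v R. R > 0 \<longrightarrow> R \<le> norm (u - v) \<longrightarrow> exp (- (norm (u - v))\<^sup>2 / 4) * (\<theta> (u, 0) / \<theta> (v, 0)) \<le> C / R"
proof -
  obtain C L where C: "C > 0" "L \<ge> 0" "\<And>x y. \<theta> (x + y) * decay L y \<le> C * \<theta> x"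
    using poly_moderate_bound[OF \<theta>] by metis
  define M where "M = nat \<lceil>L\<rceil>"
  have M: "L \<le> real M" unfolding M_def by linarith
  \<comment> \<open>The bound of \<open>one_plus_power_exp_bound\<close> for c = 1/4 and power M +
    1; the additional power supplies the factor 1 / (1 + |u - v|).\<close>
  define E where "E = exp ((real (Suc M))\<^sup>2 / (4 * (1/4)))"
  have "exp (- (norm (u - v))\<^sup>2 / 4) * (\<theta> (u, 0) / \<theta> (v, 0)) \<le> C * E / R" if R: "R > 0" "R \<le> norm (u - v)" for u v R
  proof -
    let ?r = "norm (u - v)"
    have pos: "\<theta> (v, 0) > 0" "\<theta> (u, 0) > 0" using weight_pos[OF \<theta>] by auto
    have r: "1 + ?r > 0" using R by linarith
    have "\<theta> (u, 0) * decay (real M) (u - v, 0::'a) \<le> \<theta> (u, 0) * decay L (u - v, 0::'a)"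
      using pos M by (intro mult_left_mono decay_antimono) auto
    also have "\<dots> \<le> C * \<theta> (v, 0)" using C(3)[of "(v, 0)" "(u - v, 0)"] by simp
    finally have "\<theta> (u, 0) / (1 + ?r) ^ M \<le> C * \<theta> (v, 0)" by (simp add: decay_nat norm_Pair)
    then have *: "\<theta> (u, 0) / \<theta> (v, 0) \<le> C * (1 + ?r) ^ M"
      using pos r by (simp add: field_simps)
    have "exp (- ?r\<^sup>2 / 4) * (\<theta> (u, 0) / \<theta> (v, 0)) \<le> exp (- ?r\<^sup>2 / 4) * (C * (1 + ?r) ^ M)"
      by (intro mult_left_mono *) simp
    also have "\<dots> = C * ((1 + ?r) ^ Suc M * exp (- (1/4) * ?r\<^sup>2)) / (1 + ?r)"
      using r by simp
    also have "\<dots> \<le> C * E / (1 + ?r)"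
      using C(1) r one_plus_power_exp_bound[of ?r "1/4" "Suc M"] unfolding E_def
      by (intro divide_right_mono mult_left_mono) auto
    also have "\<dots> \<le> C * E / R"
      using R C(1) r by (intro divide_left_mono) (auto simp: E_def)
    finally show ?thesis .
  qed
  then show ?thesis using C(1) by (intro exI[of _ "C * E"]) (auto simp: E_def)
qed

lemma power_growth_exponent_le:
  fixes a b K :: real
  assumes "\<And>N::nat. N \<ge> 1 \<Longrightarrow> real N powr a \<le> K * real N powr b"
  shows "a \<le> b"
proof (rule ccontr)
  assume "\<not> a \<le> b"
  then have d: "a - b > 0" by simp
  obtain N :: nat where N: "real N > max 1 ((\<bar>K\<bar> + 1) powr (1 / (a - b)))"
    using reals_Archimedean2 by blast
  then have N1: "real N > 0" "N \<ge> 1" by auto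
  have "\<bar>K\<bar> + 1 = ((\<bar>K\<bar> + 1) powr (1 / (a - b))) powr (a - b)" using d by (simp add: powr_powr)
  also have "\<dots> < real N powr (a - b)" using N d by (intro powr_less_mono2) auto
  finally have "K < real N powr (a - b)" by linarith
  moreover have "real N powr (a - b) \<le> K"
    using assms[OF N1(2)] N1 by (simp add: powr_diff divide_le_eq)
  ultimately show False by simp
qed

text \<open>\<open>D\<close> indexes the main terms of a product of two test symbols; the remaining pairs give cross
  terms, which the Gaussian factor of the product makes small.\<close>
definition composable :: "real \<Rightarrow> nat set \<Rightarrow> nat set \<Rightarrow> (nat \<times> nat) set \<Rightarrow> (nat \<Rightarrow> 'a::euclidean_space) \<Rightarrow> (nat \<Rightarrow> 'a) \<Rightarrow> bool" where
  "composable R I J D y y' \<longleftrightarrow> finite I \<and> I \<noteq> {} \<and> finite J \<and> J \<noteq> {} \<and> D \<subseteq> I \<times> J \<and> D \<noteq> {} \<and>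
     (\<forall>(i, j)\<in>D. y i = y' j) \<and> (\<forall>(i, j)\<in>I \<times> J - D. R \<le> norm (y i - y' j))"

text \<open>Near the shifted centre of each main term the product is at least half of that term,
  since the remaining terms are small there. The main terms are normalised for
  \<open>\<omega>\<close>, because the middle weight \<open>\<theta>1\<close> cancels in
  them.\<close>

lemma product_lower:
  fixes \<Phi> :: "'a::euclidean_space \<times> 'a \<Rightarrow> complex"
    and \<theta>0 \<theta>1 \<theta>2 :: "'a \<times> 'a \<Rightarrow> real"
  assumes \<Phi>: "\<Phi> \<in> schwartz_space" "\<Phi> \<noteq> (\<lambda>_. 0)" and p: "0 < p" and q: "0 < q"
    and \<omega>: "\<omega> \<in> poly_moderate_weights"
    and \<theta>: "\<theta>0 \<in> poly_moderate_weights" "\<theta>1 \<in> poly_moderate_weights" "\<theta>2 \<in> poly_moderate_weights"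
    and eq: "\<And>X Y. \<omega> (X, Y) = \<theta>2 (X - Y) / \<theta>0 (X + Y)"
  shows "\<exists>k>0. \<exists>K0>0. \<forall>I J D R e. \<forall>x y y' z.
    composable R I J D y y' \<longrightarrow> K0 * (real (card I) * real (card J)) \<le> R \<longrightarrow>
    spread R D (\<lambda>d. x (fst d)) (\<lambda>d. z (snd d)) p q e \<longrightarrow>
    ennreal (k * card D powr e) \<le> modulation_qnorm \<Phi> p q \<omega> (test_symbol \<theta>2 \<theta>1 I x y #\<^sub>w test_symbol \<theta>1 \<theta>0 J y' z)"
proof -
  obtain X0 Y0 :: "'a \<times> 'a" and \<delta> c where \<delta>: "\<delta> > 0" and c: "c > 0"
    and V0: "\<And>X Y. X \<in> ball X0 \<delta> \<Longrightarrow> Y \<in> ball Y0 \<delta> \<Longrightarrow> c \<le> norm (symp_stft \<Phi> sgauss X Y)"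
  proof -
    have nz: "sgauss Z \<noteq> 0" for Z :: "'a \<times> 'a" by (simp add: gaussian_wave_def)
    show ?thesis using symp_stft_lower_bound[OF sgauss_schwartz \<Phi>(1) nz \<Phi>(2)] that by blast
  qed
  obtain A where A: "A > 0" "\<And>X Y m w. norm (symp_stft \<Phi> sgauss (X - m) (Y - w)) * \<omega> (X, Y) \<le> A * \<omega> (m, w) * (decay 1 (X - m) * decay 1 (Y - w))"
    using weighted_stft_decay[OF \<Phi>(1) \<omega>, of 1] by auto
  obtain C L where C: "C > 0" "L \<ge> 0"
    "\<And>X Y m w. \<omega> (m, w) * (decay L (X - m) * decay L (Y - w)) \<le> C * \<omega> (X, Y)"
    using poly_moderate_bound_Pair[OF \<omega>] by metis
  obtain C3 where C3: "C3 > 0" "\<And>u v R. R > 0 \<Longrightarrow> R \<le> norm (u - v) \<Longrightarrow> exp (- (norm (u - v))\<^sup>2 / 4) * (\<theta>1 (u, 0) / \<theta>1 (v, 0)) \<le> C3 / R"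
    using cross_coefficient_bound[OF \<theta>(2)] by blast
  \<comment> \<open>Points of the shifted balls lie within B of the centre of their atom, in
    position and in frequency. Accordingly, \<open>\<beta>\<close> bounds below the factor
    \<open>decay L\<close> that limits the variation of the weight there.\<close>
  define B where "B = norm X0 + norm Y0 + \<delta>"
  have B0: "B > 0" unfolding B_def using \<delta> by (simp add: add_nonneg_pos)
  define \<beta> where "\<beta> = (1 + B) powr (- L)"
  have \<beta>: "\<beta> > 0" unfolding \<beta>_def using B0 by simp
  have decay_B: "\<beta> \<le> decay L Z" if "norm Z \<le> B" for Z :: "'a \<times> 'a"
    unfolding \<beta>_def decay_def using that C(2) one_plus_norm_pos[of Z] by (intro powr_mono2') auto
  define \<kappa> :: real where "\<kappa> = (1/2) ^ DIM('a)"
  have \<kappa>: "\<kappa> > 0" by (simp add: \<kappa>_def)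
  \<comment> \<open>Height of a main term apart from \<open>\<kappa>\<close>: the transform is at
    least c, and moderateness loses at most the factor \<open>\<beta>\<^sup>2 / C\<close>.\<close>
  define a1 where "a1 = c * \<beta>\<^sup>2 / C"
  have a1: "a1 > 0" unfolding a1_def using c \<beta> C by simp
  \<comment> \<open>From R >= K0 |I||J| three things are needed: R >= 2B, so that a point near one
    main centre stays R/2 away from the others; R >= 2 \<open>\<delta>\<close>, for disjoint balls;
    and a total of the unwanted terms of at most half a main term.\<close>
  define K0 where "K0 = 1 + 2 * B + 2 * \<delta> + 2 * A * (C3 + 2) / a1"
  have K0_parts: "2 * A * (C3 + 2) / a1 > 0" using A C3 a1 by simp
  have K0: "K0 \<ge> 2 * A * (C3 + 2) / a1" "K0 \<ge> 2 * B" "K0 \<ge> 2 * \<delta>" "K0 > 0"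
    unfolding K0_def using K0_parts B0 \<delta> by linarith+
  let ?V = "measure lborel (ball (0::'a \<times> 'a) \<delta>)"
  define k where "k = (\<kappa> * a1 / 2) * ?V powr recip p * ?V powr recip q"
  have V: "?V > 0" by (rule measure_ball_pos[OF \<delta>])
  have k: "k > 0" unfolding k_def using \<kappa> a1 V by simp
  have "ennreal (k * card D powr e) \<le> modulation_qnorm \<Phi> p q \<omega> (test_symbol \<theta>2 \<theta>1 I x y #\<^sub>w test_symbol \<theta>1 \<theta>0 J y' z)"
    if comp: "composable R I J D y y'" and R: "K0 * (real (card I) * real (card J)) \<le> R"
      and sp: "spread R D (\<lambda>d. x (fst d)) (\<lambda>d. z (snd d)) p q e"
    for I J D R e and x y y' z :: "nat \<Rightarrow> 'a"
  proof -
    have I: "finite I" "I \<noteq> {}" and J: "finite J" "J \<noteq> {}" and D: "D \<subseteq> I \<times> J" "D \<noteq> {}"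
      and yD: "\<forall>(i, j)\<in>D. y i = y' j" and yR: "\<forall>(i, j)\<in>I \<times> J - D. R \<le> norm (y i - y' j)"
      using comp by (auto simp: composable_def)
    let ?P = "I \<times> J"
    let ?m = "\<lambda>d. atom_center (x (fst d)) (z (snd d))" and ?w = "\<lambda>d. atom_offset (x (fst d)) (z (snd d))"
    have P: "finite ?P" using I J by simp
    have finD: "finite D" using D(1) P by (rule finite_subset)
    have "card ?P > 0" using I J by (simp add: card_gt_0_iff del: card_cartesian_product)
    then have cardP: "real (card ?P) \<ge> 1" by linarith
    have R': "K0 * real (card ?P) \<le> R" using R by (simp add: card_cartesian_product)
    have "K0 * 1 \<le> K0 * real (card ?P)" using K0 cardP by (intro mult_left_mono) auto
    then have R1: "R \<ge> K0" using R' by linarith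
    then have R0: "R > 0" "R \<ge> 2 * B" "R \<ge> 2 * \<delta>" using K0 by linarith+
    \<comment> \<open>The coefficient of one pair in the product. \<open>\<theta>1\<close> enters
      through the numerator of the first factor and the denominator of the second, so it cancels
      where y = y'.\<close>
    define b where "b d = \<theta>1 (y (fst d), 0) / \<theta>2 (x (fst d), 0) * (\<theta>0 (z (snd d), 0) / \<theta>1 (y' (snd d), 0)) * (\<kappa> * exp (- (norm (y (fst d) - y' (snd d)))\<^sup>2 / 4))" for d
    have b0: "b d \<ge> 0" for d
      unfolding b_def using \<kappa> weight_pos[OF \<theta>(1)] weight_pos[OF \<theta>(2)] weight_pos[OF \<theta>(3)]
      by (intro mult_nonneg_nonneg divide_nonneg_nonneg) (auto simp: less_imp_le)
    have b\<omega>: "b d * \<omega> (?m d, ?w d) = \<kappa> * (exp (- (norm (y (fst d) - y' (snd d)))\<^sup>2 / 4) * (\<theta>1 (y (fst d), 0) / \<theta>1 (y' (snd d), 0)))" for d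
      using weight_pos[OF \<theta>(1), of "(z (snd d), 0)"] weight_pos[OF \<theta>(2), of "(y' (snd d), 0)"] weight_pos[OF \<theta>(3), of "(x (fst d), 0)"]
      unfolding eq center_minus_offset center_plus_offset b_def by (simp add: field_simps)
    have b\<omega>D: "b d * \<omega> (?m d, ?w d) = \<kappa>" if "d \<in> D" for d
    proof -
      have "y (fst d) = y' (snd d)" using yD that by (auto simp: split_beta)
      then show ?thesis unfolding b\<omega> using weight_pos[OF \<theta>(2), of "(y' (snd d), 0)"] by simp
    qed
    let ?ab = "test_symbol \<theta>2 \<theta>1 I x y #\<^sub>w test_symbol \<theta>1 \<theta>0 J y' z"
    have ab: "?ab = (\<lambda>Z. \<Sum>d\<in>?P. complex_of_real (b d) * atom (x (fst d)) (z (snd d)) Z)"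
      unfolding test_symbol_def weyl_product_atoms[OF I J] b_def \<kappa>_def split_beta of_real_mult ..
    have stft_ab: "symp_stft \<Phi> ?ab X Y = (\<Sum>d\<in>?P. complex_of_real (b d) * symp_stft \<Phi> (atom (x (fst d)) (z (snd d))) X Y)" for X Y
      unfolding ab by (rule symp_stft_sum[OF \<Phi>(1) atom_schwartz])
    define F where "F d X Y = b d * (norm (symp_stft \<Phi> sgauss (X - ?m d) (Y - ?w d)) * \<omega> (X, Y))" for d X Y
    have F_le: "F d X Y \<le> (b d * \<omega> (?m d, ?w d)) * (A * (decay 1 (X - ?m d) * decay 1 (Y - ?w d)))" for d X Y
      unfolding F_def using mult_left_mono[OF A(2)[of X "?m d" Y "?w d"] b0[of d]] by (simp add: mult_ac)
    have sep: "R \<le> norm (?m d - ?m d') \<or> R \<le> norm (?w d - ?w d')" if "d \<in> D" "d' \<in> D" "d \<noteq> d'" for d d'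
      using sp by (cases rule: spread_cases) (use that in blast)+
    have lower: "\<kappa> * a1 / 2 \<le> norm (symp_stft \<Phi> ?ab X Y * \<omega> (X, Y))"
      if d: "d \<in> D" and X: "X \<in> ball (?m d + X0) \<delta>" and Y: "Y \<in> ball (?w d + Y0) \<delta>" for d X Y
    proof -
      have dP: "d \<in> ?P" using d D by blast
      have X': "X - ?m d \<in> ball X0 \<delta>" and Y': "Y - ?w d \<in> ball Y0 \<delta>"
        using X Y by (auto simp: dist_norm algebra_simps)
      have "norm (X - ?m d) \<le> norm X0 + norm (X0 - (X - ?m d))" "norm (Y - ?w d) \<le> norm Y0 + norm (Y0 - (Y - ?w d))"
        by (metis norm_minus_commute norm_triangle_sub)+
      then have XB: "norm (X - ?m d) \<le> B" and YB: "norm (Y - ?w d) \<le> B"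
        using X' Y' norm_ge_zero[of X0] norm_ge_zero[of Y0] unfolding B_def mem_ball dist_norm by linarith+
      have main: "\<kappa> * a1 \<le> F d X Y"
      proof -
        have "\<omega> (?m d, ?w d) * (\<beta> * \<beta>) \<le> \<omega> (?m d, ?w d) * (decay L (X - ?m d) * decay L (Y - ?w d))"
          using decay_B[OF XB] decay_B[OF YB] \<beta> weight_pos[OF \<omega>, of "(?m d, ?w d)"] by (intro mult_left_mono mult_mono) auto
        also have "\<dots> \<le> C * \<omega> (X, Y)" by (rule C)
        finally have w: "\<omega> (?m d, ?w d) * \<beta>\<^sup>2 / C \<le> \<omega> (X, Y)" using C(1) by (simp add: power2_eq_square divide_le_eq mult.commute)
        have "\<kappa> * a1 = b d * (c * (\<omega> (?m d, ?w d) * \<beta>\<^sup>2 / C))"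
          unfolding b\<omega>D[OF d, symmetric] a1_def by simp
        also have "\<dots> \<le> F d X Y"
          unfolding F_def using V0[OF X' Y'] w c C(1) \<beta> weight_pos[OF \<omega>, of "(?m d, ?w d)"]
          by (intro mult_left_mono mult_mono b0) auto
        finally show ?thesis .
      qed
      \<comment> \<open>There are two causes of smallness. Another main term has full size but its
        centre is at distance at least R/2; a pair outside \<open>D\<close> may be centred nearby
        but has a small coefficient. The constant C3 + 2 covers both.\<close>
      have other: "F d' X Y \<le> \<kappa> * A * (C3 + 2) / R" if d': "d' \<in> ?P - {d}" for d'
      proof (cases "d' \<in> D")
        case True
        have far: "decay 1 Z \<le> 2 / R" if "R / 2 \<le> norm Z" for Z :: "'a \<times> 'a"
        proof -
          have "decay 1 Z = 1 / (1 + norm Z)" using decay_nat[of 1 Z] by simp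
          also have "\<dots> \<le> 1 / (R / 2)" using that R0 by (intro divide_left_mono) (auto intro!: mult_pos_pos add_pos_nonneg)
          finally show ?thesis by simp
        qed
        have "R \<le> norm (?m d - ?m d') \<or> R \<le> norm (?w d - ?w d')" using sep[OF d True] d' by auto
        moreover have "norm (?m d - ?m d') \<le> norm (X - ?m d) + norm (X - ?m d')" "norm (?w d - ?w d') \<le> norm (Y - ?w d) + norm (Y - ?w d')"
          by (metis dist_norm dist_triangle3)+
        ultimately have "R / 2 \<le> norm (X - ?m d') \<or> R / 2 \<le> norm (Y - ?w d')" using XB YB R0 by linarith
        moreover have "decay 1 (X - ?m d') * decay 1 (Y - ?w d') \<le> decay 1 (X - ?m d')"
          "decay 1 (X - ?m d') * decay 1 (Y - ?w d') \<le> decay 1 (Y - ?w d')"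
          by (intro mult_left_le mult_left_le_one_le decay_le_1; simp)+
        ultimately have "decay 1 (X - ?m d') * decay 1 (Y - ?w d') \<le> 2 / R"
          by (meson far order_trans)
        then have "\<kappa> * (A * (decay 1 (X - ?m d') * decay 1 (Y - ?w d'))) \<le> \<kappa> * (A * (2 / R))"
          using \<kappa> A by (intro mult_left_mono) auto
        also have "\<dots> \<le> \<kappa> * A * (C3 + 2) / R"
          using \<kappa> A C3 R0 by (simp add: field_simps)
        finally show ?thesis using F_le[of d' X Y] unfolding b\<omega>D[OF True] by linarith
      next
        case False
        have "R \<le> norm (y (fst d') - y' (snd d'))" using yR d' False by (auto simp: split_beta)
        from C3(2)[OF R0(1) this]
        have "b d' * \<omega> (?m d', ?w d') \<le> \<kappa> * (C3 / R)" unfolding b\<omega> using \<kappa> by (intro mult_left_mono) auto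
        moreover have "A * (decay 1 (X - ?m d') * decay 1 (Y - ?w d')) \<le> A * 1"
          using A by (intro mult_left_mono mult_le_one decay_le_1) auto
        ultimately have "(b d' * \<omega> (?m d', ?w d')) * (A * (decay 1 (X - ?m d') * decay 1 (Y - ?w d'))) \<le> (\<kappa> * (C3 / R)) * (A * 1)"
          by (rule mult_mono) (use \<kappa> C3(1) R0(1) A(1) in simp_all)
        also have "\<dots> \<le> \<kappa> * A * (C3 + 2) / R"
          using \<kappa> A C3 R0 by (simp add: field_simps)
        finally show ?thesis using F_le[of d' X Y] by linarith
      qed
      have "(\<Sum>d'\<in>?P - {d}. F d' X Y) \<le> (\<Sum>d'\<in>?P - {d}. \<kappa> * A * (C3 + 2) / R)"
        by (intro sum_mono other)
      also have "\<dots> \<le> (\<Sum>d'\<in>?P. \<kappa> * A * (C3 + 2) / R)"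
        using P \<kappa> A C3 R0 by (intro sum_mono2) auto
      also have "\<dots> = \<kappa> * (A * (C3 + 2) * real (card ?P) / R)" by simp
      also have "\<dots> \<le> \<kappa> * (a1 / 2)"
      proof (intro mult_left_mono)
        have "2 * A * (C3 + 2) / a1 * real (card ?P) \<le> K0 * real (card ?P)" using K0 by (intro mult_right_mono) auto
        then have "2 * A * (C3 + 2) / a1 * real (card ?P) \<le> R" using R' by linarith
        then show "A * (C3 + 2) * real (card ?P) / R \<le> a1 / 2" using a1 R0 by (simp add: field_simps)
      qed (use \<kappa> in simp)
      finally have others: "(\<Sum>d'\<in>?P - {d}. F d' X Y) \<le> \<kappa> * a1 / 2" by simp
      let ?v = "\<lambda>d. complex_of_real (b d) * symp_stft \<Phi> (atom (x (fst d)) (z (snd d))) X Y"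
      have nv: "norm (?v d') * \<omega> (X, Y) = F d' X Y" for d'
        by (simp only: F_def norm_mult norm_of_real abs_of_nonneg[OF b0] norm_symp_stft_atom[OF \<Phi>(1)] mult.assoc)
      have "norm (?v d) \<le> norm (\<Sum>d'\<in>?P. ?v d') + (\<Sum>d'\<in>?P - {d}. norm (?v d'))"
      proof -
        have "?v d = (\<Sum>d'\<in>?P. ?v d') - (\<Sum>d'\<in>?P - {d}. ?v d')"
          unfolding sum.remove[OF P dP, of ?v] by simp
        then have "norm (?v d) \<le> norm (\<Sum>d'\<in>?P. ?v d') + norm (\<Sum>d'\<in>?P - {d}. ?v d')"
          by (simp only: norm_triangle_ineq4)
        then show ?thesis using norm_sum[of ?v "?P - {d}"] by linarith
      qed
      then have "norm (?v d) * \<omega> (X, Y) \<le> (norm (\<Sum>d'\<in>?P. ?v d') + (\<Sum>d'\<in>?P - {d}. norm (?v d'))) * \<omega> (X, Y)"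
        using weight_pos[OF \<omega>, of "(X, Y)"] by (intro mult_right_mono) auto
      then have "F d X Y \<le> norm (symp_stft \<Phi> ?ab X Y) * \<omega> (X, Y) + (\<Sum>d'\<in>?P - {d}. F d' X Y)"
        by (simp only: distrib_right sum_distrib_right nv stft_ab)
      then have "\<kappa> * a1 / 2 \<le> norm (symp_stft \<Phi> ?ab X Y) * \<omega> (X, Y)" using main others by linarith
      then show ?thesis using weight_pos[OF \<omega>, of "(X, Y)"] by (simp add: norm_mult)
    qed
    have a0: "\<kappa> * a1 / 2 \<ge> 0" using \<kappa> a1 by simp
    define H where "H X Y = norm (symp_stft \<Phi> ?ab X Y * \<omega> (X, Y))" for X Y
    have low: "\<kappa> * a1 / 2 \<le> H X Y" if "d \<in> D" "X \<in> ball (?m d + X0) \<delta>" "Y \<in> ball (?w d + Y0) \<delta>" for d X Y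
      unfolding H_def using lower that by blast
    note lw = mixed_qnorm_lower_position[OF p q finD D(2) a0 \<delta> low] mixed_qnorm_lower_frequency[OF p q finD D(2) a0 \<delta> low]
    have "ennreal (k * card D powr e) \<le> mixed_qnorm p q H"
      using sp
    proof (cases rule: spread_cases)
      case position
      show ?thesis
        unfolding k_def position(1)
      proof (rule lw(1)[where ?w0.0 = Y0])
        show "2 * \<delta> \<le> norm (?m i + X0 - (?m j + X0))" if "i \<in> D" "j \<in> D" "i \<noteq> j" for i j
          using position(3)[OF that] R0 by simp
        show "?w i + Y0 = Y0" if "i \<in> D" for i using position(2)[OF that] by simp
      qed
    next
      case frequency
      show ?thesis
        unfolding k_def frequency(1)
      proof (rule lw(2))
        show "2 * \<delta> \<le> norm (?w i + Y0 - (?w j + Y0))" if "i \<in> D" "j \<in> D" "i \<noteq> j" for i j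
          using frequency(2)[OF that] R0 by simp
      qed
    qed
    then show ?thesis unfolding modulation_qnorm_eq_mixed H_def[abs_def] .
  qed
  then show ?thesis using k K0(4) by blast
qed

text \<open>Inserting the test symbols into the assumed continuity eliminates symbols, weights and
  window. What remains is an inequality between cardinalities for every admissible configuration of
  points.\<close>

lemma weyl_product_test_inequality:
  fixes \<Phi> :: "'a::euclidean_space \<times> 'a \<Rightarrow> complex"
    and \<theta>0 \<theta>1 \<theta>2 :: "'a \<times> 'a \<Rightarrow> real"
  assumes \<Phi>: "\<Phi> \<in> schwartz_space" "\<Phi> \<noteq> (\<lambda>_. 0)"
    and pos: "0 < p0" "0 < p1" "0 < p2" "0 < q0" "0 < q1" "0 < q2"
    and \<theta>: "\<theta>0 \<in> poly_moderate_weights" "\<theta>1 \<in> poly_moderate_weights" "\<theta>2 \<in> poly_moderate_weights"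
    and \<omega>: "\<omega>0 \<in> poly_moderate_weights" "\<omega>1 \<in> poly_moderate_weights" "\<omega>2 \<in> poly_moderate_weights"
    and eq: "\<And>X Y. \<omega>0 (X, Y) = \<theta>2 (X - Y) / \<theta>0 (X + Y)"
      "\<And>X Y. \<omega>1 (X, Y) = \<theta>2 (X - Y) / \<theta>1 (X + Y)"
      "\<And>X Y. \<omega>2 (X, Y) = \<theta>1 (X - Y) / \<theta>0 (X + Y)"
    and bound: "\<exists>C::real>0. \<forall>a\<in>schwartz_space. \<forall>b\<in>schwartz_space.
      modulation_qnorm \<Phi> p0 q0 \<omega>0 (a #\<^sub>w b)
        \<le> ennreal C * modulation_qnorm \<Phi> p1 q1 \<omega>1 a * modulation_qnorm \<Phi> p2 q2 \<omega>2 b"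
  shows "\<exists>K K0. K0 > 0 \<and> (\<forall>I J D R e0 e1 e2. \<forall>x y y' z :: nat \<Rightarrow> 'a.
    composable R I J D y y' \<longrightarrow> K0 * (real (card I) * real (card J)) \<le> R \<longrightarrow>
    spread R D (\<lambda>d. x (fst d)) (\<lambda>d. z (snd d)) p0 q0 e0 \<longrightarrow>
    spread R I x y p1 q1 e1 \<longrightarrow> spread R J y' z p2 q2 e2 \<longrightarrow>
    real (card D) powr e0 \<le> K * (real (card I) powr e1 * real (card J) powr e2))"
proof -
  obtain C where C: "C > 0" "\<And>a b. a \<in> schwartz_space \<Longrightarrow> b \<in> schwartz_space \<Longrightarrow>
      modulation_qnorm \<Phi> p0 q0 \<omega>0 (a #\<^sub>w b)
        \<le> ennreal C * modulation_qnorm \<Phi> p1 q1 \<omega>1 a * modulation_qnorm \<Phi> p2 q2 \<omega>2 b"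
    using bound by blast
  obtain K1 where K1: "K1 > 0" "\<And>I R e. \<And>x y :: nat \<Rightarrow> 'a. finite I \<Longrightarrow> I \<noteq> {} \<Longrightarrow> 2 * real (card I) \<le> R \<Longrightarrow> spread R I x y p1 q1 e \<Longrightarrow>
    modulation_qnorm \<Phi> p1 q1 \<omega>1 (test_symbol \<theta>2 \<theta>1 I x y) \<le> ennreal (K1 * card I powr e)"
    using test_symbol_upper[OF \<Phi>(1) pos(2,5) \<omega>(2) \<theta>(3,2) eq(2)] by blast
  obtain K2 where K2: "K2 > 0" "\<And>I R e. \<And>x y :: nat \<Rightarrow> 'a. finite I \<Longrightarrow> I \<noteq> {} \<Longrightarrow> 2 * real (card I) \<le> R \<Longrightarrow> spread R I x y p2 q2 e \<Longrightarrow>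
    modulation_qnorm \<Phi> p2 q2 \<omega>2 (test_symbol \<theta>1 \<theta>0 I x y) \<le> ennreal (K2 * card I powr e)"
    using test_symbol_upper[OF \<Phi>(1) pos(3,6) \<omega>(3) \<theta>(2,1) eq(3)] by blast
  obtain k K0 where k: "k > 0" "K0 > 0"
    and low: "\<And>I J D R e x y y' z.
    composable R I J D y y' \<Longrightarrow> K0 * (real (card I) * real (card J)) \<le> R \<Longrightarrow>
    spread R D (\<lambda>d. x (fst d)) (\<lambda>d. z (snd d)) p0 q0 e \<Longrightarrow>
    ennreal (k * card D powr e) \<le> modulation_qnorm \<Phi> p0 q0 \<omega>0 (test_symbol \<theta>2 \<theta>1 I x y #\<^sub>w test_symbol \<theta>1 \<theta>0 J y' z)"
    using product_lower[OF \<Phi> pos(1,4) \<omega>(1) \<theta> eq(1)] by blast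
  show ?thesis
  proof (intro exI conjI allI impI)
    \<comment> \<open>The extra 2 provides the spacing, at least twice the number of atoms, that the
      upper bounds for the two factors require.\<close>
    show "K0 + 2 > 0" using k by simp
    fix I J D R e0 e1 e2 and x y y' z :: "nat \<Rightarrow> 'a"
    assume comp: "composable R I J D y y'" and R: "(K0 + 2) * (real (card I) * real (card J)) \<le> R"
      and sp: "spread R D (\<lambda>d. x (fst d)) (\<lambda>d. z (snd d)) p0 q0 e0" "spread R I x y p1 q1 e1" "spread R J y' z p2 q2 e2"
    have I: "finite I" "I \<noteq> {}" and J: "finite J" "J \<noteq> {}"
      using comp by (auto simp: composable_def)
    have c: "real (card I) \<ge> 1" "real (card J) \<ge> 1" using I J by (simp_all add: Suc_le_eq card_gt_0_iff)
    have cc: "real (card I) \<le> real (card I) * real (card J)" "real (card J) \<le> real (card I) * real (card J)"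
      using c mult_left_mono[OF c(2), of "real (card I)"] mult_right_mono[OF c(1), of "real (card J)"] by auto
    have RR: "K0 * (real (card I) * real (card J)) + 2 * (real (card I) * real (card J)) \<le> R"
      using R by (simp add: distrib_right)
    have KI: "0 \<le> K0 * (real (card I) * real (card J))" using k by simp
    have R0: "K0 * (real (card I) * real (card J)) \<le> R" and R1: "2 * real (card I) \<le> R" and R2: "2 * real (card J) \<le> R"
      using RR KI cc c by linarith+
    let ?a = "test_symbol \<theta>2 \<theta>1 I x y" and ?b = "test_symbol \<theta>1 \<theta>0 J y' z"
    have "ennreal (k * card D powr e0) \<le> modulation_qnorm \<Phi> p0 q0 \<omega>0 (?a #\<^sub>w ?b)"
      by (rule low[OF comp R0 sp(1)])
    also have "\<dots> \<le> ennreal C * modulation_qnorm \<Phi> p1 q1 \<omega>1 ?a * modulation_qnorm \<Phi> p2 q2 \<omega>2 ?b"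
      by (rule C(2)[OF test_symbol_schwartz[OF I] test_symbol_schwartz[OF J]])
    also have "\<dots> \<le> ennreal C * ennreal (K1 * card I powr e1) * ennreal (K2 * card J powr e2)"
      by (intro mult_mono K1(2)[OF I R1 sp(2)] K2(2)[OF J R2 sp(3)]) auto
    also have "\<dots> = ennreal (C * (K1 * card I powr e1) * (K2 * card J powr e2))"
      using C(1) K1(1) K2(1) by (simp add: ennreal_mult)
    finally have "k * card D powr e0 \<le> C * (K1 * card I powr e1) * (K2 * card J powr e2)"
      using C(1) K1(1) K2(1) by (subst (asm) ennreal_le_iff) auto
    then show "real (card D) powr e0 \<le> C * K1 * K2 / k * (real (card I) powr e1 * real (card J) powr e2)"
      using k by (simp add: field_simps)
  qed
qed

section \<open>The four inequalities\<close>

lemma ennreal_one_divide_recip: "0 < p \<Longrightarrow> 1 / p = ennreal (recip p)"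
proof (cases "p = \<infinity>")
  case False
  assume "0 < p"
  note r = recip_pos[OF this False]
  then show ?thesis
    by (metis divide_ennreal ennreal_1 zero_le_one)
qed simp

lemma le_of_recip_le:
  assumes "0 < p" "0 < q" "recip p \<le> recip q"
  shows "q \<le> p"
proof (cases "p = \<infinity>")
  case False
  note r = recip_pos[OF assms(1) False]
  have "recip p > 0" using r by simp
  then have q: "q \<noteq> \<infinity>" using assms(3) by auto
  note r' = recip_pos[OF assms(2) q]
  have "enn2real q \<le> enn2real p"
    using assms(3) r r' by (simp add: field_simps)
  then show ?thesis using r(3) r'(3) by (metis ennreal_leI)
qed simp

theorem theorem4p3:
  fixes p0 p1 p2 q0 q1 q2 :: ennreal
    and \<theta>0 \<theta>1 \<theta>2 :: "(real ^ 'n) \<times> (real ^ 'n) \<Rightarrow> real"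
    and \<omega>0 \<omega>1 \<omega>2 :: "((real ^ 'n) \<times> (real ^ 'n)) \<times> ((real ^ 'n) \<times> (real ^ 'n)) \<Rightarrow> real"
    and \<Phi> :: "(real ^ 'n) \<times> (real ^ 'n) \<Rightarrow> complex"
  assumes "0 < p0" "0 < p1" "0 < p2" "0 < q0" "0 < q1" "0 < q2"
    and "\<theta>0 \<in> poly_moderate_weights" "\<theta>1 \<in> poly_moderate_weights"
      "\<theta>2 \<in> poly_moderate_weights"
    and "\<omega>0 \<in> poly_moderate_weights" "\<omega>1 \<in> poly_moderate_weights"
      "\<omega>2 \<in> poly_moderate_weights"
    and "\<And>X Y. \<omega>0 (X, Y) = \<theta>2 (X - Y) / \<theta>0 (X + Y)"
    and "\<And>X Y. \<omega>1 (X, Y) = \<theta>2 (X - Y) / \<theta>1 (X + Y)"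
    and "\<And>X Y. \<omega>2 (X, Y) = \<theta>1 (X - Y) / \<theta>0 (X + Y)"
    and "\<Phi> \<in> gelfand_shilov_half" "\<Phi> \<noteq> (\<lambda>_. 0)"
    and "\<exists>C::real>0. \<forall>a\<in>schwartz_space. \<forall>b\<in>schwartz_space.
      modulation_qnorm \<Phi> p0 q0 \<omega>0 (a #\<^sub>w b)
        \<le> ennreal C * modulation_qnorm \<Phi> p1 q1 \<omega>1 a * modulation_qnorm \<Phi> p2 q2 \<omega>2 b"
  shows "1 / p0 \<le> 1 / p1 + 1 / p2 \<and> 1 / p0 \<le> 1 / q1 + 1 / q2 \<and> q1 \<le> q0 \<and> q2 \<le> q0"
proof -
  have \<Phi>: "\<Phi> \<in> schwartz_space" using gelfand_shilov_subset_schwartz \<open>\<Phi> \<in> gelfand_shilov_half\<close> by blast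
  obtain K K0 where K0: "K0 > 0" and test: "\<And>I J D R e0 e1 e2. \<And>x y y' z :: nat \<Rightarrow> real ^ 'n.
    composable R I J D y y' \<Longrightarrow> K0 * (real (card I) * real (card J)) \<le> R \<Longrightarrow>
    spread R D (\<lambda>d. x (fst d)) (\<lambda>d. z (snd d)) p0 q0 e0 \<Longrightarrow>
    spread R I x y p1 q1 e1 \<Longrightarrow> spread R J y' z p2 q2 e2 \<Longrightarrow>
    real (card D) powr e0 \<le> K * (real (card I) powr e1 * real (card J) powr e2)"
    using weyl_product_test_inequality[OF \<Phi> \<open>\<Phi> \<noteq> (\<lambda>_. 0)\<close> assms(1-15) assms(18)] by blast
  obtain u :: "real ^ 'n" where u: "norm u = 1"
    using vector_choose_size[of 1] by auto
  \<comment> \<open>Equally spaced points on a line. The spacing R will depend on N, but K and K0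
    are already fixed.\<close>
  define t :: "real \<Rightarrow> nat \<Rightarrow> real ^ 'n" where "t R i = (R * real i) *\<^sub>R u" for R i
  have t: "R \<le> norm (t R i - t R j)" if "R > 0" "i \<noteq> j" for R i j
  proof -
    have "t R i - t R j = (R * (real i - real j)) *\<^sub>R u"
      by (simp add: t_def algebra_simps)
    then have "norm (t R i - t R j) = R * \<bar>real i - real j\<bar>"
      using that u by (simp add: abs_mult)
    moreover have "1 \<le> \<bar>real i - real j\<bar>" using \<open>i \<noteq> j\<close> by linarith
    ultimately show ?thesis using mult_left_mono[of 1 "\<bar>real i - real j\<bar>" R] that by simp
  qed
  have t2: "2 * R \<le> norm (2 *\<^sub>R (t R i - t R j))" if "R > 0" "i \<noteq> j" for R i j
    using t[OF that] by simp
  define diag where "diag N = (\<lambda>i. (i, i)) ` {..<N}" for N :: nat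
  have in_diag: "(i, j) \<in> diag N \<longleftrightarrow> i = j \<and> i < N" for i j N
    by (auto simp: diag_def)
  have diag_ne: "diag N \<noteq> {}" if "N \<ge> 1" for N
    using in_diag[of 0 0 N] that by auto
  have card_diag: "card (diag N) = N" for N
    unfolding diag_def by (subst card_image) (auto simp: inj_on_def)
  have R_pos: "K0 * (real N * real M) > 0" if "N \<ge> 1" "M \<ge> 1" for N M :: nat using that K0 by simp
  \<comment> \<open>All three sums are diagonal, so each contributes its position exponent; pairs of
    different indices are the cross terms.\<close>
  have "recip p0 \<le> recip p1 + recip p2"
  proof (rule power_growth_exponent_le)
    fix N :: nat assume N: "N \<ge> 1"
    define R where "R = K0 * (real N * real N)"
    have R: "R > 0" unfolding R_def by (rule R_pos[OF N N])
    have "real (card (diag N)) powr recip p0 \<le> K * (real (card {..<N}) powr recip p1 * real (card {..<N}) powr recip p2)"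
    proof (rule test[where R = R and x = "t R" and y = "t R" and y' = "t R" and z = "t R"])
      show "composable R {..<N} {..<N} (diag N) (t R) (t R)"
        using N diag_ne[OF N] t[OF R] by (auto simp: composable_def in_diag lessThan_empty_iff)
      show "spread R (diag N) (\<lambda>d. t R (fst d)) (\<lambda>d. t R (snd d)) p0 q0 (recip p0)"
        by (rule spread_positionI, force simp: in_diag, rule t[OF R], force simp: in_diag)
      show "spread R {..<N} (t R) (t R) p1 q1 (recip p1)"
        by (rule spread_positionI, rule refl, rule t[OF R])
      show "spread R {..<N} (t R) (t R) p2 q2 (recip p2)"
        by (rule spread_positionI, rule refl, rule t[OF R])
    qed (simp add: R_def)
    then show "real N powr recip p0 \<le> K * real N powr (recip p1 + recip p2)"
      by (simp add: card_diag powr_add)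
  qed
  \<comment> \<open>The first factor takes the state at -x_i to the one at x_i, the second goes
    back. Their offsets are separated in frequency while the product is diagonal, so q1 and q2 face
    p0.\<close>
  moreover have "recip p0 \<le> recip q1 + recip q2"
  proof (rule power_growth_exponent_le)
    fix N :: nat assume N: "N \<ge> 1"
    define R where "R = K0 * (real N * real N)"
    have R: "R > 0" unfolding R_def by (rule R_pos[OF N N])
    have eq: "(- t R i - t R i) - (- t R j - t R j) = 2 *\<^sub>R (t R j - t R i)" "(t R i - - t R i) - (t R j - - t R j) = 2 *\<^sub>R (t R i - t R j)" for i j
      by (simp_all add: scaleR_2)
    have "real (card (diag N)) powr recip p0 \<le> K * (real (card {..<N}) powr recip q1 * real (card {..<N}) powr recip q2)"
    proof (rule test[where R = R and x = "t R" and y = "\<lambda>i. - t R i" and y' = "\<lambda>i. - t R i" and z = "t R"])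
      show "composable R {..<N} {..<N} (diag N) (\<lambda>i. - t R i) (\<lambda>i. - t R i)"
        using N diag_ne[OF N] t[OF R] by (auto simp: composable_def in_diag lessThan_empty_iff)
      show "spread R (diag N) (\<lambda>d. t R (fst d)) (\<lambda>d. t R (snd d)) p0 q0 (recip p0)"
        by (rule spread_positionI, force simp: in_diag, rule t[OF R], force simp: in_diag)
      show "spread R {..<N} (t R) (\<lambda>i. - t R i) p1 q1 (recip q1)"
        by (rule spread_frequencyI, unfold eq, rule t2[OF R]) auto
      show "spread R {..<N} (\<lambda>i. - t R i) (t R) p2 q2 (recip q2)"
        by (rule spread_frequencyI, unfold eq, rule t2[OF R]) auto
    qed (simp add: R_def)
    then show "real N powr recip p0 \<le> K * real N powr (recip q1 + recip q2)"
      by (simp add: card_diag powr_add)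
  qed
  \<comment> \<open>A column times one matrix unit. All pairs compose, so there are no cross terms,
    and the product is again a column: frequency exponents appear on both sides.\<close>
  moreover have "recip q0 \<le> recip q1"
  proof (rule power_growth_exponent_le)
    fix N :: nat assume N: "N \<ge> 1"
    define R where "R = K0 * (real N * real 1)"
    have R: "R > 0" unfolding R_def by (rule R_pos[OF N]) simp
    \<comment> \<open>Since y = 0, offsets are governed by x alone; the doubling supplies the
      distance 2R that frequency separation demands.\<close>
    let ?x = "\<lambda>i. 2 *\<^sub>R t R i"
    have eq: "(0 - ?x i) - (0 - ?x j) = 2 *\<^sub>R (t R j - t R i)" for i j
      by (simp add: scaleR_diff_right)
    have "real (card ({..<N} \<times> {0::nat})) powr recip q0 \<le> K * (real (card {..<N}) powr recip q1 * real (card {0::nat}) powr recip q2)"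
    proof (rule test[where R = R and x = ?x and y = "\<lambda>i. 0" and y' = "\<lambda>i. 0" and z = "\<lambda>i. 0"])
      show "spread R ({..<N} \<times> {0::nat}) (\<lambda>d. ?x (fst d)) (\<lambda>d. 0) p0 q0 (recip q0)"
        by (rule spread_frequencyI, unfold eq, rule t2[OF R]) auto
      show "spread R {..<N} ?x (\<lambda>i. 0) p1 q1 (recip q1)"
        by (rule spread_frequencyI, unfold eq, rule t2[OF R]) auto
      \<comment> \<open>A single atom is vacuously separated, and its factor is a power of
        1.\<close>
      show "spread R {0::nat} (\<lambda>i. 0) (\<lambda>i. 0::real ^ 'n) p2 q2 (recip q2)"
        by (rule spread_frequencyI) auto
    qed (use N in \<open>auto simp: R_def composable_def lessThan_empty_iff\<close>)
    then show "real N powr recip q0 \<le> K * real N powr recip q1"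
      by (simp add: card_cartesian_product)
  qed
  \<comment> \<open>The transposed configuration, one matrix unit times a row.\<close>
  moreover have "recip q0 \<le> recip q2"
  proof (rule power_growth_exponent_le)
    fix N :: nat assume N: "N \<ge> 1"
    define R where "R = K0 * (real 1 * real N)"
    have R: "R > 0" unfolding R_def by (rule R_pos[OF _ N]) simp
    let ?z = "\<lambda>i. 2 *\<^sub>R t R i"
    have eq: "(?z i - 0) - (?z j - 0) = 2 *\<^sub>R (t R i - t R j)" for i j
      by (simp add: scaleR_diff_right)
    have "real (card ({0::nat} \<times> {..<N})) powr recip q0 \<le> K * (real (card {0::nat}) powr recip q1 * real (card {..<N}) powr recip q2)"
    proof (rule test[where R = R and x = "\<lambda>i. 0" and y = "\<lambda>i. 0" and y' = "\<lambda>i. 0" and z = ?z])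
      show "spread R ({0::nat} \<times> {..<N}) (\<lambda>d. 0) (\<lambda>d. ?z (snd d)) p0 q0 (recip q0)"
        by (rule spread_frequencyI, unfold eq, rule t2[OF R]) auto
      show "spread R {0::nat} (\<lambda>i. 0) (\<lambda>i. 0::real ^ 'n) p1 q1 (recip q1)"
        by (rule spread_frequencyI) auto
      show "spread R {..<N} (\<lambda>i. 0) ?z p2 q2 (recip q2)"
        by (rule spread_frequencyI, unfold eq, rule t2[OF R]) auto
    qed (use N in \<open>auto simp: R_def composable_def lessThan_empty_iff\<close>)
    then show "real N powr recip q0 \<le> K * real N powr recip q2"
      by (simp add: card_cartesian_product)
  qed
  ultimately show ?thesis
    using assms(1-6) by (auto simp: ennreal_one_divide_recip ennreal_plus[symmetric] intro: ennreal_leI le_of_recip_le simp del: ennreal_plus)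
qed

end
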